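(* Let $X$ be an asymptotic $\ell_1$ space. Let $\gamma\in\Delta(X)$ and let $(y_i)\prec X$ $\Delta$-stabilize $\gamma$. If $Y=[y_i]$ is of $D$-bounded distortion then for any $\alpha<\omega_1$ and $n,m\in\mathbb N$: (a) $D^{-1}(\ddot\delta_\alpha(Y))^n\le\gamma_{\alpha\cdot n}\le(\ddot\delta_\alpha(Y))^n$; (b) $\gamma_{\alpha\cdot n}\gamma_{\alpha\cdot m}\le\gamma_{\alpha\cdot(n+m)}\le D^2\gamma_{\alpha\cdot n}\gamma_{\alpha\cdot m}$.
   Context: Spaces are separable infinite-dimensional Banach spaces; ordinal arithmetic is the usual one. For a basic sequence $(x_i)$, $(y_i)\prec(x_i)$ means that $(y_i)$ is a (finite or infinite) block basis of $(x_i)$; for $X$ with a given basis, $(y_i)\prec X$ means that $(y_i)$ is a block basis of that basis; $[y_i]$ is the closed linear span. Supports are w.r.t. the indicated basic sequence, and $x<y$ means $\max\operatorname{supp}x<\min\operatorname{supp}y$. A space $X$ with a basis $(e_i)$ is asymptotic $\ell_1$ (w.r.t. $(e_i)$) if there is $C$ such that for all $n$ and all finitely supported $e_n\le x_1<\dots<x_n$ (i.e. $n\le\min\operatorname{supp}x_1$), $\|\sum_1^nx_i\|\ge(1/C)\sum_1^n\|x_i\|$. For an equivalent norm $|\cdot|$ on $(Y,\|\cdot\|)$, $d(Y,|\cdot|)=\inf_Z\sup\{|x|/|y|:x,y\in Z,\ \|x\|=\|y\|=1\}$, the infimum over all infinite-dimensional (closed) subspaces $Z$ of $Y$. $Y$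 is of $D$-bounded distortion if for all equivalent norms $|\cdot|$ on $Y$ and all infinite-dimensional subspaces $Z\subseteq Y$, $d(Z,|\cdot|)\le D$. For finite $F,G\subseteq\mathbb N$, $F<G$ means $\max F<\min G$ (or one is empty); $F\ge n$ means $\min F\ge n$. Schreier classes: for sets $\mathcal F,\mathcal G$ of finite subsets of $\mathbb N$, $\mathcal F[\mathcal G]=\{\bigcup_1^nG_i: n\in\mathbb N, G_1<\dots<G_n, G_i\in\mathcal G, (\min G_i)_1^n\in\mathcal F\}$. $\mathcal S_0=\{\{n\}:n\in\mathbb N\}\cup\{\emptyset\}$, $\mathcal S_1=\{F:\min F\ge|F|\}\cup\{\emptyset\}$, $\mathcal S_{\alpha+1}=\mathcal S_1[\mathcal S_\alpha]$, and for a limit ordinal $\alpha<\omega_1$ one fixes $\alpha_n\uparrow\alpha$ and sets $\mathcal S_\alpha=\{F:\text{for some }n,\ F\in\mathcal S_{\alpha_n}\text{ and }F\ge n\}$. A finite block sequence $(y_i)_1^k\prec(x_i)$ is $\alpha$-admissible w.r.t. $(x_i)$ if $(\min\operatorname{supp}(y_i))_{i=1}^k\in\mathcal S_\alpha$. $\delta_\alpha(x_i)$ is the supremum of $\delta\ge0$ such that $\|\sum_1^ky_i\|\ge\delta\sum_1^k\|y_i\|$ for all $(y_i)_1^k\prec(x_i)$ $\alpha$-admissible w.r.t. $(x_i)$; $\delta_\alpha((x_i),|\cdot|)$ is the same quantity for an equivalent norm $|\cdot|$. For $Y=[y_i]$: $\dot\delta_\alpha((y_i),|\cdot|)=\sup\{\delta_\alpha((x_i),|\cdot|):(x_i)\prec(y_i)\}$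 and $\ddot\delta_\alpha(Y)=\sup\{\dot\delta_\alpha((y_i),|\cdot|):|\cdot|\text{ an equivalent norm on }Y\}$. A basic sequence $(x_i)$ $\Delta$-stabilizes $\gamma=(\gamma_\alpha)_{\alpha<\omega_1}\subseteq\mathbb R$ if there exist $\varepsilon_n\downarrow0$ so that for every $\alpha<\omega_1$ there is $m\in\mathbb N$ such that for all $n\ge m$, if $(y_i)\prec(x_i)_n^\infty$ then $|\delta_\alpha(y_i)-\gamma_\alpha|<\varepsilon_n$. $\Delta(X)$ is the set of all $\gamma$ that are $\Delta$-stabilized by some block basis of the basis of $X$. *)

theory Defs
  imports "HOL-Analysis.Analysis" "HOL-Library.Countable_Set_Type"
begin

section \<open>Countable ordinals\<close>

text \<open>
  The ordinals below \<open>\<omega>\<^sub>1\<close>. The facts \<open>countable_less\<close> and \<open>uncountable_UNIV_omega1\<close> below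
  determine this well-order up to isomorphism.
\<close>

lemma cardSuc_natLeq_Card_order: "card_order_on (Field (cardSuc natLeq)) (cardSuc natLeq)"
  by (rule cardSuc_Card_order[OF natLeq_Card_order])

lemma cardSuc_natLeq_well_order: "well_order_on (Field (cardSuc natLeq)) (cardSuc natLeq)"
  using cardSuc_natLeq_Card_order by (simp add: card_order_on_def)

typedef omega1 = "Field (cardSuc natLeq)"
proof -
  have "infinite (Field (cardSuc natLeq))"
    by (simp add: cardSuc_finite[OF natLeq_Card_order] Field_natLeq)
  then show ?thesis
    by (metis ex_in_conv finite.emptyI)
qed

instantiation omega1 :: wellorder
begin

definition less_eq_omega1 :: "omega1 \<Rightarrow> omega1 \<Rightarrow> bool" where
  "\<alpha> \<le> \<beta> \<longleftrightarrow> (Rep_omega1 \<alpha>, Rep_omega1 \<beta>) \<in> cardSuc natLeq"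

definition less_omega1 :: "omega1 \<Rightarrow> omega1 \<Rightarrow> bool" where
  "\<alpha> < \<beta> \<longleftrightarrow> \<alpha> \<le> \<beta> \<and> \<not> \<beta> \<le> (\<alpha>::omega1)"

instance
proof
  let ?r = "cardSuc natLeq"
  have lin: "refl_on (Field ?r) ?r" "trans ?r" "antisym ?r" "total_on (Field ?r) ?r"
    and wf: "wf (?r - Id)"
    using cardSuc_natLeq_well_order
    by (auto simp: well_order_on_def linear_order_on_def partial_order_on_def preorder_on_def)
  fix x y z :: omega1
  show "x < y \<longleftrightarrow> x \<le> y \<and> \<not> y \<le> x"
    by (simp add: less_omega1_def)
  show refl: "x \<le> x" for x :: omega1
    unfolding less_eq_omega1_def using lin(1) Rep_omega1 by (auto dest: refl_onD)
  show "x \<le> y \<Longrightarrow> y \<le> z \<Longrightarrow> x \<le> z"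
    unfolding less_eq_omega1_def using lin(2) by (meson transD)
  show anti: "x \<le> y \<Longrightarrow> y \<le> x \<Longrightarrow> x = y" for x y :: omega1
    unfolding less_eq_omega1_def using lin(3) by (meson Rep_omega1_inject antisymD)
  show "x \<le> y \<or> y \<le> x"
  proof (cases "x = y")
    case False
    then show ?thesis
      unfolding less_eq_omega1_def using lin(4) Rep_omega1 Rep_omega1_inject
      by (auto simp: total_on_def)
  qed (simp add: refl)
  fix P :: "omega1 \<Rightarrow> bool" and c :: omega1
  assume step: "\<And>x. (\<And>y. y < x \<Longrightarrow> P y) \<Longrightarrow> P x"
  have "wf {(u, v::omega1). u < v}"
    by (rule wf_subset[OF wf_inv_image[OF wf, of Rep_omega1]])
      (auto simp: inv_image_def less_omega1_def less_eq_omega1_def Rep_omega1_inject)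
  then show "P c"
    by (induction c rule: wf_induct_rule) (use step in auto)
qed

end

lemma countable_less:
  includes cardinal_syntax
  shows "countable {\<beta>. \<beta> < (\<alpha>::omega1)}"
proof -
  let ?r = "cardSuc natLeq"
  have "|underS ?r (Rep_omega1 \<alpha>)| <o ?r"
    by (intro card_of_underS Rep_omega1 cardSuc_natLeq_Card_order)
  then have "|underS ?r (Rep_omega1 \<alpha>)| \<le>o natLeq"
    using cardSuc_ordLeq_ordLess[OF natLeq_Card_order card_of_Card_order] by blast
  then have c: "countable (underS ?r (Rep_omega1 \<alpha>))"
    by (simp add: countable_card_le_natLeq)
  have "Rep_omega1 ` {\<beta>. \<beta> < \<alpha>} \<subseteq> underS ?r (Rep_omega1 \<alpha>)"
    by (auto simp: underS_def less_le less_eq_omega1_def Rep_omega1_inject)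
  then have "countable (Rep_omega1 ` {\<beta>. \<beta> < \<alpha>})"
    using c countable_subset by blast
  then show ?thesis
    by (rule countable_image_inj_on) (simp add: inj_on_def Rep_omega1_inject)
qed

lemma uncountable_UNIV_omega1:
  includes cardinal_syntax
  shows "uncountable (UNIV :: omega1 set)"
proof
  assume "countable (UNIV :: omega1 set)"
  then have "countable (range Rep_omega1)" by blast
  then have "|Field (cardSuc natLeq)| \<le>o natLeq"
    by (simp add: countable_card_le_natLeq type_definition.Rep_range[OF type_definition_omega1])
  then have "cardSuc natLeq \<le>o natLeq"
    using card_of_Field_ordIso[OF cardSuc_natLeq_Card_order] ordIso_ordLeq_trans ordIso_symmetric
    by blast
  then show False
    using cardSuc_greater[OF natLeq_Card_order] not_ordLess_ordLeq by blast
qed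

lemma countable_imp_bounded_omega1:
  assumes "countable (A :: omega1 set)"
  obtains \<gamma> where "\<And>\<alpha>. \<alpha> \<in> A \<Longrightarrow> \<alpha> < \<gamma>"
proof -
  let ?U = "\<Union>\<alpha>\<in>A. insert \<alpha> {\<beta>. \<beta> < \<alpha>}"
  have "countable ?U"
    by (intro countable_UN assms countable_insert countable_less)
  then have "?U \<noteq> UNIV"
    using uncountable_UNIV_omega1 by metis
  then obtain \<gamma> where \<gamma>: "\<gamma> \<notin> ?U"
    by blast
  show ?thesis
  proof (rule that)
    fix \<alpha> assume "\<alpha> \<in> A"
    then have "\<gamma> \<noteq> \<alpha>" "\<not> \<gamma> < \<alpha>"
      using \<gamma> by auto
    then show "\<alpha> < \<gamma>" by simp
  qed
qed

function oadd :: "omega1 \<Rightarrow> omega1 \<Rightarrow> omega1" where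
  "oadd \<alpha> \<beta> = (LEAST \<gamma>. \<alpha> \<le> \<gamma> \<and> (\<forall>\<beta>'<\<beta>. oadd \<alpha> \<beta>' < \<gamma>))"
  by auto
termination
  by (relation "inv_image {(\<beta>, \<beta>'). \<beta> < \<beta>'} snd") (auto intro: wf)

declare oadd.simps [simp del]

instantiation omega1 :: "{zero, one, plus}"
begin

definition zero_omega1 :: omega1 where "0 = (LEAST \<alpha>::omega1. True)"
definition one_omega1 :: omega1 where "1 = (LEAST \<alpha>::omega1. 0 < \<alpha>)"
definition plus_omega1 :: "omega1 \<Rightarrow> omega1 \<Rightarrow> omega1" where "\<alpha> + \<beta> = oadd \<alpha> \<beta>"

instance ..

end

text \<open>\<open>omul \<alpha> n\<close> is \<open>\<alpha> \<cdot> n\<close>, that is, \<open>\<alpha> + \<dots> + \<alpha>\<close> (\<open>n\<close> times).\<close>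

primrec omul :: "omega1 \<Rightarrow> nat \<Rightarrow> omega1" where
  "omul \<alpha> 0 = 0"
| "omul \<alpha> (Suc n) = omul \<alpha> n + \<alpha>"

definition limit_ordinal :: "omega1 \<Rightarrow> bool" where
  "limit_ordinal \<alpha> \<longleftrightarrow> \<alpha> \<noteq> 0 \<and> (\<forall>\<beta><\<alpha>. \<beta> + 1 < \<alpha>)"

lemma zero_le_omega1 [simp]: "0 \<le> (\<alpha>::omega1)"
  unfolding zero_omega1_def by (rule Least_le) simp

lemma not_less_zero_omega1 [simp]: "\<not> \<alpha> < (0::omega1)"
  by (simp add: not_less)

lemma ex_greater_omega1: "\<exists>\<gamma>. (\<alpha>::omega1) < \<gamma>"
  using countable_imp_bounded_omega1[of "{\<alpha>}"] by auto

lemma less_one_omega1: "\<alpha> < 1 \<longleftrightarrow> \<alpha> = (0::omega1)"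
proof -
  have "(0::omega1) < 1"
    unfolding one_omega1_def using ex_greater_omega1[of 0] by (rule LeastI_ex)
  moreover have "1 \<le> \<alpha>" if "\<alpha> \<noteq> 0"
    unfolding one_omega1_def by (rule Least_le) (use that zero_le_omega1[of \<alpha>] in \<open>simp add: less_le\<close>)
  ultimately show ?thesis by force
qed

lemma plus_omega1_eq: "\<alpha> + \<beta> = (LEAST \<gamma>::omega1. \<alpha> \<le> \<gamma> \<and> (\<forall>\<beta>'<\<beta>. \<alpha> + \<beta>' < \<gamma>))"
  unfolding plus_omega1_def by (subst oadd.simps) simp

lemma plus_omega1_bounds:
  shows "\<alpha> \<le> \<alpha> + (\<beta>::omega1)" and "\<And>\<beta>'. \<beta>' < \<beta> \<Longrightarrow> \<alpha> + \<beta>' < \<alpha> + \<beta>"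
proof -
  have "countable (insert \<alpha> ((\<lambda>\<beta>'. \<alpha> + \<beta>') ` {\<beta>'. \<beta>' < \<beta>}))"
    by (intro countable_insert countable_image countable_less)
  then obtain \<gamma> where "\<And>\<delta>. \<delta> \<in> insert \<alpha> ((\<lambda>\<beta>'. \<alpha> + \<beta>') ` {\<beta>'. \<beta>' < \<beta>}) \<Longrightarrow> \<delta> < \<gamma>"
    using countable_imp_bounded_omega1 by blast
  then have "\<exists>\<gamma>. \<alpha> \<le> \<gamma> \<and> (\<forall>\<beta>'<\<beta>. \<alpha> + \<beta>' < \<gamma>)"
    by (intro exI[of _ \<gamma>]) (auto intro: less_imp_le)
  from LeastI_ex[OF this, folded plus_omega1_eq]
  show "\<alpha> \<le> \<alpha> + \<beta>" "\<And>\<beta>'. \<beta>' < \<beta> \<Longrightarrow> \<alpha> + \<beta>' < \<alpha> + \<beta>" by auto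
qed

lemma plus_omega1_le: "\<alpha> \<le> \<gamma> \<Longrightarrow> (\<And>\<beta>'. \<beta>' < \<beta> \<Longrightarrow> \<alpha> + \<beta>' < \<gamma>) \<Longrightarrow> \<alpha> + \<beta> \<le> (\<gamma>::omega1)"
  by (subst plus_omega1_eq) (auto intro: Least_le)

lemma plus_zero_omega1 [simp]: "\<alpha> + 0 = (\<alpha>::omega1)"
  by (intro antisym plus_omega1_le plus_omega1_bounds(1)) auto

lemma less_plus_one_omega1: "\<beta> < \<alpha> + 1 \<longleftrightarrow> \<beta> \<le> (\<alpha>::omega1)"
proof
  show "\<beta> < \<alpha> + 1" if "\<beta> \<le> \<alpha>"
    using that plus_omega1_bounds(2)[of 0 1 \<alpha>] by (simp add: less_one_omega1)
  show "\<beta> \<le> \<alpha>" if "\<beta> < \<alpha> + 1"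
    using that plus_omega1_le[of \<alpha> \<beta> 1] by (fastforce simp: less_one_omega1)
qed

lemma plus_one_inject_omega1: "\<alpha> + 1 = \<beta> + 1 \<longleftrightarrow> \<alpha> = (\<beta>::omega1)"
  using less_plus_one_omega1[of \<alpha> \<beta>] less_plus_one_omega1[of \<beta> \<alpha>]
    less_plus_one_omega1[of \<alpha> \<alpha>] less_plus_one_omega1[of \<beta> \<beta>] by (auto intro: antisym)

lemma plus_one_neq_zero_omega1: "\<alpha> + 1 \<noteq> (0::omega1)"
  using less_plus_one_omega1[of \<alpha> \<alpha>] by auto

text \<open>The usual recursion equations for ordinal addition.\<close>

lemma plus_Suc_omega1: "\<alpha> + (\<beta> + 1) = (\<alpha> + \<beta>) + (1::omega1)"
proof (rule antisym)
  show "\<alpha> + (\<beta> + 1) \<le> (\<alpha> + \<beta>) + 1"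
  proof (rule plus_omega1_le)
    show "\<alpha> \<le> (\<alpha> + \<beta>) + 1"
      using plus_omega1_bounds(1) order_trans by blast
    show "\<alpha> + \<beta>' < (\<alpha> + \<beta>) + 1" if "\<beta>' < \<beta> + 1" for \<beta>'
      using that plus_omega1_bounds(2)[of \<beta>' \<beta> \<alpha>] by (auto simp: less_plus_one_omega1 le_less)
  qed
  show "(\<alpha> + \<beta>) + 1 \<le> \<alpha> + (\<beta> + 1)"
  proof -
    have "\<alpha> + \<beta> < \<alpha> + (\<beta> + 1)"
      by (rule plus_omega1_bounds(2)) (simp add: less_plus_one_omega1)
    then show ?thesis
      using less_plus_one_omega1[of "\<alpha> + (\<beta> + 1)" "\<alpha> + \<beta>"] by (meson leD not_le_imp_less)
  qed
qed

lemma plus_limit_omega1: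
  assumes "limit_ordinal \<beta>"
  shows "\<alpha> + \<beta> = (LEAST \<gamma>. \<forall>\<beta>'<\<beta>. \<alpha> + \<beta>' \<le> \<gamma>)"
proof (rule Least_equality[symmetric])
  show "\<forall>\<beta>'<\<beta>. \<alpha> + \<beta>' \<le> \<alpha> + \<beta>"
    by (auto intro: less_imp_le plus_omega1_bounds(2))
  fix \<gamma> assume \<gamma>: "\<forall>\<beta>'<\<beta>. \<alpha> + \<beta>' \<le> \<gamma>"
  show "\<alpha> + \<beta> \<le> \<gamma>"
  proof (rule plus_omega1_le)
    have "0 < \<beta>"
      using assms zero_le_omega1[of \<beta>] by (auto simp: limit_ordinal_def less_le)
    then show "\<alpha> \<le> \<gamma>"
      using \<gamma>[rule_format, of 0] by simp
    show "\<alpha> + \<beta>' < \<gamma>" if "\<beta>' < \<beta>" for \<beta>'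
    proof -
      have "\<alpha> + \<beta>' < \<alpha> + (\<beta>' + 1)"
        by (rule plus_omega1_bounds(2)) (simp add: less_plus_one_omega1)
      also have "\<dots> \<le> \<gamma>"
        using \<gamma> that assms by (simp add: limit_ordinal_def)
      finally show ?thesis .
    qed
  qed
qed

lemma omega1_cases:
  obtains (zero) "\<alpha> = 0" | (suc) \<beta> where "\<alpha> = \<beta> + 1" | (limit) "limit_ordinal \<alpha>"
proof (cases "\<alpha> = 0 \<or> limit_ordinal \<alpha>")
  case False
  then obtain \<beta> where "\<beta> < \<alpha>" "\<not> \<beta> + 1 < \<alpha>"
    unfolding limit_ordinal_def by blast
  then have "\<alpha> = \<beta> + 1"
    using less_plus_one_omega1[of \<alpha> \<beta>] by force
  then show ?thesis by (rule suc)
qed (use zero limit in blast)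

lemma limit_ordinal_simps [simp]: "\<not> limit_ordinal 0" "\<not> limit_ordinal (\<alpha> + 1)"
proof -
  show "\<not> limit_ordinal 0"
    by (simp add: limit_ordinal_def)
  have "\<alpha> < \<alpha> + 1"
    by (simp add: less_plus_one_omega1)
  then show "\<not> limit_ordinal (\<alpha> + 1)"
    unfolding limit_ordinal_def by blast
qed


section \<open>Schreier classes\<close>

text \<open>
  Throughout, \<open>\<nat>\<close> is the set of positive integers, so the members of the Schreier classes are
  finite sets of \<open>nat\<close> not containing \<open>0\<close>.
\<close>

definition schreier0 :: "nat set set" where
  "schreier0 = {{n} | n. 1 \<le> n} \<union> {{}}"

definition schreier1 :: "nat set set" where
  "schreier1 = {F. finite F \<and> F \<noteq> {} \<and> card F \<le> Min F} \<union> {{}}"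

text \<open>
  \<open>\<F>[\<G>]\<close>. Empty sets are dropped from the lists \<open>G\<^sub>1 < \<dots> < G\<^sub>n\<close>, since they have no minimum and do
  not contribute to the union; the list itself may be empty.
\<close>

definition family_compose :: "nat set set \<Rightarrow> nat set set \<Rightarrow> nat set set" where
  "family_compose \<F> \<G> =
     {\<Union>(set Gs) | Gs. (\<forall>G\<in>set Gs. G \<in> \<G> \<and> G \<noteq> {}) \<and>
        sorted_wrt (\<lambda>G H. Max G < Min H) Gs \<and> Min ` set Gs \<in> \<F>}"

text \<open>
  The choice of sequences \<open>\<alpha>\<^sub>n \<up> \<alpha>\<close> for all limit ordinals \<open>\<alpha> < \<omega>\<^sub>1\<close> is a parameter \<open>a\<close>,
  with \<open>\<alpha>\<^sub>n = a \<alpha> n\<close>.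
\<close>

definition fundamental_sequences :: "(omega1 \<Rightarrow> nat \<Rightarrow> omega1) \<Rightarrow> bool" where
  "fundamental_sequences a \<longleftrightarrow>
     (\<forall>\<alpha>. limit_ordinal \<alpha> \<longrightarrow>
        incseq (a \<alpha>) \<and> (\<forall>n. a \<alpha> n < \<alpha>) \<and> (\<forall>\<beta><\<alpha>. \<exists>n. \<beta> < a \<alpha> n))"

lemma plus_one_THE_omega1: "(THE \<gamma>. \<beta> + 1 = \<gamma> + (1::omega1)) = \<beta>"
  by (simp add: plus_one_inject_omega1)

text \<open>
  The conjunct \<open>a \<alpha> n < \<alpha>\<close> only ensures termination for arbitrary \<open>a\<close>. The defining equations of the
  Schreier classes are restated as \<open>schreier_zero\<close>, \<open>schreier_Suc\<close> and \<open>schreier_limit\<close> below.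
\<close>

context
  notes conj_cong [fundef_cong]
begin

function schreier :: "(omega1 \<Rightarrow> nat \<Rightarrow> omega1) \<Rightarrow> omega1 \<Rightarrow> nat set set" where
  "schreier a \<alpha> =
     (if \<alpha> = 0 then schreier0
      else if limit_ordinal \<alpha>
        then {F. \<exists>n\<ge>1. a \<alpha> n < \<alpha> \<and> F \<in> schreier a (a \<alpha> n) \<and> (\<forall>i\<in>F. n \<le> i)}
      else family_compose schreier1 (schreier a (THE \<beta>. \<alpha> = \<beta> + 1)))"
  by auto
termination
proof (relation "inv_image {(\<beta>, \<beta>'). \<beta> < \<beta>'} snd")
  fix a :: "omega1 \<Rightarrow> nat \<Rightarrow> omega1" and \<alpha> :: omega1
  assume "\<alpha> \<noteq> 0" "\<not> limit_ordinal \<alpha>"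
  then obtain \<beta> where "\<alpha> = \<beta> + 1"
    using omega1_cases by blast
  then show "((a, THE \<beta>. \<alpha> = \<beta> + 1), a, \<alpha>) \<in> inv_image {(\<beta>, \<beta>'). \<beta> < \<beta>'} snd"
    by (simp add: plus_one_THE_omega1 less_plus_one_omega1)
qed (auto intro: wf)

end

declare schreier.simps [simp del]

lemma schreier_zero: "schreier a 0 = schreier0"
  by (subst schreier.simps) simp

lemma schreier_Suc: "schreier a (\<alpha> + 1) = family_compose schreier1 (schreier a \<alpha>)"
  by (subst schreier.simps) (simp add: plus_one_neq_zero_omega1 plus_one_THE_omega1)

lemma schreier_limit:
  assumes "fundamental_sequences a" "limit_ordinal \<alpha>"
  shows "schreier a \<alpha> = {F. \<exists>n\<ge>1. F \<in> schreier a (a \<alpha> n) \<and> (\<forall>i\<in>F. n \<le> i)}"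
  using assms by (subst schreier.simps) (auto simp: fundamental_sequences_def)

lemma schreier_one: "schreier a 1 = schreier1"
proof -
  have "(0::omega1) + 1 = 1"
  proof (rule antisym)
    show "(0::omega1) + 1 \<le> 1"
      by (rule plus_omega1_le) (simp_all add: less_one_omega1)
    show "(1::omega1) \<le> 0 + 1"
      using less_one_omega1[of "0 + 1"] plus_one_neq_zero_omega1[of 0] not_less by blast
  qed
  then have eq: "schreier a 1 = family_compose schreier1 schreier0"
    using schreier_Suc[of a 0] by (simp add: schreier_zero)
  have "\<Union>(set Gs) = Min ` set Gs" if "\<forall>G\<in>set Gs. G \<in> schreier0 \<and> G \<noteq> {}" for Gs
    using that by (induction Gs) (auto simp: schreier0_def)
  then have "family_compose schreier1 schreier0 \<subseteq> schreier1"
    by (auto simp: family_compose_def)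
  moreover have "F \<in> family_compose schreier1 schreier0" if F: "F \<in> schreier1" for F
  proof -
    let ?Gs = "map (\<lambda>i. {i}) (sorted_list_of_set F)"
    have fin: "finite F"
      using F by (auto simp: schreier1_def)
    have pos: "1 \<le> i" if "i \<in> F" for i
    proof -
      have "1 \<le> card F" "card F \<le> Min F" "Min F \<le> i"
        using F that fin card_gt_0_iff[of F] by (auto simp: schreier1_def Suc_le_eq)
      then show ?thesis by linarith
    qed
    have "sorted_wrt (\<lambda>G H. Max G < Min H) ?Gs"
      using strict_sorted_list_of_set[of F] by (simp add: sorted_wrt_map)
    moreover have "\<forall>G\<in>set ?Gs. G \<in> schreier0 \<and> G \<noteq> {}"
      using fin pos by (auto simp: schreier0_def)
    moreover have "Min ` set ?Gs = F" "\<Union>(set ?Gs) = F"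
      using fin by (auto simp: image_image)
    ultimately show ?thesis
      unfolding family_compose_def using F by (intro CollectI exI[of _ ?Gs]) simp
  qed
  ultimately show ?thesis
    using eq by blast
qed

lemma fundamental_sequences_exist: "\<exists>a. fundamental_sequences a"
proof -
  have "\<exists>f. incseq f \<and> (\<forall>n. f n < \<alpha>) \<and> (\<forall>\<beta><\<alpha>. \<exists>n. \<beta> < f n)" if lim: "limit_ordinal \<alpha>" for \<alpha>
  proof -
    let ?A = "{\<beta>. \<beta> < \<alpha>}"
    define f where "f n = Max (from_nat_into ?A ` {..n})" for n :: nat
    have "0 < \<alpha>"
      using lim zero_le_omega1[of \<alpha>] by (auto simp: limit_ordinal_def less_le)
    then have ne: "?A \<noteq> {}" by blast
    have "incseq f"
      unfolding f_def by (intro monoI Max_mono) auto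
    moreover have "f n < \<alpha>" for n
      unfolding f_def using from_nat_into[OF ne] by (subst Max_less_iff) auto
    moreover have "\<exists>n. \<beta> < f n" if "\<beta> < \<alpha>" for \<beta>
    proof -
      have "\<beta> + 1 \<in> ?A"
        using lim that by (auto simp: limit_ordinal_def)
      then obtain n where "from_nat_into ?A n = \<beta> + 1"
        using from_nat_into_surj[OF countable_less] by blast
      moreover have "from_nat_into ?A n \<le> f n"
        unfolding f_def by (intro Max_ge) auto
      moreover have "\<beta> < \<beta> + 1"
        by (simp add: less_plus_one_omega1)
      ultimately have "\<beta> < f n"
        by simp
      then show ?thesis ..
    qed
    ultimately show ?thesis by blast
  qed
  then have "\<forall>\<alpha>. \<exists>f. limit_ordinal \<alpha> \<longrightarrow>
      incseq f \<and> (\<forall>n. f n < \<alpha>) \<and> (\<forall>\<beta><\<alpha>. \<exists>n. \<beta> < f n)"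
    by blast
  from choice[OF this] show ?thesis
    unfolding fundamental_sequences_def .
qed

section \<open>Bases, supports and block bases\<close>

text \<open>
  A sequence \<open>(x\<^sub>i)\<close>, \<open>i = 1, 2, \<dots>\<close>, is represented by \<open>x :: nat \<Rightarrow> 'a\<close> with \<open>x\<^sub>i = x (i - 1)\<close>.
  Supports are sets of positive integers.
\<close>

definition closed_span :: "(nat \<Rightarrow> 'a::real_normed_vector) \<Rightarrow> 'a set" where
  "closed_span x = closure (span (range x))"

definition schauder_basis :: "(nat \<Rightarrow> 'a::real_normed_vector) \<Rightarrow> bool" where
  "schauder_basis e \<longleftrightarrow> (\<forall>v. \<exists>!c. (\<lambda>i. c i *\<^sub>R e i) sums v)"

text \<open>
  The coordinates and supports below are meant for basic sequences, i.e. sequences \<open>x\<close> that are a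
  Schauder basis of \<open>closed_span x\<close>, and \<open>v \<in> closed_span x\<close>.
\<close>

definition coordinates :: "(nat \<Rightarrow> 'a::real_normed_vector) \<Rightarrow> 'a \<Rightarrow> nat \<Rightarrow> real" where
  "coordinates x v = (THE c. (\<lambda>i. c i *\<^sub>R x i) sums v)"

definition supp :: "(nat \<Rightarrow> 'a::real_normed_vector) \<Rightarrow> 'a \<Rightarrow> nat set" where
  "supp x v = {Suc i | i. coordinates x v i \<noteq> 0}"

definition block_vector :: "(nat \<Rightarrow> 'a::real_normed_vector) \<Rightarrow> 'a \<Rightarrow> bool" where
  "block_vector x v \<longleftrightarrow> v \<in> closed_span x \<and> v \<noteq> 0 \<and> finite (supp x v)"

definition block_less :: "(nat \<Rightarrow> 'a::real_normed_vector) \<Rightarrow> 'a \<Rightarrow> 'a \<Rightarrow> bool" where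
  "block_less x u v \<longleftrightarrow> Max (supp x u) < Min (supp x v)"

text \<open>\<open>(y\<^sub>i) \<prec> (x\<^sub>i)\<close> for a finite sequence and for an infinite sequence \<open>(y\<^sub>i)\<close>, respectively.\<close>

definition finite_block_basis :: "'a list \<Rightarrow> (nat \<Rightarrow> 'a::real_normed_vector) \<Rightarrow> bool" where
  "finite_block_basis ys x \<longleftrightarrow> (\<forall>y\<in>set ys. block_vector x y) \<and> sorted_wrt (block_less x) ys"

definition block_basis :: "(nat \<Rightarrow> 'a) \<Rightarrow> (nat \<Rightarrow> 'a::real_normed_vector) \<Rightarrow> bool" where
  "block_basis y x \<longleftrightarrow> (\<forall>i. block_vector x (y i)) \<and> (\<forall>i. block_less x (y i) (y (Suc i)))"

definition asymptotic_l1 :: "(nat \<Rightarrow> 'a::real_normed_vector) \<Rightarrow> bool" where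
  "asymptotic_l1 e \<longleftrightarrow>
     (\<exists>C>0. \<forall>xs. xs \<noteq> [] \<and> finite_block_basis xs e \<and> length xs \<le> Min (supp e (hd xs)) \<longrightarrow>
        norm (\<Sum>x\<leftarrow>xs. x) \<ge> 1 / C * (\<Sum>x\<leftarrow>xs. norm x))"

section \<open>Equivalent norms and distortion\<close>

text \<open>Nonnegativity and definiteness follow from the lower estimate.\<close>

definition equivalent_norm :: "'a::real_normed_vector set \<Rightarrow> ('a \<Rightarrow> real) \<Rightarrow> bool" where
  "equivalent_norm Y p \<longleftrightarrow>
     (\<forall>u\<in>Y. \<forall>v\<in>Y. p (u + v) \<le> p u + p v) \<and>
     (\<forall>u\<in>Y. \<forall>t. p (t *\<^sub>R u) = \<bar>t\<bar> * p u) \<and>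
     (\<exists>c>0. \<exists>C>0. \<forall>u\<in>Y. c * norm u \<le> p u \<and> p u \<le> C * norm u)"

definition inf_dim_subspace :: "'a::real_normed_vector set \<Rightarrow> bool" where
  "inf_dim_subspace Z \<longleftrightarrow> subspace Z \<and> closed Z \<and> \<not> (\<exists>B. finite B \<and> Z \<subseteq> span B)"

text \<open>\<open>d(Y, |\<cdot>|)\<close> with \<open>|\<cdot>| = p\<close>.\<close>

definition distortion :: "'a::real_normed_vector set \<Rightarrow> ('a \<Rightarrow> real) \<Rightarrow> real" where
  "distortion Y p =
     (INF Z\<in>{Z. inf_dim_subspace Z \<and> Z \<subseteq> Y}.
        Sup {p u / p v | u v. u \<in> Z \<and> v \<in> Z \<and> norm u = 1 \<and> norm v = 1})"

definition bounded_distortion :: "real \<Rightarrow> 'a::real_normed_vector set \<Rightarrow> bool" where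
  "bounded_distortion D Y \<longleftrightarrow>
     (\<forall>p Z. equivalent_norm Y p \<and> inf_dim_subspace Z \<and> Z \<subseteq> Y \<longrightarrow> distortion Z p \<le> D)"

section \<open>The asymptotic constants\<close>

definition admissible ::
  "(omega1 \<Rightarrow> nat \<Rightarrow> omega1) \<Rightarrow> omega1 \<Rightarrow> (nat \<Rightarrow> 'a::real_normed_vector) \<Rightarrow> 'a list \<Rightarrow> bool" where
  "admissible a \<alpha> x ys \<longleftrightarrow>
     finite_block_basis ys x \<and> (\<lambda>y. Min (supp x y)) ` set ys \<in> schreier a \<alpha>"

definition delta ::
  "(omega1 \<Rightarrow> nat \<Rightarrow> omega1) \<Rightarrow> omega1 \<Rightarrow> (nat \<Rightarrow> 'a::real_normed_vector) \<Rightarrow> ('a \<Rightarrow> real) \<Rightarrow> real"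
  where
  "delta a \<alpha> x p =
     Sup {\<delta>. \<delta> \<ge> 0 \<and> (\<forall>ys. admissible a \<alpha> x ys \<longrightarrow> p (\<Sum>y\<leftarrow>ys. y) \<ge> \<delta> * (\<Sum>y\<leftarrow>ys. p y))}"

text \<open>
  In the suprema below and in \<open>Delta_stabilizes\<close>, block bases are infinite: a block basis of length
  one would trivially have all constants equal to \<open>1\<close>.
\<close>

definition delta_dot ::
  "(omega1 \<Rightarrow> nat \<Rightarrow> omega1) \<Rightarrow> omega1 \<Rightarrow> (nat \<Rightarrow> 'a::real_normed_vector) \<Rightarrow> ('a \<Rightarrow> real) \<Rightarrow> real"
  where
  "delta_dot a \<alpha> y p = (SUP x\<in>{x. block_basis x y}. delta a \<alpha> x p)"

text \<open>\<open>delta_ddot a \<alpha> y\<close> is the constant for the space \<open>Y = [y\<^sub>i]\<close> with its basis \<open>(y\<^sub>i)\<close>.\<close>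

definition delta_ddot ::
  "(omega1 \<Rightarrow> nat \<Rightarrow> omega1) \<Rightarrow> omega1 \<Rightarrow> (nat \<Rightarrow> 'a::real_normed_vector) \<Rightarrow> real" where
  "delta_ddot a \<alpha> y = (SUP p\<in>{p. equivalent_norm (closed_span y) p}. delta_dot a \<alpha> y p)"

text \<open>\<open>tail n x\<close> is \<open>(x\<^sub>i)\<close>, \<open>i \<ge> n\<close>, for \<open>n \<ge> 1\<close>; recall \<open>x\<^sub>i = x (i - 1)\<close>.\<close>

definition tail :: "nat \<Rightarrow> (nat \<Rightarrow> 'a) \<Rightarrow> nat \<Rightarrow> 'a" where
  "tail n x = (\<lambda>i. x (i + (n - 1)))"

definition Delta_stabilizes ::
  "(omega1 \<Rightarrow> nat \<Rightarrow> omega1) \<Rightarrow> (nat \<Rightarrow> 'a::real_normed_vector) \<Rightarrow> (omega1 \<Rightarrow> real) \<Rightarrow> bool" where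
  "Delta_stabilizes a x \<gamma> \<longleftrightarrow>
     (\<exists>\<epsilon> :: nat \<Rightarrow> real. decseq \<epsilon> \<and> \<epsilon> \<longlonglongrightarrow> 0 \<and>
        (\<forall>\<alpha>. \<exists>m\<ge>1. \<forall>n\<ge>m. \<forall>y. block_basis y (tail n x) \<longrightarrow> \<bar>delta a \<alpha> y norm - \<gamma> \<alpha>\<bar> < \<epsilon> n))"

definition Delta_set ::
  "(omega1 \<Rightarrow> nat \<Rightarrow> omega1) \<Rightarrow> (nat \<Rightarrow> 'a::real_normed_vector) \<Rightarrow> (omega1 \<Rightarrow> real) set" where
  "Delta_set a e = {\<gamma>. \<exists>x. block_basis x e \<and> Delta_stabilizes a x \<gamma>}"

end

theory Submission
  imports Defs
begin

text \<open>
  Up to passing to subsequences, \<open>\<S>\<^sub>\<alpha>\<^sub>+\<^sub>\<beta>\<close> and \<open>\<S>\<^sub>\<beta>[\<S>\<^sub>\<alpha>]\<close> embed into each other, so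
  lower estimates multiply: \<open>\<gamma>\<^sub>\<alpha>\<gamma>\<^sub>\<beta> \<le> \<gamma>\<^sub>\<alpha>\<^sub>+\<^sub>\<beta>\<close>, and a lower \<open>\<alpha>\<close>-estimate \<open>\<delta>\<close> for an
  equivalent norm gives a lower \<open>\<alpha>\<cdot>n\<close>-estimate \<open>\<delta>\<^sup>n\<close>. By bounded distortion that norm is, up to a
  factor arbitrarily close to \<open>D\<close>, a multiple of the given norm on some block subspace; this is the
  lower bound in (a). For the upper bound, let \<open>A\<^sub>k\<close> be the \<open>k\<close>-fold composition of \<open>\<S>\<^sub>\<alpha>\<close>
  and let \<open>h\<^sub>k(u)\<close> be the supremum of \<open>\<Sum>\<parallel>E\<^sub>i u\<parallel>\<close> over successive intervals
  \<open>E\<^sub>i\<close> whose minima form a set in \<open>A\<^sub>k\<close>. Then \<open>\<Sum>\<^sub>k\<^sub><\<^sub>n \<eta>\<^sup>k h\<^sub>k\<close> with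
  \<open>\<eta>\<^sup>n = \<theta>/2K\<^sup>2\<close>, where \<open>K\<close> is the basis constant, is an equivalent norm with lower
  \<open>\<alpha>\<close>-estimate \<open>\<eta>\<close> as soon as the given norm has the lower \<open>\<alpha>\<cdot>n\<close>-estimate \<open>\<theta>\<close>.
  The constant \<open>2K\<^sup>2\<close> disappears when this is applied to \<open>\<alpha>\<cdot>nk\<close> and \<open>k\<close> tends to infinity.
  The upper bound in (b) is immediate from (a).
\<close>

section \<open>Regular families\<close>

text \<open>The Schreier classes depend on the chosen fundamental sequences, so they match
  compositions only along subsequences. This costs nothing: block bases move index sets to the
  right, so lower estimates pass to block bases, and the stabilized values are read off from tails
  of arbitrary block bases of y. Every estimate may therefore be proved on a further block basis.
  Inside the renorming, however, the sums of level k and k+1 have to be linked on one fixed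
  sequence. The classes of \<alpha>\<cdot>k and \<alpha>\<cdot>(k+1) do not provide this; the exact
  compositional powers do, and only the last of them is compared with a Schreier class. The new norm
  is found on a block subspace, whereas the supremum in (a) refers to norms on all of Y, so it has
  to be extended. All block bases share the basis constant K. The loss in the upper bound is thus
  the same for every exponent, and \<gamma> at \<alpha>\<cdot>n, raised to the k, is at most
  \<gamma> at \<alpha>\<cdot>nk; comparing k-th powers removes the loss.\<close>

definition regular_family :: "nat set set \<Rightarrow> bool" where
  "regular_family S \<longleftrightarrow> (\<forall>F\<in>S. finite F \<and> 0 \<notin> F) \<and> (\<forall>F\<in>S. \<forall>G\<subseteq>F. G \<in> S) \<and>
     (\<forall>F\<in>S. \<forall>h. strict_mono_on F h \<and> (\<forall>f\<in>F. f \<le> h f) \<longrightarrow> h ` F \<in> S) \<and>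
     (\<forall>n\<ge>1. {n} \<in> S)"

lemma regular_finite: "regular_family S \<Longrightarrow> F \<in> S \<Longrightarrow> finite F"
  and regular_zero: "regular_family S \<Longrightarrow> F \<in> S \<Longrightarrow> 0 \<notin> F"
  and regular_subset: "regular_family S \<Longrightarrow> F \<in> S \<Longrightarrow> G \<subseteq> F \<Longrightarrow> G \<in> S"
  and regular_singleton: "regular_family S \<Longrightarrow> 1 \<le> n \<Longrightarrow> {n} \<in> S"
  by (auto simp: regular_family_def)

lemma regular_spread:
  assumes "regular_family S" "F \<in> S" "strict_mono_on F h" "\<And>f. f \<in> F \<Longrightarrow> f \<le> h f"
  shows "h ` F \<in> S"
  using assms by (simp add: regular_family_def)

lemma regular_empty: "regular_family S \<Longrightarrow> {} \<in> S"
  using regular_subset[OF _ regular_singleton[of S 1]] by auto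

section \<open>Composition of families\<close>

definition piece :: "nat set \<Rightarrow> nat set \<Rightarrow> nat \<Rightarrow> nat set" where
  "piece H F h = {f \<in> F. h \<le> f \<and> (\<forall>h'\<in>H. h < h' \<longrightarrow> f < h')}"

text \<open>
  For regular families this is \<open>family_compose\<close>: \<open>H\<close> is the set of minima of the sets
  \<open>G\<^sub>1 < \<dots> < G\<^sub>n\<close>, which are recovered from \<open>H\<close> and \<open>F\<close> as pieces.
\<close>

definition fam_comp :: "nat set set \<Rightarrow> nat set set \<Rightarrow> nat set set" where
  "fam_comp T S = {F. finite F \<and> 0 \<notin> F \<and>
     (\<exists>H\<in>T. H \<subseteq> F \<and> (\<forall>f\<in>F. \<exists>h\<in>H. h \<le> f) \<and> (\<forall>h\<in>H. piece H F h \<in> S))}"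

lemma ex_piece:
  assumes "finite H" "f \<in> F" "\<exists>h\<in>H. h \<le> f"
  obtains h where "h \<in> H" "f \<in> piece H F h"
proof -
  let ?A = "{h\<in>H. h \<le> f}"
  have fin: "finite ?A" "?A \<noteq> {}"
    using assms by auto
  then have "Max ?A \<in> ?A"
    by (rule Max_in)
  moreover have "f < h'" if "h' \<in> H" "Max ?A < h'" for h'
    using Max_ge[OF fin(1), of h'] that by fastforce
  ultimately show ?thesis
    using assms(2) by (intro that[of "Max ?A"]) (auto simp: piece_def)
qed

lemma piece_unique: "f \<in> piece H F h \<Longrightarrow> f \<in> piece H G h' \<Longrightarrow> h \<in> H \<Longrightarrow> h' \<in> H \<Longrightarrow> h = h'"
  by (rule linorder_cases[of h h']) (fastforce simp: piece_def)+

lemma piece_mono: "F \<subseteq> G \<Longrightarrow> piece H F h \<subseteq> piece H G h"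
  by (auto simp: piece_def)

text \<open>\<open>H\<close> need not lie inside \<open>F\<close>. Every h with a nonempty piece is
  replaced by the minimum of that piece. This moves h to the right and keeps the order, so heredity
  and spreading of \<open>T\<close> put the new set into \<open>T\<close>, and the new pieces are
  contained in the old ones.\<close>

lemma fam_comp_weakI:
  assumes T: "regular_family T" and S: "regular_family S" and F: "finite F" "0 \<notin> F"
    and H: "H \<in> T" "\<And>f. f \<in> F \<Longrightarrow> \<exists>h\<in>H. h \<le> f"
    and pieces: "\<And>h. h \<in> H \<Longrightarrow> piece H F h \<in> S"
  shows "F \<in> fam_comp T S"
proof -
  define H0 where "H0 = {h\<in>H. piece H F h \<noteq> {}}"
  define \<phi> where "\<phi> h = Min (piece H F h)" for h
  have fH: "finite H"
    using T H(1) regular_finite by blast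
  have \<phi>: "\<phi> h \<in> piece H F h" if "h \<in> H0" for h
    unfolding \<phi>_def using that F(1) by (intro Min_in) (auto simp: H0_def piece_def)
  have \<phi>_min: "\<phi> h \<le> f" if "f \<in> piece H F h" for f h
    unfolding \<phi>_def using that F(1) by (intro Min_le) (auto simp: piece_def)
  have mono: "\<phi> h < \<phi> h'" if "h \<in> H0" "h' \<in> H0" "h < h'" for h h'
  proof -
    have "\<phi> h < h'" "h' \<le> \<phi> h'"
      using \<phi>[OF that(1)] \<phi>[OF that(2)] that by (auto simp: piece_def H0_def)
    then show ?thesis by simp
  qed
  have "H0 \<in> T"
    using regular_subset[OF T H(1)] by (auto simp: H0_def)
  then have "\<phi> ` H0 \<in> T"
    by (intro regular_spread[OF T]) (use mono \<phi> in \<open>auto simp: piece_def strict_mono_on_def\<close>)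
  moreover have "\<phi> ` H0 \<subseteq> F"
    using \<phi> by (auto simp: piece_def)
  moreover have cov: "\<exists>h\<in>H0. f \<in> piece H F h" if "f \<in> F" for f
    by (rule ex_piece[OF fH that H(2)[OF that]]) (auto simp: H0_def)
  then have "\<exists>h\<in>\<phi> ` H0. h \<le> f" if "f \<in> F" for f
    using \<phi>_min that by blast
  moreover have "piece (\<phi> ` H0) F (\<phi> h) \<in> S" if h: "h \<in> H0" for h
  proof (rule regular_subset[OF S pieces])
    show "h \<in> H" using h by (simp add: H0_def)
    show "piece (\<phi> ` H0) F (\<phi> h) \<subseteq> piece H F h"
    proof
      fix f assume f: "f \<in> piece (\<phi> ` H0) F (\<phi> h)"
      have "f \<in> F" using f by (simp add: piece_def)
      then obtain h2 where h2: "h2 \<in> H0" "f \<in> piece H F h2"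
        using cov by blast
      have "h \<le> f"
        using f \<phi>[OF h] by (auto simp: piece_def)
      moreover have "h2 \<le> h"
      proof (rule ccontr)
        assume "\<not> h2 \<le> h"
        then show False
          using mono[OF h h2(1)] \<phi>_min[OF h2(2)] f h2(1) by (auto simp: piece_def)
      qed
      moreover have "\<not> h2 < h"
        using h2 h \<open>h \<le> f\<close> by (auto simp: piece_def H0_def)
      ultimately have "h2 = h"
        by simp
      then show "f \<in> piece H F h"
        using h2 by simp
    qed
  qed
  ultimately show ?thesis
    using F unfolding fam_comp_def by blast
qed

lemma fam_compE:
  assumes "F \<in> fam_comp T S"
  obtains H where "H \<in> T" "H \<subseteq> F" "\<And>f. f \<in> F \<Longrightarrow> \<exists>h\<in>H. h \<le> f"
    "\<And>h. h \<in> H \<Longrightarrow> piece H F h \<in> S" "finite F" "0 \<notin> F"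
  using assms unfolding fam_comp_def by blast

lemma fam_compI:
  assumes "H \<in> T" "H \<subseteq> F" "\<And>f. f \<in> F \<Longrightarrow> \<exists>h\<in>H. h \<le> f"
    "\<And>h. h \<in> H \<Longrightarrow> piece H F h \<in> S" "finite F" "0 \<notin> F"
  shows "F \<in> fam_comp T S"
  using assms unfolding fam_comp_def by blast

text \<open>A map that is increasing on \<open>F\<close> carries pieces to pieces. Source and target
  families are separate because the map occurs in three roles: as a spread, as an embedding of the
  inner family, and as a shift taking the outer family from a term of a fundamental sequence to its
  limit.\<close>

lemma fam_comp_spread:
  assumes "F \<in> fam_comp T S" and h: "strict_mono_on F h" "\<And>f. f \<in> F \<Longrightarrow> f \<le> h f"
    and T: "\<And>G. G \<in> T \<Longrightarrow> G \<subseteq> F \<Longrightarrow> h ` G \<in> T'"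
    and S: "\<And>G. G \<in> S \<Longrightarrow> G \<subseteq> F \<Longrightarrow> h ` G \<in> S'"
  shows "h ` F \<in> fam_comp T' S'"
proof -
  from assms(1) obtain H where H: "H \<in> T" "H \<subseteq> F" "\<And>f. f \<in> F \<Longrightarrow> \<exists>h\<in>H. h \<le> f"
    "\<And>h. h \<in> H \<Longrightarrow> piece H F h \<in> S" "finite F" "0 \<notin> F"
    by (rule fam_compE) blast
  have less: "h i < h j \<longleftrightarrow> i < j" "h i \<le> h j \<longleftrightarrow> i \<le> j" if "i \<in> F" "j \<in> F" for i j
    using strict_mono_on_less[OF h(1) that] strict_mono_on_less_eq[OF h(1) that] by auto
  have "piece (h ` H) (h ` F) (h k) = h ` piece H F k" if "k \<in> H" for k
    using that H(2) less by (auto simp: piece_def subset_iff)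
  then have "piece (h ` H) (h ` F) (h k) \<in> S'" if "k \<in> H" for k
    using that S[OF H(4)[OF that]] by (auto simp: piece_def)
  moreover have "0 \<notin> h ` F"
    using h(2) H(6) by force
  moreover have "\<exists>k\<in>h ` H. k \<le> f" if "f \<in> h ` F" for f
    using that H(2,3) less by (fastforce simp: subset_iff)
  ultimately show ?thesis
    using H(2,5) by (intro fam_compI[OF T[OF H(1,2)]]) auto
qed

lemma regular_fam_comp:
  assumes T: "regular_family T" and S: "regular_family S"
  shows "regular_family (fam_comp T S)"
  unfolding regular_family_def
proof (intro conjI ballI allI impI)
  fix F assume F: "F \<in> fam_comp T S"
  then obtain H where H: "H \<in> T" "H \<subseteq> F" "\<And>f. f \<in> F \<Longrightarrow> \<exists>h\<in>H. h \<le> f"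
    "\<And>h. h \<in> H \<Longrightarrow> piece H F h \<in> S" "finite F" "0 \<notin> F"
    by (rule fam_compE) blast
  show "finite F" "0 \<notin> F" by fact+
  show "G \<in> fam_comp T S" if "G \<subseteq> F" for G
  \<comment> \<open>\<open>H\<close> may contain points outside \<open>G\<close>, so its elements
    are not minima of subsets of \<open>G\<close>.\<close>
  proof (rule fam_comp_weakI[OF T S _ _ H(1)])
    show "finite G" "0 \<notin> G" using that H(5,6) finite_subset by auto
    show "\<exists>h\<in>H. h \<le> f" if "f \<in> G" for f
      using that \<open>G \<subseteq> F\<close> H(3) by blast
    show "piece H G h \<in> S" if "h \<in> H" for h
      using regular_subset[OF S H(4)[OF that] piece_mono[OF \<open>G \<subseteq> F\<close>]] .
  qed
  show "h ` F \<in> fam_comp T S" if "strict_mono_on F h \<and> (\<forall>f\<in>F. f \<le> h f)" for h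
    by (rule fam_comp_spread[OF F])
      (use that in \<open>auto intro!: regular_spread[OF T] regular_spread[OF S] simp: monotone_on_subset\<close>)
next
  fix n :: nat assume n: "1 \<le> n"
  have "piece {n} {n} n = {n}" by (auto simp: piece_def)
  then show "{n} \<in> fam_comp T S"
    using n regular_singleton[OF T n] regular_singleton[OF S n] by (auto simp: fam_comp_def)
qed

text \<open>The middle layer is the set \<open>M\<close> of minima of the innermost sets. From the
  left, \<open>M\<close> is the union of the sets of minima chosen inside the pieces over
  \<open>H\<close>; from the right, \<open>M\<close> is given and its own pieces over
  \<open>H\<close> serve as these sets of minima.\<close>

lemma fam_comp_assoc:
  assumes R: "regular_family R" and T: "regular_family T" and S: "regular_family S"
  shows "fam_comp R (fam_comp T S) = fam_comp (fam_comp R T) S"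
proof (intro equalityI subsetI)
  fix F assume "F \<in> fam_comp R (fam_comp T S)"
  then obtain H where H: "H \<in> R" "H \<subseteq> F" "\<And>f. f \<in> F \<Longrightarrow> \<exists>h\<in>H. h \<le> f"
    "\<And>h. h \<in> H \<Longrightarrow> piece H F h \<in> fam_comp T S" "finite F" "0 \<notin> F"
    by (rule fam_compE) blast
  have fH: "finite H" using H finite_subset by blast
  have "\<forall>h\<in>H. \<exists>K. K \<in> T \<and> K \<subseteq> piece H F h \<and> (\<forall>f\<in>piece H F h. \<exists>k\<in>K. k \<le> f) \<and>
      (\<forall>k\<in>K. piece K (piece H F h) k \<in> S)"
    using H(4) unfolding fam_comp_def by blast
  then obtain K where K: "\<And>h. h \<in> H \<Longrightarrow> K h \<in> T" "\<And>h. h \<in> H \<Longrightarrow> K h \<subseteq> piece H F h"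
    "\<And>h f. h \<in> H \<Longrightarrow> f \<in> piece H F h \<Longrightarrow> \<exists>k\<in>K h. k \<le> f"
    "\<And>h k. h \<in> H \<Longrightarrow> k \<in> K h \<Longrightarrow> piece (K h) (piece H F h) k \<in> S"
    by metis
  define M where "M = (\<Union>h\<in>H. K h)"
  have MF: "M \<subseteq> F"
    using K(2) by (force simp: M_def piece_def)
  have fM: "finite M" using MF H(5) finite_subset by blast
  \<comment> \<open>Each h is the least element of its piece, so it must be one of the minima chosen
    there.\<close>
  have HM: "H \<subseteq> M"
  proof
    fix h assume h: "h \<in> H"
    then have "h \<in> piece H F h" using H(2) by (auto simp: piece_def)
    then obtain k where "k \<in> K h" "k \<le> h" using K(3) h by blast
    moreover have "h \<le> k" using K(2)[OF h] \<open>k \<in> K h\<close> by (auto simp: piece_def)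
    ultimately show "h \<in> M" using h by (auto simp: M_def)
  qed
  have pM: "piece H M h \<subseteq> K h" if "h \<in> H" for h
  proof
    fix m assume m: "m \<in> piece H M h"
    then obtain h' where h': "h' \<in> H" "m \<in> K h'" by (auto simp: M_def piece_def)
    then have "m \<in> piece H F h'" using K(2) by blast
    then have "h' = h"
      using piece_unique[OF m _ that h'(1)] by blast
    then show "m \<in> K h" using h' by simp
  qed
  have M: "M \<in> fam_comp R T"
  proof (rule fam_comp_weakI[OF R T fM _ H(1)])
    show "0 \<notin> M" using MF H(6) by blast
    show "\<exists>h\<in>H. h \<le> f" if "f \<in> M" for f using that MF H(3) by blast
    show "piece H M h \<in> T" if "h \<in> H" for h
      using regular_subset[OF T K(1) pM] that by blast
  qed
  show "F \<in> fam_comp (fam_comp R T) S"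
  proof (rule fam_comp_weakI[OF regular_fam_comp[OF R T] S H(5,6) M])
    show "\<exists>m\<in>M. m \<le> f" if "f \<in> F" for f using that HM H(3) by blast
    fix m assume "m \<in> M"
    then obtain h where h: "h \<in> H" "m \<in> K h" by (auto simp: M_def)
    have "piece M F m \<subseteq> piece (K h) (piece H F h) m"
    proof
      fix f assume f: "f \<in> piece M F m"
      have m: "h \<le> m" "\<And>h'. h' \<in> H \<Longrightarrow> h < h' \<Longrightarrow> m < h'"
        using K(2)[OF h(1)] h(2) by (auto simp: piece_def)
      have f': "f \<in> F" "m \<le> f" "\<And>m'. m' \<in> M \<Longrightarrow> m < m' \<Longrightarrow> f < m'"
        using f by (auto simp: piece_def)
      have "f \<in> piece H F h"
        using m f' HM by (auto simp: piece_def)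
      moreover have "f < k" if "k \<in> K h" "m < k" for k
        using f'(3) that h(1) by (auto simp: M_def)
      ultimately show "f \<in> piece (K h) (piece H F h) m"
        using f'(2) by (simp add: piece_def[of "K h"])
    qed
    then show "piece M F m \<in> S"
      using regular_subset[OF S K(4)[OF h]] by blast
  qed
next
  fix F assume "F \<in> fam_comp (fam_comp R T) S"
  then obtain M where M: "M \<in> fam_comp R T" "M \<subseteq> F" "\<And>f. f \<in> F \<Longrightarrow> \<exists>h\<in>M. h \<le> f"
    "\<And>h. h \<in> M \<Longrightarrow> piece M F h \<in> S" "finite F" "0 \<notin> F"
    by (rule fam_compE) blast
  from M(1) obtain H where H: "H \<in> R" "H \<subseteq> M" "\<And>f. f \<in> M \<Longrightarrow> \<exists>h\<in>H. h \<le> f"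
    "\<And>h. h \<in> H \<Longrightarrow> piece H M h \<in> T" "finite M"
    by (rule fam_compE) blast
  show "F \<in> fam_comp R (fam_comp T S)"
  proof (rule fam_comp_weakI[OF R regular_fam_comp[OF T S] M(5,6) H(1)])
    show "\<exists>h\<in>H. h \<le> f" if "f \<in> F" for f using that M(3) H(3) order_trans by meson
    fix h assume h: "h \<in> H"
    show "piece H F h \<in> fam_comp T S"
    proof (rule fam_comp_weakI[OF T S _ _ H(4)[OF h]])
      show "finite (piece H F h)" "0 \<notin> piece H F h" using M(5,6) by (auto simp: piece_def)
      fix f assume f: "f \<in> piece H F h"
      then have "f \<in> F" by (simp add: piece_def)
      then obtain m where m: "m \<in> M" "f \<in> piece M F m"
        using ex_piece[OF H(5)] M(3) by metis
      have "h \<le> m"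
        using m(2) h H(2) f by (force simp: piece_def not_less[symmetric])
      then have "m \<in> piece H M h"
        using m f by (force simp: piece_def)
      then show "\<exists>k\<in>piece H M h. k \<le> f" using m by (auto simp: piece_def)
    next
      fix m assume m: "m \<in> piece H M h"
      have "piece (piece H M h) (piece H F h) m \<subseteq> piece M F m"
      proof
        fix f assume f: "f \<in> piece (piece H M h) (piece H F h) m"
        have "f < m'" if "m' \<in> M" "m < m'" for m'
        proof (rule ccontr)
          assume "\<not> f < m'"
          then have "m' \<in> piece H M h" using that f m by (force simp: piece_def)
          then show False using f that \<open>\<not> f < m'\<close> by (auto simp: piece_def)
        qed
        then show "f \<in> piece M F m" using f by (auto simp: piece_def)
      qed
      then show "piece (piece H M h) (piece H F h) m \<in> S"
        using regular_subset[OF S M(4)] m by (auto simp: piece_def)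
    qed
  qed
qed

text \<open>Strict separation of the listed sets makes each of them the piece of the union at its
  own minimum; conversely, the pieces listed along the sorted minima are separated.\<close>

lemma family_compose_eq_comp:
  assumes T: "regular_family T" and S: "regular_family S"
  shows "family_compose T S = fam_comp T S"
proof (intro equalityI subsetI)
  fix F assume "F \<in> family_compose T S"
  then obtain Gs where F: "F = \<Union>(set Gs)" and Gs: "\<And>G. G \<in> set Gs \<Longrightarrow> G \<in> S \<and> G \<noteq> {}"
    and sorted: "sorted_wrt (\<lambda>G H. Max G < Min H) Gs" and H: "Min ` set Gs \<in> T"
    by (auto simp: family_compose_def)
  have fin: "finite G" "Min G \<in> G" "\<And>g. g \<in> G \<Longrightarrow> Min G \<le> g \<and> g \<le> Max G" if "G \<in> set Gs" for G
    using Gs[OF that] regular_finite[OF S] by auto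
  have cmp: "G = G' \<or> Max G < Min G' \<or> Max G' < Min G" if "G \<in> set Gs" "G' \<in> set Gs" for G G'
    using that sorted by (metis in_set_conv_nth linorder_neqE_nat sorted_wrt_nth_less)
  have "piece (Min ` set Gs) F (Min G) = G" if G: "G \<in> set Gs" for G
  proof (intro equalityI subsetI)
    fix f assume f: "f \<in> piece (Min ` set Gs) F (Min G)"
    then obtain G' where G': "G' \<in> set Gs" "f \<in> G'" by (auto simp: F piece_def)
    have "\<not> Max G < Min G'"
    proof
      assume "Max G < Min G'"
      then have "Min G < Min G'" using fin(3)[OF G fin(2)[OF G]] by simp
      then show False using f G' fin(3)[OF G' ] by (fastforce simp: piece_def)
    qed
    moreover have "\<not> Max G' < Min G"
      using f fin(3)[OF G'] by (auto simp: piece_def)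
    ultimately show "f \<in> G"
      using cmp[OF G G'(1)] G' by blast
  next
    fix f assume f: "f \<in> G"
    have "f < Min G'" if G': "G' \<in> set Gs" "Min G < Min G'" for G'
    proof -
      have "Min G' \<le> Max G'" using fin(2,3)[OF G'(1)] by blast
      then have "Max G < Min G'" using cmp[OF G G'(1)] G'(2) by auto
      then show ?thesis using fin(3)[OF G f] by simp
    qed
    then show "f \<in> piece (Min ` set Gs) F (Min G)"
      using f G fin[OF G] by (auto simp: piece_def F)
  qed
  moreover have "0 \<notin> F" using Gs regular_zero[OF S] by (auto simp: F)
  moreover have "finite F" using fin by (auto simp: F)
  moreover have "\<exists>h\<in>Min ` set Gs. h \<le> f" if "f \<in> F" for f
    using that fin(3) F by blast
  ultimately show "F \<in> fam_comp T S"
    using Gs fin(2) F by (intro fam_compI[OF H]) auto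
next
  fix F assume "F \<in> fam_comp T S"
  then obtain H where H: "H \<in> T" "H \<subseteq> F" "\<And>f. f \<in> F \<Longrightarrow> \<exists>h\<in>H. h \<le> f"
    "\<And>h. h \<in> H \<Longrightarrow> piece H F h \<in> S" "finite F" "0 \<notin> F"
    by (rule fam_compE) blast
  have fH: "finite H" using H finite_subset by blast
  let ?Gs = "map (piece H F) (sorted_list_of_set H)"
  have fp: "finite (piece H F h)" for h using H(5) by (auto simp: piece_def)
  have hp: "h \<in> piece H F h" if "h \<in> H" for h using H(2) that by (auto simp: piece_def)
  have min: "Min (piece H F h) = h" if "h \<in> H" for h
    using hp[OF that] by (intro Min_eqI fp) (auto simp: piece_def)
  have max: "Max (piece H F h) < h'" if "h \<in> H" "h' \<in> H" "h < h'" for h h'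
    using hp[OF that(1)] that fp by (subst Max_less_iff) (auto simp: piece_def)
  have "sorted_wrt (\<lambda>G H. Max G < Min H) ?Gs"
    unfolding sorted_wrt_map
    by (rule sorted_wrt_mono_rel[OF _ strict_sorted_list_of_set]) (use fH min max in auto)
  moreover have "\<Union>(set ?Gs) = F"
  proof
    show "F \<subseteq> \<Union>(set ?Gs)"
    proof
      fix f assume "f \<in> F"
      with ex_piece[OF fH this H(3)] show "f \<in> \<Union>(set ?Gs)" using fH by auto
    qed
  qed (auto simp: piece_def)
  moreover have "Min ` set ?Gs = H"
    using fH min by (simp add: image_image)
  moreover have "\<forall>G\<in>set ?Gs. G \<in> S \<and> G \<noteq> {}"
    using fH H(4) hp by auto
  ultimately show "F \<in> family_compose T S"
    unfolding family_compose_def using H(1) by (intro CollectI exI[of _ ?Gs]) simp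
qed

section \<open>Regularity of the Schreier classes\<close>

lemma regular_schreier0: "regular_family schreier0"
  by (auto simp: regular_family_def schreier0_def subset_singleton_iff Suc_le_eq)

lemma regular_schreier1: "regular_family schreier1"
  unfolding regular_family_def
proof (intro conjI ballI allI impI)
  fix F assume F: "F \<in> schreier1"
  show "finite F" using F by (auto simp: schreier1_def)
  show "0 \<notin> F"
    using F card_gt_0_iff[of F] Min_le[of F 0] by (force simp: schreier1_def)
  show "G \<in> schreier1" if "G \<subseteq> F" for G
  proof (cases "G = {}")
    case False
    then have "F \<noteq> {}" "finite F" using F that by (auto simp: schreier1_def)
    then have "card G \<le> card F" "Min F \<le> Min G" "card F \<le> Min F" "finite G"
      using that F False finite_subset by (auto intro: card_mono Min_antimono simp: schreier1_def)
    then show ?thesis using False by (auto simp: schreier1_def)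
  qed (simp add: schreier1_def)
  show "h ` F \<in> schreier1" if h: "strict_mono_on F h \<and> (\<forall>f\<in>F. f \<le> h f)" for h
  proof (cases "F = {}")
    case False
    then have *: "finite F" "card F \<le> Min F" using F by (auto simp: schreier1_def)
    have "card (h ` F) = card F"
      using h strict_mono_on_imp_inj_on card_image by blast
    moreover have "Min F \<le> Min (h ` F)"
      using False * h by (subst Min_ge_iff) (auto intro: order_trans[OF Min_le])
    ultimately have "card (h ` F) \<le> Min (h ` F)" using * by linarith
    then show ?thesis using False * by (auto simp: schreier1_def)
  qed (simp add: schreier1_def)
qed (auto simp: schreier1_def)

lemma regular_schreier:
  assumes a: "fundamental_sequences a"
  shows "regular_family (schreier a \<alpha>)"
proof (induction \<alpha> rule: less_induct)
  case (less \<alpha>)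
  show ?case
  proof (cases \<alpha> rule: omega1_cases)
    case zero
    then show ?thesis by (simp add: schreier_zero regular_schreier0)
  next
    case (suc \<beta>)
    then have "regular_family (schreier a \<beta>)"
      using less by (simp add: less_plus_one_omega1)
    then show ?thesis
      by (simp add: suc schreier_Suc family_compose_eq_comp regular_schreier1 regular_fam_comp)
  next
    case limit
    have IH: "regular_family (schreier a (a \<alpha> n))" for n
      using less a limit by (auto simp: fundamental_sequences_def)
    show ?thesis
      unfolding schreier_limit[OF a limit] regular_family_def
    proof (intro conjI ballI allI impI)
      fix F assume "F \<in> {F. \<exists>n\<ge>1. F \<in> schreier a (a \<alpha> n) \<and> (\<forall>i\<in>F. n \<le> i)}"
      then obtain n where n: "1 \<le> n" "F \<in> schreier a (a \<alpha> n)" "\<forall>i\<in>F. n \<le> i" by blast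
      show "finite F" "0 \<notin> F" using regular_finite[OF IH n(2)] regular_zero[OF IH n(2)] by auto
      show "G \<in> {F. \<exists>n\<ge>1. F \<in> schreier a (a \<alpha> n) \<and> (\<forall>i\<in>F. n \<le> i)}" if "G \<subseteq> F" for G
        using n regular_subset[OF IH n(2) that] that by blast
      show "h ` F \<in> {F. \<exists>n\<ge>1. F \<in> schreier a (a \<alpha> n) \<and> (\<forall>i\<in>F. n \<le> i)}"
        if "strict_mono_on F h \<and> (\<forall>f\<in>F. f \<le> h f)" for h
      proof -
        have "h ` F \<in> schreier a (a \<alpha> n)" using regular_spread[OF IH n(2)] that by blast
        moreover have "\<forall>i\<in>h ` F. n \<le> i" using n(3) that order_trans by blast
        ultimately show ?thesis using n(1) by blast
      qed
    next
      fix n :: nat assume "1 \<le> n"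
      then show "{n} \<in> {F. \<exists>n\<ge>1. F \<in> schreier a (a \<alpha> n) \<and> (\<forall>i\<in>F. n \<le> i)}"
        using regular_singleton[OF IH, of n 1] by auto
    qed
  qed
qed

section \<open>Comparison of the Schreier classes\<close>

text \<open>The direction is chosen for lower estimates: if \<open>S\<close> embeds into
  \<open>T\<close> along \<open>N\<close>, then a lower \<open>T\<close>-estimate for a sequence
  becomes a lower \<open>S\<close>-estimate for its subsequence along \<open>N\<close>.\<close>

definition embeds :: "nat set set \<Rightarrow> nat set set \<Rightarrow> bool" (infix "\<lesssim>\<^sub>F" 50) where
  "S \<lesssim>\<^sub>F T \<longleftrightarrow> (\<exists>N. strict_mono N \<and> (\<forall>F\<in>S. N ` F \<in> T))"

lemma embeds_subset: "S \<subseteq> T \<Longrightarrow> S \<lesssim>\<^sub>F T"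
  unfolding embeds_def by (rule exI[of _ id]) (auto simp: strict_mono_def)

lemma embeds_trans [trans]:
  assumes "R \<lesssim>\<^sub>F S" "S \<lesssim>\<^sub>F T"
  shows "R \<lesssim>\<^sub>F T"
proof -
  from assms obtain M N where "strict_mono M" "\<forall>F\<in>R. M ` F \<in> S" "strict_mono N" "\<forall>F\<in>S. N ` F \<in> T"
    by (auto simp: embeds_def)
  moreover from this have "N ` M ` F \<in> T" if "F \<in> R" for F
    using that by blast
  ultimately show ?thesis
    unfolding embeds_def
    by (intro exI[of _ "\<lambda>i. N (M i)"]) (simp add: strict_mono_def image_image)
qed

lemma strict_mono_on_strict_mono: "strict_mono f \<Longrightarrow> strict_mono_on A f"
  by (auto simp: strict_mono_def strict_mono_on_def)

lemma embeds_fam_comp: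
  assumes R: "regular_family R" and "S \<lesssim>\<^sub>F T"
  shows "fam_comp R S \<lesssim>\<^sub>F fam_comp R T"
proof -
  from assms(2) obtain N where N: "strict_mono N" "\<forall>F\<in>S. N ` F \<in> T"
    by (auto simp: embeds_def)
  have "N ` F \<in> fam_comp R T" if "F \<in> fam_comp R S" for F
    using that N
    by (intro fam_comp_spread[OF that])
      (auto intro!: regular_spread[OF R] strict_mono_on_strict_mono simp: strict_mono_imp_increasing)
  then show ?thesis
    using N embeds_def by blast
qed

text \<open>A diagonal argument: a function that eventually dominates all the given embeddings.\<close>

lemma embeds_diagonal:
  assumes T: "regular_family T"
    and N: "\<And>n. 1 \<le> n \<Longrightarrow> {F \<in> U n. \<forall>i\<in>F. n \<le> i} \<lesssim>\<^sub>F T"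
  shows "(\<Union>n\<in>{1..}. {F \<in> U n. \<forall>i\<in>F. n \<le> i}) \<lesssim>\<^sub>F T"
proof -
  have "\<forall>n. \<exists>N. 1 \<le> n \<longrightarrow> strict_mono N \<and> (\<forall>F\<in>U n. (\<forall>i\<in>F. n \<le> i) \<longrightarrow> N ` F \<in> T)"
    using N unfolding embeds_def by blast
  from choice[OF this] obtain N where N: "\<And>n. 1 \<le> n \<Longrightarrow> strict_mono (N n)"
    "\<And>n F. 1 \<le> n \<Longrightarrow> F \<in> U n \<Longrightarrow> \<forall>i\<in>F. n \<le> i \<Longrightarrow> N n ` F \<in> T"
    by blast
  define M where "M i = i + (\<Sum>j\<in>{1..i}. N j i)" for i
  have "strict_mono M"
  proof (rule strict_monoI_Suc)
    fix i
    have "(\<Sum>j\<in>{1..i}. N j i) \<le> (\<Sum>j\<in>{1..i}. N j (Suc i))"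
      by (rule sum_mono, rule less_imp_le, rule strict_monoD[OF N(1)]) auto
    then show "M i < M (Suc i)" by (simp add: M_def)
  qed
  moreover have "M ` F \<in> T" if n: "1 \<le> n" "F \<in> U n" "\<forall>i\<in>F. n \<le> i" for F n
  proof -
    \<comment> \<open>\<open>h\<close> sends \<open>N n i\<close> to \<open>M i\<close>. For i at
      least n, the value \<open>N n i\<close> is one of the summands of \<open>M i\<close>, so on
      the image of F nothing moves to the left and spreading of \<open>T\<close> applies.\<close>
    define h where "h j = M (the_inv (N n) j)" for j
    have inv: "the_inv (N n) (N n i) = i" for i
      using the_inv_f_f strict_mono_imp_inj_on[OF N(1)[OF n(1)]] by metis
    have "N n i \<le> M i" if "i \<in> F" for i
      using n that member_le_sum[of n "{1..i}" "\<lambda>j. N j i"] by (force simp: M_def)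
    then have "h ` N n ` F \<in> T"
      using N(1)[OF n(1)] \<open>strict_mono M\<close>
      by (intro regular_spread[OF T N(2)[OF n]])
        (auto simp: h_def inv strict_mono_on_def strict_mono_less)
    then show ?thesis
      by (simp add: h_def inv image_image)
  qed
  ultimately show ?thesis
    by (auto simp: embeds_def)
qed

lemma fam_comp_schreier0_left: "regular_family S \<Longrightarrow> fam_comp schreier0 S \<subseteq> S"
proof
  fix F assume S: "regular_family S" and "F \<in> fam_comp schreier0 S"
  then obtain H where H: "H \<in> schreier0" "H \<subseteq> F" "\<And>f. f \<in> F \<Longrightarrow> \<exists>h\<in>H. h \<le> f"
    "\<And>h. h \<in> H \<Longrightarrow> piece H F h \<in> S"
    by (auto elim: fam_compE)
  then consider "H = {}" | h where "H = {h}" by (auto simp: schreier0_def)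
  then show "F \<in> S"
  proof cases
    case 1
    then have "F = {}" using H(3) by auto
    then show ?thesis using regular_empty[OF S] by simp
  next
    case (2 h)
    then have "piece H F h = F" using H(3) by (auto simp: piece_def)
    then show ?thesis using H(4)[of h] 2 by auto
  qed
qed

lemma subset_fam_comp:
  assumes R: "regular_family R" and S: "regular_family S"
  shows "S \<subseteq> fam_comp R S"
proof
  fix F assume F: "F \<in> S"
  show "F \<in> fam_comp R S"
  proof (cases "F = {}")
    case True
    then show ?thesis
      using regular_empty[OF regular_fam_comp[OF R S]] by simp
  next
    case False
    have fin: "finite F" "0 \<notin> F" using F S regular_finite regular_zero by auto
    have "1 \<le> Min F" using False fin by (metis Min_in less_one not_le)
    then show ?thesis
      using False fin F
      by (intro fam_comp_weakI[OF R S, of _ "{Min F}"] regular_singleton[OF R])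
        (auto intro: regular_subset[OF S F] simp: piece_def)
  qed
qed

text \<open>Inclusion may fail at a limit ordinal, where a set taken from the k-th approximating
  class must also lie beyond k. A shift by k repairs this and stays in the class by
  spreading.\<close>

lemma embeds_schreier_mono:
  assumes a: "fundamental_sequences a" and "\<alpha> \<le> \<beta>"
  shows "schreier a \<alpha> \<lesssim>\<^sub>F schreier a \<beta>"
  using assms(2)
proof (induction \<beta> rule: less_induct)
  case (less \<beta>)
  note reg = regular_schreier[OF a]
  show ?case
  proof (cases "\<alpha> = \<beta>")
    case False
    then have \<alpha>: "\<alpha> < \<beta>" using less.prems by simp
    show ?thesis
    proof (cases \<beta> rule: omega1_cases)
      case (suc \<beta>')
      then have "schreier a \<alpha> \<lesssim>\<^sub>F schreier a \<beta>'"
        using less.IH[of \<beta>'] \<alpha> by (simp add: less_plus_one_omega1)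
      also have "schreier a \<beta>' \<lesssim>\<^sub>F schreier a \<beta>"
        using subset_fam_comp[OF regular_schreier1 reg]
        by (simp add: suc schreier_Suc family_compose_eq_comp[OF regular_schreier1 reg] embeds_subset)
      finally show ?thesis .
    next
      case limit
      then obtain n where n: "\<alpha> < a \<beta> n" "incseq (a \<beta>)" "\<And>n. a \<beta> n < \<beta>"
        using a \<alpha> unfolding fundamental_sequences_def by blast
      define k where "k = Suc n"
      have k: "1 \<le> k" "\<alpha> \<le> a \<beta> k"
        using n(1) incseqD[OF n(2), of n k] by (auto simp: k_def)
      then have "schreier a \<alpha> \<lesssim>\<^sub>F schreier a (a \<beta> k)"
        using less.IH n(3) by blast
      also have "schreier a (a \<beta> k) \<lesssim>\<^sub>F schreier a \<beta>"
        unfolding embeds_def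
      proof (intro exI[of _ "\<lambda>i. i + k"] conjI ballI)
        fix F assume "F \<in> schreier a (a \<beta> k)"
        then have "(\<lambda>i. i + k) ` F \<in> schreier a (a \<beta> k)"
          by (rule regular_spread[OF reg]) (auto simp: strict_mono_on_def)
        then show "(\<lambda>i. i + k) ` F \<in> schreier a \<beta>"
          using k(1) by (auto simp: schreier_limit[OF a limit])
      qed (auto simp: strict_mono_def)
      finally show ?thesis .
    qed (use \<alpha> in simp)
  qed (simp add: embeds_subset)
qed

section \<open>Ordinal addition: limits, associativity and multiples\<close>

lemma less_plus_omega1D:
  assumes "\<gamma> < \<alpha> + (\<beta>::omega1)" "0 < \<beta>"
  obtains \<beta>' where "\<beta>' < \<beta>" "\<gamma> \<le> \<alpha> + \<beta>'"
proof (cases "\<gamma> \<le> \<alpha>")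
  case True
  then show ?thesis using assms(2) that[of 0] by simp
next
  case False
  then show ?thesis
    using assms(1) plus_omega1_le[of \<alpha> \<gamma> \<beta>] that by (meson leI leD less_imp_le)
qed

lemma limit_ordinal_pos: "limit_ordinal \<beta> \<Longrightarrow> 0 < \<beta>"
  using zero_le_omega1[of \<beta>] by (auto simp: limit_ordinal_def less_le)

lemma limit_ordinal_plus:
  assumes "limit_ordinal \<beta>"
  shows "limit_ordinal (\<alpha> + \<beta>)"
  unfolding limit_ordinal_def
proof (intro conjI allI impI)
  have "\<alpha> + 0 < \<alpha> + \<beta>"
    using limit_ordinal_pos[OF assms] plus_omega1_bounds(2) by blast
  then show "\<alpha> + \<beta> \<noteq> 0" by force
  fix \<gamma> assume "\<gamma> < \<alpha> + \<beta>"
  then obtain \<beta>' where \<beta>': "\<beta>' < \<beta>" "\<gamma> \<le> \<alpha> + \<beta>'"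
    using less_plus_omega1D limit_ordinal_pos[OF assms] by blast
  have "\<gamma> + 1 \<le> (\<alpha> + \<beta>') + 1"
    using \<beta>'(2) less_plus_one_omega1 by (metis leI le_less_trans less_irrefl order.trans)
  also have "\<dots> = \<alpha> + (\<beta>' + 1)" by (simp add: plus_Suc_omega1)
  also have "\<dots> < \<alpha> + \<beta>"
    using \<beta>'(1) assms by (intro plus_omega1_bounds(2)) (simp add: limit_ordinal_def)
  finally show "\<gamma> + 1 < \<alpha> + \<beta>" .
qed

lemma plus_assoc_omega1: "(\<alpha> + \<beta>) + \<gamma> = \<alpha> + (\<beta> + (\<gamma>::omega1))"
proof (induction \<gamma> rule: less_induct)
  case (less \<gamma>)
  show ?case
  proof (rule antisym)
    show "(\<alpha> + \<beta>) + \<gamma> \<le> \<alpha> + (\<beta> + \<gamma>)"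
    proof (rule plus_omega1_le)
      show "\<alpha> + \<beta> \<le> \<alpha> + (\<beta> + \<gamma>)"
        using plus_omega1_bounds(1)[of \<beta> \<gamma>] plus_omega1_bounds(2)[of \<beta> "\<beta> + \<gamma>" \<alpha>]
        by (cases "\<beta> = \<beta> + \<gamma>") (simp_all add: less_imp_le)
      show "\<alpha> + \<beta> + \<gamma>' < \<alpha> + (\<beta> + \<gamma>)" if "\<gamma>' < \<gamma>" for \<gamma>'
        using less[OF that] that by (simp add: plus_omega1_bounds(2))
    qed
    show "\<alpha> + (\<beta> + \<gamma>) \<le> (\<alpha> + \<beta>) + \<gamma>"
    proof (rule plus_omega1_le)
      show "\<alpha> \<le> \<alpha> + \<beta> + \<gamma>"
        using plus_omega1_bounds(1) order_trans by blast
      fix \<delta> assume \<delta>: "\<delta> < \<beta> + \<gamma>"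
      show "\<alpha> + \<delta> < \<alpha> + \<beta> + \<gamma>"
      proof (cases "\<delta> < \<beta>")
        case True
        then show ?thesis
          using plus_omega1_bounds(2)[of \<delta> \<beta> \<alpha>] plus_omega1_bounds(1)[of "\<alpha> + \<beta>" \<gamma>] by simp
      next
        case False
        have "0 < \<gamma>" using \<delta> False zero_le_omega1[of \<gamma>] by (cases "\<gamma> = 0") (auto simp: less_le)
        with \<delta> obtain \<gamma>' where g: "\<gamma>' < \<gamma>" "\<delta> \<le> \<beta> + \<gamma>'"
          using less_plus_omega1D by blast
        have "\<alpha> + \<delta> \<le> \<alpha> + (\<beta> + \<gamma>')"
          using g(2) plus_omega1_bounds(2)[of \<delta> "\<beta> + \<gamma>'" \<alpha>]
          by (cases "\<delta> = \<beta> + \<gamma>'") (simp_all add: less_imp_le)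
        also have "\<dots> = \<alpha> + \<beta> + \<gamma>'" using less[OF g(1)] by simp
        also have "\<dots> < \<alpha> + \<beta> + \<gamma>" using g(1) by (rule plus_omega1_bounds(2))
        finally show ?thesis .
      qed
    qed
  qed
qed

lemma zero_plus_omega1 [simp]: "0 + \<alpha> = (\<alpha>::omega1)"
proof (induction \<alpha> rule: less_induct)
  case (less \<alpha>)
  show ?case
  proof (rule antisym)
    show "0 + \<alpha> \<le> \<alpha>" by (rule plus_omega1_le) (use less in auto)
    show "\<alpha> \<le> 0 + \<alpha>"
      using plus_omega1_bounds(2)[of _ \<alpha> 0] less by (metis leI less_irrefl)
  qed
qed

lemma omul_add: "omul \<alpha> (n + m) = omul \<alpha> n + omul \<alpha> m"
  by (induction m) (simp_all add: plus_assoc_omega1[symmetric])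

text \<open>Successor steps are associativity of composition. At a limit \<beta>, the sequence fixed
  for \<alpha> + \<beta> is unrelated to the one fixed for \<beta>. Each of its terms lies below
  \<alpha> + \<open>a \<beta> k\<close> for some k, which gives an embedding for this term by
  monotonicity, induction and a shift by k; the diagonal argument combines the terms.\<close>

lemma embeds_schreier_plus:
  assumes a: "fundamental_sequences a"
  shows "schreier a (\<alpha> + \<beta>) \<lesssim>\<^sub>F fam_comp (schreier a \<beta>) (schreier a \<alpha>)"
proof (induction \<beta> rule: less_induct)
  case (less \<beta>)
  note reg = regular_schreier[OF a]
  show ?case
  proof (cases \<beta> rule: omega1_cases)
    case zero
    then show ?thesis
      by (simp add: schreier_zero embeds_subset subset_fam_comp[OF regular_schreier0 reg])
  next
    case (suc \<beta>')
    then have "schreier a (\<alpha> + \<beta>') \<lesssim>\<^sub>F fam_comp (schreier a \<beta>') (schreier a \<alpha>)"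
      using less by (simp add: less_plus_one_omega1)
    from embeds_fam_comp[OF regular_schreier1 this] show ?thesis
      by (simp add: suc plus_Suc_omega1 schreier_Suc family_compose_eq_comp[OF regular_schreier1 reg]
          fam_comp_assoc[OF regular_schreier1 reg reg])
  next
    case limit
    note lim = limit_ordinal_plus[OF limit, of \<alpha>]
    have "schreier a (a (\<alpha> + \<beta>) n) \<lesssim>\<^sub>F fam_comp (schreier a \<beta>) (schreier a \<alpha>)" for n
    proof -
      have "a (\<alpha> + \<beta>) n < \<alpha> + \<beta>"
        using a lim by (auto simp: fundamental_sequences_def)
      then obtain \<beta>' where \<beta>': "\<beta>' < \<beta>" "a (\<alpha> + \<beta>) n \<le> \<alpha> + \<beta>'"
        using less_plus_omega1D limit_ordinal_pos[OF limit] by blast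
      then obtain j where j: "\<beta>' < a \<beta> j" "incseq (a \<beta>)" "\<And>n. a \<beta> n < \<beta>"
        using a limit unfolding fundamental_sequences_def by blast
      define k where "k = Suc j"
      have k: "1 \<le> k" "\<beta>' < a \<beta> k" "a \<beta> k < \<beta>"
        using less_le_trans[OF j(1) incseqD[OF j(2), of j k]] j(3) by (auto simp: k_def)
      have "\<alpha> + \<beta>' < \<alpha> + a \<beta> k" using k(2) by (rule plus_omega1_bounds(2))
      then have "schreier a (a (\<alpha> + \<beta>) n) \<lesssim>\<^sub>F schreier a (\<alpha> + a \<beta> k)"
        using \<beta>'(2) by (intro embeds_schreier_mono[OF a]) simp
      also have "\<dots> \<lesssim>\<^sub>F fam_comp (schreier a (a \<beta> k)) (schreier a \<alpha>)"
        by (rule less[OF k(3)])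
      also have "\<dots> \<lesssim>\<^sub>F fam_comp (schreier a \<beta>) (schreier a \<alpha>)"
        unfolding embeds_def
      proof (intro exI[of _ "\<lambda>i. i + k"] conjI ballI)
        fix F assume F: "F \<in> fam_comp (schreier a (a \<beta> k)) (schreier a \<alpha>)"
        show "(\<lambda>i. i + k) ` F \<in> fam_comp (schreier a \<beta>) (schreier a \<alpha>)"
        proof (rule fam_comp_spread[OF F])
          fix G assume "G \<in> schreier a (a \<beta> k)"
          then have "(\<lambda>i. i + k) ` G \<in> schreier a (a \<beta> k)"
            by (rule regular_spread[OF reg]) (auto simp: strict_mono_on_def)
          then show "(\<lambda>i. i + k) ` G \<in> schreier a \<beta>"
            using k(1) by (auto simp: schreier_limit[OF a limit])
        next
          fix G assume "G \<in> schreier a \<alpha>"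
          then show "(\<lambda>i. i + k) ` G \<in> schreier a \<alpha>"
            by (rule regular_spread[OF reg]) (auto simp: strict_mono_on_def)
        qed (auto simp: strict_mono_on_def)
      qed (auto simp: strict_mono_def)
      finally show ?thesis .
    qed
    then have "{F \<in> schreier a (a (\<alpha> + \<beta>) n). \<forall>i\<in>F. n \<le> i} \<lesssim>\<^sub>F fam_comp (schreier a \<beta>) (schreier a \<alpha>)" for n
      by (rule embeds_trans[OF embeds_subset, rotated]) auto
    from embeds_diagonal[OF regular_fam_comp[OF reg reg] this]
    show ?thesis
      by (rule embeds_trans[OF embeds_subset, rotated]) (auto simp: schreier_limit[OF a lim])
  qed
qed

text \<open>At a limit \<beta>, the set of minima lies in some approximating class with index n and
  beyond n. Since every element of F dominates a minimum, all of F lies beyond n, which is the form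
  required by the diagonal argument.\<close>

lemma fam_comp_schreier_embeds:
  assumes a: "fundamental_sequences a"
  shows "fam_comp (schreier a \<beta>) (schreier a \<alpha>) \<lesssim>\<^sub>F schreier a (\<alpha> + \<beta>)"
proof (induction \<beta> rule: less_induct)
  case (less \<beta>)
  note reg = regular_schreier[OF a]
  show ?case
  proof (cases \<beta> rule: omega1_cases)
    case zero
    then show ?thesis
      by (simp add: schreier_zero embeds_subset fam_comp_schreier0_left[OF reg])
  next
    case (suc \<beta>')
    then have "fam_comp (schreier a \<beta>') (schreier a \<alpha>) \<lesssim>\<^sub>F schreier a (\<alpha> + \<beta>')"
      using less by (simp add: less_plus_one_omega1)
    from embeds_fam_comp[OF regular_schreier1 this] show ?thesis
      by (simp add: suc plus_Suc_omega1 schreier_Suc family_compose_eq_comp[OF regular_schreier1 reg]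
          fam_comp_assoc[OF regular_schreier1 reg reg])
  next
    case limit
    have "{F \<in> fam_comp (schreier a (a \<beta> n)) (schreier a \<alpha>). \<forall>i\<in>F. n \<le> i} \<lesssim>\<^sub>F schreier a (\<alpha> + \<beta>)" for n
    proof -
      have n: "a \<beta> n < \<beta>" using a limit by (auto simp: fundamental_sequences_def)
      have "fam_comp (schreier a (a \<beta> n)) (schreier a \<alpha>) \<lesssim>\<^sub>F schreier a (\<alpha> + \<beta>)"
        using less[OF n] embeds_schreier_mono[OF a less_imp_le[OF plus_omega1_bounds(2)[OF n]]]
        by (rule embeds_trans)
      then show ?thesis
        by (rule embeds_trans[OF embeds_subset, rotated]) auto
    qed
    from embeds_diagonal[OF reg this]
    have "(\<Union>n\<in>{1..}. {F \<in> fam_comp (schreier a (a \<beta> n)) (schreier a \<alpha>). \<forall>i\<in>F. n \<le> i})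
        \<lesssim>\<^sub>F schreier a (\<alpha> + \<beta>)" .
    moreover have "fam_comp (schreier a \<beta>) (schreier a \<alpha>) \<subseteq>
        (\<Union>n\<in>{1..}. {F \<in> fam_comp (schreier a (a \<beta> n)) (schreier a \<alpha>). \<forall>i\<in>F. n \<le> i})"
    proof
      fix F assume "F \<in> fam_comp (schreier a \<beta>) (schreier a \<alpha>)"
      then obtain H where H: "H \<in> schreier a \<beta>" "H \<subseteq> F" "\<And>f. f \<in> F \<Longrightarrow> \<exists>h\<in>H. h \<le> f"
        "\<And>h. h \<in> H \<Longrightarrow> piece H F h \<in> schreier a \<alpha>" "finite F" "0 \<notin> F"
        by (rule fam_compE) blast
      then obtain n where n: "1 \<le> n" "H \<in> schreier a (a \<beta> n)" "\<forall>i\<in>H. n \<le> i"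
        by (auto simp: schreier_limit[OF a limit])
      then have "F \<in> fam_comp (schreier a (a \<beta> n)) (schreier a \<alpha>)"
        using H(2-6) by (intro fam_compI)
      moreover have "\<forall>i\<in>F. n \<le> i" using n(3) H(3) order_trans by blast
      ultimately show "F \<in> (\<Union>n\<in>{1..}. {F \<in> fam_comp (schreier a (a \<beta> n)) (schreier a \<alpha>). \<forall>i\<in>F. n \<le> i})"
        using n(1) by auto
    qed
    ultimately show ?thesis
      using embeds_trans[OF embeds_subset] by blast
  qed
qed

section \<open>Basic sequences\<close>

text \<open>The Grunblum criterion with its constant, stated for finite sums and thus without
  convergence. The constant is explicit because one \<open>K\<close> has to serve all block
  bases.\<close>

definition basic :: "real \<Rightarrow> (nat \<Rightarrow> 'a::real_normed_vector) \<Rightarrow> bool" where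
  "basic K x \<longleftrightarrow> (\<forall>i. x i \<noteq> 0) \<and>
     (\<forall>c n m. n \<le> m \<longrightarrow> norm (\<Sum>i<n. c i *\<^sub>R x i) \<le> K * norm (\<Sum>i<m. c i *\<^sub>R x i))"

lemma basic_nonzero: "basic K x \<Longrightarrow> x i \<noteq> 0"
  and basic_partial: "basic K x \<Longrightarrow> n \<le> m \<Longrightarrow>
    norm (\<Sum>i<n. c i *\<^sub>R x i) \<le> K * norm (\<Sum>i<m. c i *\<^sub>R x i)"
  by (auto simp: basic_def)

lemma basic_ge_1:
  assumes "basic K x"
  shows "1 \<le> K"
  using basic_partial[OF assms, of 1 1 "\<lambda>_. 1"] basic_nonzero[OF assms, of 0] by simp

lemma basic_interval:
  assumes x: "basic K x" and "b \<le> m"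
  shows "norm (\<Sum>i=a..<b. c i *\<^sub>R x i) \<le> 2 * K * norm (\<Sum>i<m. c i *\<^sub>R x i)"
proof (cases "a \<le> b")
  case True
  have "(\<Sum>i=a..<b. c i *\<^sub>R x i) = (\<Sum>i<b. c i *\<^sub>R x i) - (\<Sum>i<a. c i *\<^sub>R x i)"
    using sum_diff_nat_ivl[of 0 a b "\<lambda>i. c i *\<^sub>R x i"] True by (simp add: atLeast0LessThan)
  also have "norm \<dots> \<le> K * norm (\<Sum>i<m. c i *\<^sub>R x i) + K * norm (\<Sum>i<m. c i *\<^sub>R x i)"
    using basic_partial[OF x, of b m c] basic_partial[OF x, of a m c] True assms(2)
    by (intro order_trans[OF norm_triangle_ineq4] add_mono) auto
  finally show ?thesis by simp
next
  case False
  then show ?thesis using basic_ge_1[OF x] by simp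
qed

lemma basic_coeff:
  assumes "basic K x" "n < m"
  shows "\<bar>c n\<bar> * norm (x n) \<le> 2 * K * norm (\<Sum>i<m. c i *\<^sub>R x i)"
  using basic_interval[OF assms(1), of "Suc n" m c n] assms(2) by simp

lemma basic_sums_zero:
  assumes x: "basic K x" and "(\<lambda>i. c i *\<^sub>R x i) sums 0"
  shows "c i = 0"
proof -
  have "(\<lambda>m. \<Sum>i<m. c i *\<^sub>R x i) \<longlonglongrightarrow> 0"
    using assms(2) by (simp add: sums_def)
  then have "(\<lambda>m. 2 * K * norm (\<Sum>i<m. c i *\<^sub>R x i)) \<longlonglongrightarrow> 2 * K * norm (0::'a)"
    by (intro tendsto_intros)
  moreover have "\<forall>m\<ge>Suc i. \<bar>c i\<bar> * norm (x i) \<le> 2 * K * norm (\<Sum>i<m. c i *\<^sub>R x i)"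
    using basic_coeff[OF x, of i] by (simp add: Suc_le_eq)
  ultimately have "\<bar>c i\<bar> * norm (x i) \<le> 2 * K * norm (0::'a)"
    by (intro LIMSEQ_le_const) auto
  then show ?thesis
    using basic_nonzero[OF x, of i] by (simp add: mult_le_0_iff)
qed

lemma basic_sums_unique:
  assumes x: "basic K x" and "(\<lambda>i. c i *\<^sub>R x i) sums v" "(\<lambda>i. d i *\<^sub>R x i) sums v"
  shows "c = d"
proof
  fix i
  have "(\<lambda>i. (c i - d i) *\<^sub>R x i) sums 0"
    using sums_diff[OF assms(2,3)] by (simp add: scaleR_left_diff_distrib)
  then show "c i = d i"
    using basic_sums_zero[OF x, of "\<lambda>i. c i - d i"] by force
qed

lemma in_span_image_finite:
  assumes "finite I"
  shows "v \<in> span (x ` I) \<longleftrightarrow> (\<exists>c. v = (\<Sum>i\<in>I. c i *\<^sub>R (x i :: 'a::real_vector)))"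
proof
  let ?S = "{v. \<exists>c. v = (\<Sum>i\<in>I. c i *\<^sub>R x i)}"
  have "subspace ?S"
  proof (rule subspaceI)
    show "0 \<in> ?S" by (auto intro!: exI[of _ "\<lambda>_. 0"])
    show "u + w \<in> ?S" if uw: "u \<in> ?S" "w \<in> ?S" for u w
    proof -
      obtain c d where "u = (\<Sum>i\<in>I. c i *\<^sub>R x i)" "w = (\<Sum>i\<in>I. d i *\<^sub>R x i)"
        using uw by blast
      then have "u + w = (\<Sum>i\<in>I. (c i + d i) *\<^sub>R x i)"
        by (simp add: scaleR_left_distrib sum.distrib)
      then show ?thesis by (auto intro!: exI[of _ "\<lambda>i. c i + d i"])
    qed
    show "t *\<^sub>R u \<in> ?S" if u: "u \<in> ?S" for t u
    proof -
      obtain c where "u = (\<Sum>i\<in>I. c i *\<^sub>R x i)" using u by blast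
      then have "t *\<^sub>R u = (\<Sum>i\<in>I. (t * c i) *\<^sub>R x i)" by (simp add: scaleR_sum_right)
      then show ?thesis by (auto intro!: exI[of _ "\<lambda>i. t * c i"])
    qed
  qed
  moreover have "x i \<in> ?S" if "i \<in> I" for i
  proof -
    have "x i = (\<Sum>j\<in>I. (if j = i then 1 else 0) *\<^sub>R x j)"
      using assms that by (simp add: if_distrib[of "\<lambda>t. t *\<^sub>R _"] sum.delta cong: if_cong)
    then show ?thesis by (intro CollectI exI[of _ "\<lambda>j. if j = i then 1 else 0"])
  qed
  ultimately have "span (x ` I) \<subseteq> ?S"
    by (intro span_minimal) auto
  then show "v \<in> span (x ` I) \<Longrightarrow> \<exists>c. v = (\<Sum>i\<in>I. c i *\<^sub>R x i)" by blast
qed (auto intro!: span_sum span_scale intro: span_base)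

lemma in_span_range:
  fixes x :: "nat \<Rightarrow> 'a::real_vector"
  assumes "v \<in> span (range x)"
  obtains c n where "v = (\<Sum>i<n. c i *\<^sub>R x i)"
proof -
  have "\<exists>n. v \<in> span (x ` {..<n})"
    using assms
  proof (induction rule: span_induct_alt)
    case base
    show ?case using span_zero by blast
  next
    case (step t u w)
    then obtain i n where i: "u = x i" "w \<in> span (x ` {..<n})" by blast
    have "span (x ` {..<n}) \<subseteq> span (x ` {..<max n (Suc i)})"
      by (intro span_mono image_mono) auto
    then have "w \<in> span (x ` {..<max n (Suc i)})" using i(2) by blast
    moreover have "u \<in> span (x ` {..<max n (Suc i)})"
      unfolding i(1) by (intro span_base imageI) simp
    ultimately have "w \<in> span (x ` {..<max n (Suc i)})" "u \<in> span (x ` {..<max n (Suc i)})"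
      by auto
    then show ?case using span_add span_scale by blast
  qed
  then show ?thesis
    using that in_span_image_finite[OF finite_lessThan] by metis
qed

text \<open>Differences of coefficients are bounded by norms of differences of the vectors, so the
  coefficients of approximating finite sums converge. The partial sum bound is uniform in the
  length, which allows the two limits to be exchanged.\<close>

lemma closed_span_expansion:
  assumes x: "basic K x" and v: "v \<in> closed_span x"
  shows "\<exists>c. (\<lambda>i. c i *\<^sub>R x i) sums v"
proof -
  have K: "1 \<le> K" by (rule basic_ge_1[OF x])
  obtain w where w: "\<And>k. w k \<in> span (range x)" and lim: "w \<longlonglongrightarrow> v"
    using v by (auto simp: closed_span_def closure_sequential)
  have "\<forall>k. \<exists>d m. w k = (\<Sum>i<m. d i *\<^sub>R x i)"
    using w in_span_range by metis
  then obtain d0 m where w0: "\<And>k. w k = (\<Sum>i<m k. d0 k i *\<^sub>R x i)"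
    by metis
  \<comment> \<open>Padding with zeros lets approximants of different lengths be compared at a
    common length.\<close>
  define d where "d k i = (if i < m k then d0 k i else 0)" for k i
  have w_eq: "w k = (\<Sum>i<n. d k i *\<^sub>R x i)" if "m k \<le> n" for k n
    unfolding w0 d_def using that
    by (intro sum.mono_neutral_cong_left) auto
  have part: "norm ((\<Sum>i<n. d k i *\<^sub>R x i) - (\<Sum>i<n. d l i *\<^sub>R x i)) \<le> K * norm (w k - w l)" for n k l
  proof -
    let ?N = "max n (max (m k) (m l))"
    have "norm (\<Sum>i<n. (d k i - d l i) *\<^sub>R x i) \<le> K * norm (\<Sum>i<?N. (d k i - d l i) *\<^sub>R x i)"
      by (intro basic_partial[OF x]) auto
    moreover have "(\<Sum>i<?N. (d k i - d l i) *\<^sub>R x i) = w k - w l"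
      by (simp add: w_eq[of k ?N] w_eq[of l ?N] scaleR_left_diff_distrib sum_subtractf)
    ultimately show ?thesis
      by (simp add: scaleR_left_diff_distrib sum_subtractf)
  qed
  have coeff: "\<bar>d k i - d l i\<bar> * norm (x i) \<le> 2 * K * norm (w k - w l)" for k l i
  proof -
    have "(d k i - d l i) *\<^sub>R x i = ((\<Sum>i<Suc i. d k i *\<^sub>R x i) - (\<Sum>i<Suc i. d l i *\<^sub>R x i))
        - ((\<Sum>i<i. d k i *\<^sub>R x i) - (\<Sum>i<i. d l i *\<^sub>R x i))"
      by (simp add: scaleR_left_diff_distrib)
    also have "norm \<dots> \<le> K * norm (w k - w l) + K * norm (w k - w l)"
      by (rule order_trans[OF norm_triangle_ineq4 add_mono[OF part part]])
    finally show ?thesis by simp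
  qed
  have "\<exists>t. (\<lambda>k. d k i) \<longlonglongrightarrow> t" for i
  proof -
    have "Cauchy (\<lambda>k. d k i)"
    proof (rule metric_CauchyI)
      fix e :: real assume e: "e > 0"
      have nx: "norm (x i) > 0" using basic_nonzero[OF x] by simp
      have "e * norm (x i) / (2 * K) > 0" using e nx K by simp
      then obtain M where M: "\<And>k l. k \<ge> M \<Longrightarrow> l \<ge> M \<Longrightarrow> dist (w k) (w l) < e * norm (x i) / (2 * K)"
        using LIMSEQ_imp_Cauchy[OF lim] unfolding Cauchy_def by metis
      have "dist (d k i) (d l i) < e" if "k \<ge> M" "l \<ge> M" for k l
      proof -
        have "2 * K * norm (w k - w l) < e * norm (x i)"
          using M[OF that] K by (simp add: dist_norm field_simps)
        then have "\<bar>d k i - d l i\<bar> * norm (x i) < e * norm (x i)"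
          using coeff[of k i l] by linarith
        then show ?thesis using nx by (simp add: dist_real_def)
      qed
      then show "\<exists>M. \<forall>k\<ge>M. \<forall>l\<ge>M. dist (d k i) (d l i) < e" by blast
    qed
    then show ?thesis
      by (metis Cauchy_convergent_iff convergent_def)
  qed
  then obtain c where c: "\<And>i. (\<lambda>k. d k i) \<longlonglongrightarrow> c i" by metis
  have part': "norm ((\<Sum>i<n. d k i *\<^sub>R x i) - (\<Sum>i<n. c i *\<^sub>R x i)) \<le> K * norm (w k - v)" for n k
  proof (rule LIMSEQ_le)
    show "(\<lambda>l. norm ((\<Sum>i<n. d k i *\<^sub>R x i) - (\<Sum>i<n. d l i *\<^sub>R x i)))
        \<longlonglongrightarrow> norm ((\<Sum>i<n. d k i *\<^sub>R x i) - (\<Sum>i<n. c i *\<^sub>R x i))"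
      by (intro tendsto_intros c)
    show "(\<lambda>l. K * norm (w k - w l)) \<longlonglongrightarrow> K * norm (w k - v)"
      by (intro tendsto_intros lim)
    show "\<exists>N. \<forall>l\<ge>N. norm ((\<Sum>i<n. d k i *\<^sub>R x i) - (\<Sum>i<n. d l i *\<^sub>R x i)) \<le> K * norm (w k - w l)"
      using part by blast
  qed
  have "(\<lambda>n. \<Sum>i<n. c i *\<^sub>R x i) \<longlonglongrightarrow> v"
  proof (rule metric_LIMSEQ_I)
    fix e :: real assume e: "e > 0"
    then have "e / (K + 1) > 0" using K by simp
    then obtain k where k: "dist (w k) v < e / (K + 1)"
      using metric_LIMSEQ_D[OF lim] by blast
    have "dist (\<Sum>i<n. c i *\<^sub>R x i) v < e" if "m k \<le> n" for n
    proof -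
      have "dist (\<Sum>i<n. c i *\<^sub>R x i) v \<le> norm (w k - (\<Sum>i<n. c i *\<^sub>R x i)) + norm (w k - v)"
        using dist_triangle3[of "\<Sum>i<n. c i *\<^sub>R x i" v "w k"] by (simp add: dist_norm)
      also have "\<dots> \<le> (K + 1) * norm (w k - v)"
        using part'[of k n] w_eq[OF that] by (simp add: algebra_simps)
      also have "\<dots> < e"
        using k K by (simp add: dist_norm field_simps)
      finally show ?thesis .
    qed
    then show "\<exists>n0. \<forall>n\<ge>n0. dist (\<Sum>i<n. c i *\<^sub>R x i) v < e" by blast
  qed
  then show ?thesis by (auto simp: sums_def)
qed


section \<open>Closed spans and coordinates\<close>

lemma span_subset_closed_span: "span (range x) \<subseteq> closed_span x"
  unfolding closed_span_def by (rule closure_subset)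

lemma subspace_closed_span: "subspace (closed_span x)"
proof (rule subspaceI)
  show "0 \<in> closed_span x" using span_subset_closed_span span_zero by blast
  show "u + v \<in> closed_span x" if uv: "u \<in> closed_span x" "v \<in> closed_span x" for u v
  proof -
    obtain f g where "\<And>k. f k \<in> span (range x)" "f \<longlonglongrightarrow> u" "\<And>k. g k \<in> span (range x)" "g \<longlonglongrightarrow> v"
      using uv by (auto simp: closed_span_def closure_sequential)
    then show ?thesis
      unfolding closed_span_def closure_sequential
      by (intro exI[of _ "\<lambda>k. f k + g k"]) (auto intro: span_add tendsto_add)
  qed
  show "t *\<^sub>R u \<in> closed_span x" if u: "u \<in> closed_span x" for t u
  proof -
    obtain f where "\<And>k. f k \<in> span (range x)" "f \<longlonglongrightarrow> u"
      using u by (auto simp: closed_span_def closure_sequential)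
    then show ?thesis
      unfolding closed_span_def closure_sequential
      by (intro exI[of _ "\<lambda>k. t *\<^sub>R f k"]) (auto intro: span_scale tendsto_intros)
  qed
qed

lemma closed_closed_span: "closed (closed_span x)"
  by (simp add: closed_span_def)

lemma coordinates_eq:
  assumes "basic K x" "(\<lambda>i. c i *\<^sub>R x i) sums v"
  shows "coordinates x v = c"
  unfolding coordinates_def using assms basic_sums_unique by (intro the_equality) auto

lemma coordinates_sums:
  assumes "basic K x" "v \<in> closed_span x"
  shows "(\<lambda>i. coordinates x v i *\<^sub>R x i) sums v"
  using closed_span_expansion[OF assms] coordinates_eq[OF assms(1)] by auto

lemma coordinates_add:
  assumes x: "basic K x" and "u \<in> closed_span x" "v \<in> closed_span x"
  shows "coordinates x (u + v) i = coordinates x u i + coordinates x v i"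
proof -
  have "(\<lambda>i. (coordinates x u i + coordinates x v i) *\<^sub>R x i) sums (u + v)"
    using sums_add[OF coordinates_sums[OF x assms(2)] coordinates_sums[OF x assms(3)]]
    by (simp add: scaleR_left_distrib)
  from coordinates_eq[OF x this] show ?thesis by simp
qed

lemma coordinates_scale:
  assumes x: "basic K x" and "u \<in> closed_span x"
  shows "coordinates x (t *\<^sub>R u) i = t * coordinates x u i"
proof -
  have "(\<lambda>i. (t * coordinates x u i) *\<^sub>R x i) sums (t *\<^sub>R u)"
    using sums_scaleR_right[OF coordinates_sums[OF x assms(2)], of t] by simp
  from coordinates_eq[OF x this] show ?thesis by simp
qed

lemma coordinates_finite_sum:
  assumes x: "basic K x" and "finite I"
  shows "coordinates x (\<Sum>i\<in>I. c i *\<^sub>R x i) j = (if j \<in> I then c j else 0)"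
proof -
  have "(\<lambda>i. (if i \<in> I then c i else 0) *\<^sub>R x i) sums (\<Sum>i\<in>I. c i *\<^sub>R x i)"
    using sums_finite[OF assms(2), of "\<lambda>i. (if i \<in> I then c i else 0) *\<^sub>R x i"] by simp
  from coordinates_eq[OF x this] show ?thesis by simp
qed

section \<open>Block bases\<close>

text \<open>The vectors with support in \<open>{f..<r}\<close>; the shift is due to \<open>x\<^sub>i = x (i - 1)\<close>.\<close>

definition blk :: "(nat \<Rightarrow> 'a::real_normed_vector) \<Rightarrow> nat \<Rightarrow> nat \<Rightarrow> 'a set" where
  "blk x f r = span (x ` {f - 1..<r - 1})"

text \<open>
  \<open>\<sigma> (Suc i)\<close> is a lower bound for the support of the \<open>i\<close>th block that exceeds the supports of the
  preceding ones; \<open>\<sigma> 0\<close> plays no role.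
\<close>

definition blocks_via :: "(nat \<Rightarrow> nat) \<Rightarrow> (nat \<Rightarrow> 'a) \<Rightarrow> (nat \<Rightarrow> 'a::real_normed_vector) \<Rightarrow> bool" where
  "blocks_via \<sigma> x y \<longleftrightarrow> strict_mono \<sigma> \<and>
     (\<forall>i. y i \<noteq> 0 \<and> y i \<in> blk x (\<sigma> (Suc i)) (\<sigma> (Suc (Suc i))))"

lemma blk_mono: "f' \<le> f \<Longrightarrow> r \<le> r' \<Longrightarrow> blk x f r \<subseteq> blk x f' r'"
  unfolding blk_def by (intro span_mono image_mono) auto

lemma blk_subset_span: "blk x f r \<subseteq> span (range x)"
  unfolding blk_def by (intro span_mono) auto

lemma blk_subset_closed_span: "blk x f r \<subseteq> closed_span x"
  using blk_subset_span span_subset_closed_span by blast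

lemma subspace_blk: "subspace (blk x f r)"
  by (simp add: blk_def)

lemma in_blk_iff: "v \<in> blk x f r \<longleftrightarrow> (\<exists>c. v = (\<Sum>i=f - 1..<r - 1. c i *\<^sub>R x i))"
  unfolding blk_def by (rule in_span_image_finite) simp

lemma supp_blk:
  assumes x: "basic K x" and v: "v \<in> blk x f r"
  shows "supp x v \<subseteq> {f..<r}"
proof -
  obtain c where "v = (\<Sum>i=f - 1..<r - 1. c i *\<^sub>R x i)"
    using v by (auto simp: in_blk_iff)
  then show ?thesis
    by (auto simp: supp_def coordinates_finite_sum[OF x])
qed

lemma supp_nonempty:
  assumes x: "basic K x" and v: "v \<in> closed_span x" "v \<noteq> 0"
  shows "supp x v \<noteq> {}"
proof
  assume "supp x v = {}"
  then have "(\<lambda>i. 0) sums v"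
    using coordinates_sums[OF x v(1)] by (simp add: supp_def)
  then show False using v(2) sums_zero sums_unique2 by blast
qed

lemma in_blk_supp:
  assumes x: "basic K x" and v: "v \<in> closed_span x" and s: "supp x v \<subseteq> {f..<r}"
  shows "v \<in> blk x f r"
proof -
  let ?I = "{f - 1..<r - 1}"
  have out: "coordinates x v i *\<^sub>R x i = 0" if "i \<notin> ?I" for i
    using s that by (force simp: supp_def)
  have "(\<lambda>i. coordinates x v i *\<^sub>R x i) sums (\<Sum>i\<in>?I. coordinates x v i *\<^sub>R x i)"
    by (rule sums_finite) (use out in auto)
  then have "v = (\<Sum>i\<in>?I. coordinates x v i *\<^sub>R x i)"
    using coordinates_sums[OF x v] sums_unique2 by blast
  then show ?thesis by (auto simp: in_blk_iff)
qed

lemma block_vectorD: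
  assumes x: "basic K x" and v: "block_vector x v"
  shows "v \<in> blk x (Min (supp x v)) (Suc (Max (supp x v)))" "1 \<le> Min (supp x v)"
    "Min (supp x v) \<le> Max (supp x v)"
proof -
  have fin: "finite (supp x v)" "supp x v \<noteq> {}"
    using v supp_nonempty[OF x] by (auto simp: block_vector_def)
  show "v \<in> blk x (Min (supp x v)) (Suc (Max (supp x v)))"
    using v fin by (intro in_blk_supp[OF x]) (auto simp: block_vector_def less_Suc_eq_le)
  show "1 \<le> Min (supp x v)" using Min_in[OF fin] by (auto simp: supp_def)
  show "Min (supp x v) \<le> Max (supp x v)" using fin by simp
qed

lemma block_vector_blk:
  assumes x: "basic K x" and v: "v \<in> blk x f r" "v \<noteq> 0"
  shows "block_vector x v" "f \<le> Min (supp x v)" "Max (supp x v) < r"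
proof -
  have "v \<in> closed_span x" using v(1) blk_subset_closed_span by blast
  moreover have s: "supp x v \<subseteq> {f..<r}" by (rule supp_blk[OF x v(1)])
  ultimately have fin: "finite (supp x v)" "supp x v \<noteq> {}" "v \<in> closed_span x"
    using supp_nonempty[OF x _ v(2)] finite_subset by auto
  then show "block_vector x v" using v(2) by (simp add: block_vector_def)
  show "f \<le> Min (supp x v)" "Max (supp x v) < r"
    using fin s by auto
qed

text \<open>Supports are traded for membership in spans of windows. A block basis yields windows
  that start at the actual minima of the supports; conversely, any consecutive windows keep the
  supports apart.\<close>

lemma block_basis_iff_blocks_via:
  assumes x: "basic K x"
  shows "block_basis y x \<longleftrightarrow> (\<exists>\<sigma>. blocks_via \<sigma> x y)"
proof
  assume y: "block_basis y x"
  define \<sigma> where "\<sigma> = case_nat 0 (\<lambda>i. Min (supp x (y i)))"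
  have bv: "block_vector x (y i)" for i using y by (simp add: block_basis_def)
  have less: "Max (supp x (y i)) < Min (supp x (y (Suc i)))" for i
    using y by (simp add: block_basis_def block_less_def)
  have "\<sigma> i < \<sigma> (Suc i)" for i
  proof (cases i)
    case 0
    then show ?thesis using block_vectorD(2)[OF x bv, of 0] by (simp add: \<sigma>_def)
  next
    case (Suc j)
    then show ?thesis using block_vectorD(3)[OF x bv, of j] less[of j] by (simp add: \<sigma>_def)
  qed
  then have "strict_mono \<sigma>" by (rule strict_monoI_Suc)
  moreover have "y i \<noteq> 0" "y i \<in> blk x (\<sigma> (Suc i)) (\<sigma> (Suc (Suc i)))" for i
  proof -
    show "y i \<noteq> 0" using bv by (simp add: block_vector_def)
    show "y i \<in> blk x (\<sigma> (Suc i)) (\<sigma> (Suc (Suc i)))"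
      using block_vectorD(1)[OF x bv[of i]] less[of i]
        blk_mono[of "\<sigma> (Suc i)" "Min (supp x (y i))" "Suc (Max (supp x (y i)))" "\<sigma> (Suc (Suc i))" x]
      by (auto simp: \<sigma>_def)
  qed
  ultimately show "\<exists>\<sigma>. blocks_via \<sigma> x y" by (auto simp: blocks_via_def)
next
  assume "\<exists>\<sigma>. blocks_via \<sigma> x y"
  then obtain \<sigma> where \<sigma>: "strict_mono \<sigma>" "\<And>i. y i \<noteq> 0"
    "\<And>i. y i \<in> blk x (\<sigma> (Suc i)) (\<sigma> (Suc (Suc i)))"
    by (auto simp: blocks_via_def)
  note * = block_vector_blk[OF x \<sigma>(3,2)]
  show "block_basis y x"
    unfolding block_basis_def block_less_def using *(1) less_le_trans[OF *(3) *(2)] by blast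
qed

text \<open>The index shift in \<open>blocks_via\<close> is made for this: passing from
  \<open>y\<close> to \<open>x\<close> sends the window from f to r to the window from \<sigma> f to
  \<sigma> r, so it acts on index sets simply by \<sigma>.\<close>

lemma blocks_via_blk:
  assumes "blocks_via \<sigma> x y" "v \<in> blk y f r"
  shows "v \<in> blk x (\<sigma> f) (\<sigma> r)"
proof -
  have \<sigma>: "strict_mono \<sigma>" "y i \<in> blk x (\<sigma> (Suc i)) (\<sigma> (Suc (Suc i)))" for i
    using assms(1) by (auto simp: blocks_via_def)
  have "blk y f r \<subseteq> blk x (\<sigma> f) (\<sigma> r)"
    unfolding blk_def[of y]
  proof (rule span_minimal[OF _ subspace_blk])
    show "y ` {f - 1..<r - 1} \<subseteq> blk x (\<sigma> f) (\<sigma> r)"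
    proof clarify
      fix i assume i: "i \<in> {f - 1..<r - 1}"
      have "\<sigma> f \<le> \<sigma> (Suc i)" "\<sigma> (Suc (Suc i)) \<le> \<sigma> r"
        using i \<sigma>(1) by (auto simp: strict_mono_less_eq)
      then show "y i \<in> blk x (\<sigma> f) (\<sigma> r)" using \<sigma>(2)[of i] blk_mono by blast
    qed
  qed
  then show ?thesis using assms(2) by blast
qed

lemma blocks_via_trans:
  assumes "blocks_via \<sigma> x y" "blocks_via \<tau> y z"
  shows "blocks_via (\<lambda>i. \<sigma> (\<tau> i)) x z"
  using assms blocks_via_blk[OF assms(1)] unfolding blocks_via_def
  by (simp add: strict_mono_def)

lemma blocks_via_subseq:
  assumes "strict_mono \<sigma>" "\<And>i. x i \<noteq> 0"
  shows "blocks_via \<sigma> x (\<lambda>i. x (\<sigma> (Suc i) - 1))"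
  unfolding blocks_via_def
proof (intro conjI allI)
  fix i
  have "\<sigma> 0 < \<sigma> (Suc i)" "\<sigma> (Suc i) < \<sigma> (Suc (Suc i))" using assms(1) by (auto simp: strict_mono_less)
  then show "x (\<sigma> (Suc i) - 1) \<in> blk x (\<sigma> (Suc i)) (\<sigma> (Suc (Suc i)))"
    unfolding blk_def by (intro span_base imageI) auto
qed (use assms in auto)

lemma blocks_via_self: "(\<And>i. x i \<noteq> 0) \<Longrightarrow> blocks_via (\<lambda>i. i) x x"
  using blocks_via_subseq[of "\<lambda>i. i" x] by (simp add: strict_mono_def)

lemma blocks_via_tail: "(\<And>i. x i \<noteq> 0) \<Longrightarrow> blocks_via (\<lambda>i. i + (n - 1)) x (tail n x)"
  using blocks_via_subseq[of "\<lambda>i. i + (n - 1)" x] by (simp add: tail_def strict_mono_def)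

lemma closed_span_blocks:
  assumes "blocks_via \<sigma> x y"
  shows "closed_span y \<subseteq> closed_span x"
proof -
  have "range y \<subseteq> span (range x)"
    using assms blk_subset_span unfolding blocks_via_def by blast
  then have "span (range y) \<subseteq> span (range x)" by (simp add: span_minimal)
  then show ?thesis unfolding closed_span_def by (rule closure_mono)
qed

text \<open>Stabilization speaks about block bases of tails. Because \<sigma> never moves an index
  to the left, the n-th tail of a block basis is itself a block basis of the n-th tail, with the
  same n.\<close>

lemma blocks_via_tail_tail:
  assumes "blocks_via \<sigma> x y"
  shows "\<exists>\<tau>. blocks_via \<tau> (tail n x) (tail n y)"
proof
  define \<tau> where "\<tau> j = \<sigma> (j + (n - 1)) - (n - 1)" for j
  have \<sigma>: "strict_mono \<sigma>" "\<And>i. y i \<noteq> 0" "\<And>i. y i \<in> blk x (\<sigma> (Suc i)) (\<sigma> (Suc (Suc i)))"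
    using assms by (auto simp: blocks_via_def)
  have ge: "j + (n - 1) \<le> \<sigma> (j + (n - 1))" for j
    using strict_mono_imp_increasing[OF \<sigma>(1)] .
  show "blocks_via \<tau> (tail n x) (tail n y)"
    unfolding blocks_via_def
  proof (intro conjI allI)
    show "strict_mono \<tau>"
    proof (rule strict_monoI_Suc)
      fix j
      have "\<sigma> (j + (n - 1)) < \<sigma> (Suc j + (n - 1))" using \<sigma>(1) by (simp add: strict_mono_less)
      then show "\<tau> j < \<tau> (Suc j)" using ge[of j] unfolding \<tau>_def by linarith
    qed
    fix i
    show "tail n y i \<noteq> 0" by (simp add: tail_def \<sigma>(2))
    have "x ` {\<sigma> (Suc i + (n - 1)) - 1..<\<sigma> (Suc (Suc i) + (n - 1)) - 1} \<subseteq>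
        tail n x ` {\<tau> (Suc i) - 1..<\<tau> (Suc (Suc i)) - 1}"
    proof clarify
      fix k assume k: "k \<in> {\<sigma> (Suc i + (n - 1)) - 1..<\<sigma> (Suc (Suc i) + (n - 1)) - 1}"
      have "k - (n - 1) \<in> {\<tau> (Suc i) - 1..<\<tau> (Suc (Suc i)) - 1}" "n - 1 \<le> k"
      proof -
        have arith: "A - q - 1 \<le> k - q \<and> k - q < B - q - 1 \<and> q \<le> k"
          if "q + 1 \<le> A" "A - 1 \<le> k" "k < B - 1" for A B q :: nat
          using that by linarith
        show "k - (n - 1) \<in> {\<tau> (Suc i) - 1..<\<tau> (Suc (Suc i)) - 1}" "n - 1 \<le> k"
          using arith[of "n - 1" "\<sigma> (Suc i + (n - 1))" "\<sigma> (Suc (Suc i) + (n - 1))"] k ge[of "Suc i"]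
          by (simp_all add: \<tau>_def)
      qed
      then show "x k \<in> tail n x ` {\<tau> (Suc i) - 1..<\<tau> (Suc (Suc i)) - 1}"
        by (intro image_eqI[of _ _ "k - (n - 1)"]) (auto simp: tail_def)
    qed
    then have "blk x (\<sigma> (Suc i + (n - 1))) (\<sigma> (Suc (Suc i) + (n - 1)))
        \<subseteq> blk (tail n x) (\<tau> (Suc i)) (\<tau> (Suc (Suc i)))"
      unfolding blk_def by (rule span_mono)
    then show "tail n y i \<in> blk (tail n x) (\<tau> (Suc i)) (\<tau> (Suc (Suc i)))"
      using \<sigma>(3)[of "i + (n - 1)"] by (auto simp: tail_def)
  qed
qed

text \<open>A partial sum of \<open>y\<close> is a partial sum of \<open>x\<close> with suitable
  coefficients, up to the end of the last window. The constant is therefore inherited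
  unchanged.\<close>

lemma basic_blocks:
  assumes x: "basic K x" and "blocks_via \<sigma> x y"
  shows "basic K y"
proof -
  have \<sigma>: "strict_mono \<sigma>" "\<And>i. y i \<noteq> 0" "\<And>i. y i \<in> blk x (\<sigma> (Suc i)) (\<sigma> (Suc (Suc i)))"
    using assms(2) by (auto simp: blocks_via_def)
  define \<tau> where "\<tau> i = \<sigma> (Suc i) - 1" for i
  have pos: "\<sigma> (Suc i) \<ge> 1" for i
    using strict_mono_less[OF \<sigma>(1), of 0 "Suc i"] by simp
  have \<tau>: "strict_mono \<tau>"
  proof (rule strict_monoI_Suc)
    fix i
    have "\<sigma> (Suc i) < \<sigma> (Suc (Suc i))" using \<sigma>(1) by (simp add: strict_mono_less)
    then show "\<tau> i < \<tau> (Suc i)" using pos[of i] unfolding \<tau>_def by linarith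
  qed
  have "\<forall>i. \<exists>d. y i = (\<Sum>j=\<tau> i..<\<tau> (Suc i). d j *\<^sub>R x j)"
    using \<sigma>(3) by (auto simp: in_blk_iff \<tau>_def)
  then obtain d where d: "\<And>i. y i = (\<Sum>j=\<tau> i..<\<tau> (Suc i). d i j *\<^sub>R x j)" by metis
  have uniq: "i = i'" if "j \<in> {\<tau> i..<\<tau> (Suc i)}" "j \<in> {\<tau> i'..<\<tau> (Suc i')}" for i i' j
  proof -
    have "\<tau> i < \<tau> (Suc i')" "\<tau> i' < \<tau> (Suc i)" using that by auto
    then show ?thesis using \<tau> by (simp add: strict_mono_less)
  qed
  have main: "\<exists>b. \<forall>n. (\<Sum>i<n. c i *\<^sub>R y i) = (\<Sum>j<\<tau> n. b j *\<^sub>R x j)" for c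
  proof -
    \<comment> \<open>The windows are disjoint, so \<open>SOME\<close> picks the only possible i.
      The default 0 concerns the indices before the first window.\<close>
    define b where "b j = (if \<exists>i. j \<in> {\<tau> i..<\<tau> (Suc i)} then
        let i = (SOME i. j \<in> {\<tau> i..<\<tau> (Suc i)}) in c i * d i j else 0)" for j
    have b: "b j = c i * d i j" if "j \<in> {\<tau> i..<\<tau> (Suc i)}" for i j
    proof -
      have "j \<in> {\<tau> (SOME i. j \<in> {\<tau> i..<\<tau> (Suc i)})..<\<tau> (Suc (SOME i. j \<in> {\<tau> i..<\<tau> (Suc i)}))}"
        using that by (rule someI[of "\<lambda>i. j \<in> {\<tau> i..<\<tau> (Suc i)}"])
      then have "(SOME i. j \<in> {\<tau> i..<\<tau> (Suc i)}) = i" using uniq that by blast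
      then show ?thesis using that unfolding b_def Let_def by metis
    qed
    have "(\<Sum>i<n. c i *\<^sub>R y i) = (\<Sum>j<\<tau> n. b j *\<^sub>R x j)" for n
    proof (induction n)
      case 0
      have "b j = 0" if "j < \<tau> 0" for j
      proof -
        have "\<tau> 0 \<le> \<tau> i" for i using \<tau> by (simp add: strict_mono_less_eq)
        then have "j < \<tau> i" for i using that less_le_trans by blast
        then show ?thesis by (auto simp: b_def dest: leD)
      qed
      then show ?case by simp
    next
      case (Suc n)
      have "\<tau> n \<le> \<tau> (Suc n)" using \<tau> by (simp add: strict_mono_less_eq)
      then have "(\<Sum>j<\<tau> (Suc n). b j *\<^sub>R x j) =
          (\<Sum>j<\<tau> n. b j *\<^sub>R x j) + (\<Sum>j=\<tau> n..<\<tau> (Suc n). b j *\<^sub>R x j)"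
        using sum.atLeastLessThan_concat[of 0 "\<tau> n" "\<tau> (Suc n)" "\<lambda>j. b j *\<^sub>R x j"]
        by (simp add: atLeast0LessThan)
      also have "(\<Sum>j=\<tau> n..<\<tau> (Suc n). b j *\<^sub>R x j) = c n *\<^sub>R y n"
        unfolding d scaleR_sum_right by (intro sum.cong) (simp_all add: b)
      finally show ?case by (simp add: Suc)
    qed
    then show ?thesis by blast
  qed
  show ?thesis
    unfolding basic_def
  proof (intro conjI allI impI)
    fix c n m assume "n \<le> (m::nat)"
    obtain b where b: "\<And>n. (\<Sum>i<n. c i *\<^sub>R y i) = (\<Sum>j<\<tau> n. b j *\<^sub>R x j)" using main by blast
    have "\<tau> n \<le> \<tau> m" using \<tau> \<open>n \<le> m\<close> by (simp add: strict_mono_less_eq)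
    then show "norm (\<Sum>i<n. c i *\<^sub>R y i) \<le> K * norm (\<Sum>i<m. c i *\<^sub>R y i)"
      unfolding b by (rule basic_partial[OF x])
  qed (rule \<sigma>)
qed

text \<open>For two successive blocks with supports beginning at 2 or later, the asymptotic l1
  inequality bounds the first block by C times the sum. This is the basic sequence inequality for
  the basis without its first vector, which is then restored by means of its distance to the closed
  span of the others.\<close>

lemma asymptotic_l1_basic:
  fixes e :: "nat \<Rightarrow> 'a::real_normed_vector"
  assumes e: "schauder_basis e" and "asymptotic_l1 e"
  shows "\<exists>K. basic K e"
proof -
  have uniq: "c = d" if "(\<lambda>i. c i *\<^sub>R e i) sums v" "(\<lambda>i. d i *\<^sub>R e i) sums v" for c d v
    using e that unfolding schauder_basis_def by blast
  have ne: "e i \<noteq> 0" for i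
  proof
    assume "e i = 0"
    then have "(\<lambda>j. (if j = i then 1 else 0) *\<^sub>R e j) = (\<lambda>j. 0)" by auto
    then have "(\<lambda>j. (if j = i then 1 else 0) *\<^sub>R e j) sums 0" by (simp only: sums_zero)
    moreover have "(\<lambda>j. 0 *\<^sub>R e j) sums 0" by simp
    ultimately have "(\<lambda>j. if j = i then 1 else (0::real)) = (\<lambda>j. 0)" by (rule uniq)
    then show False by (metis zero_neq_one)
  qed
  have coord: "coordinates e (\<Sum>i\<in>I. c i *\<^sub>R e i) = (\<lambda>j. if j \<in> I then c j else 0)" if "finite I" for c I
  proof -
    have "(\<lambda>i. (if i \<in> I then c i else 0) *\<^sub>R e i) sums (\<Sum>i\<in>I. c i *\<^sub>R e i)"
      using sums_finite[OF that, of "\<lambda>i. (if i \<in> I then c i else 0) *\<^sub>R e i"] by simp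
    then show ?thesis unfolding coordinates_def using uniq by (intro the_equality)
  qed
  obtain C where C: "C > 0" "\<And>xs. xs \<noteq> [] \<Longrightarrow> finite_block_basis xs e \<Longrightarrow>
      length xs \<le> Min (supp e (hd xs)) \<Longrightarrow> norm (\<Sum>x\<leftarrow>xs. x) \<ge> 1 / C * (\<Sum>x\<leftarrow>xs. norm x)"
    using assms(2) unfolding asymptotic_l1_def by blast
  define K0 where "K0 = max 1 C"
  have K0: "K0 \<ge> 1" "K0 \<ge> C" by (auto simp: K0_def)
  \<comment> \<open>The length condition for two blocks asks for supports from 2 on, which in
    zero-based indexing excludes exactly \<open>e 0\<close>.\<close>
  have two: "norm u \<le> K0 * norm (u + w)"
    if u: "u = (\<Sum>i=1..<n. c i *\<^sub>R e i)" and w: "w = (\<Sum>i=n..<m. c i *\<^sub>R e i)" for u w c n m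
  proof (cases "u = 0 \<or> w = 0")
    case True
    then show ?thesis
      using K0 mult_right_mono[of 1 K0 "norm u"] by auto
  next
    case False
    have su: "supp e u \<subseteq> {2..n}" and sw: "supp e w \<subseteq> {Suc n..m}"
      unfolding u w supp_def by (auto simp: coord)
    have nonempty: "supp e v \<noteq> {}" if "v \<noteq> 0" "v = (\<Sum>i\<in>I. c i *\<^sub>R e i)" "finite I" for v I
    proof
      assume "supp e v = {}"
      then have "coordinates e v i = 0" for i by (auto simp: supp_def)
      then have "(\<lambda>j. if j \<in> I then c j else 0) = (\<lambda>j. 0)"
        using that(2) coord[OF that(3), of c] by auto
      then have "\<forall>i\<in>I. c i = 0" by (metis (mono_tags))
      then show False using that(1,2) by simp
    qed
    have ne': "supp e u \<noteq> {}" "supp e w \<noteq> {}" using False nonempty u w by auto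
    have fin: "finite (supp e u)" "finite (supp e w)" using su sw finite_subset by auto
    have "block_vector e u" "block_vector e w"
      using False fin span_subset_closed_span[of e] unfolding u w block_vector_def
      by (auto intro!: subsetD[OF span_subset_closed_span] span_sum span_scale intro: span_base)
    moreover have "Max (supp e u) \<le> n" "Suc n \<le> Min (supp e w)"
      using fin ne' su sw by auto
    ultimately have "finite_block_basis [u, w] e"
      by (simp add: finite_block_basis_def block_less_def)
    moreover have "2 \<le> Min (supp e u)" using fin ne' su by auto
    ultimately have "1 / C * (norm u + norm w) \<le> norm (u + w)"
      using C(2)[of "[u, w]"] by simp
    then have "norm u + norm w \<le> C * norm (u + w)" using C(1) by (simp add: field_simps)
    also have "\<dots> \<le> K0 * norm (u + w)" using K0 by (intro mult_right_mono) auto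
    finally show ?thesis using norm_ge_zero[of w] by linarith
  qed
  define e' where "e' i = e (Suc i)" for i
  have shift: "(\<Sum>i<n. c i *\<^sub>R e' i) = (\<Sum>i=1..<Suc n. c (i - 1) *\<^sub>R e i)" for c n
    unfolding e'_def using sum.shift_bounds_Suc_ivl[of "\<lambda>i. c (i - 1) *\<^sub>R e i" 0 n]
    by (simp add: atLeast0LessThan)
  have e': "basic K0 e'"
    unfolding basic_def
  proof (intro conjI allI impI)
    fix c n m assume nm: "n \<le> (m::nat)"
    have "(\<Sum>i=1..<Suc n. c (i - 1) *\<^sub>R e i) + (\<Sum>i=Suc n..<Suc m. c (i - 1) *\<^sub>R e i) =
        (\<Sum>i=1..<Suc m. c (i - 1) *\<^sub>R e i)"
      using nm by (intro sum.atLeastLessThan_concat) auto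
    then show "norm (\<Sum>i<n. c i *\<^sub>R e' i) \<le> K0 * norm (\<Sum>i<m. c i *\<^sub>R e' i)"
      unfolding shift using two[OF refl refl, where n="Suc n" and m="Suc m" and c="\<lambda>i. c (i - 1)"] by metis
  qed (simp add: e'_def ne)
  \<comment> \<open>Otherwise \<open>e 0\<close> would have a second expansion, one with first
    coefficient 0.\<close>
  have "e 0 \<notin> closed_span e'"
  proof
    assume "e 0 \<in> closed_span e'"
    then obtain c where "(\<lambda>i. c i *\<^sub>R e' i) sums e 0"
      using closed_span_expansion[OF e'] by blast
    then have "(\<lambda>i. case_nat 0 c i *\<^sub>R e i) sums (e 0 + case_nat 0 c 0 *\<^sub>R e 0)"
      by (intro sums_Suc) (simp add: e'_def)
    then have "(\<lambda>i. case_nat 0 c i *\<^sub>R e i) sums e 0" by simp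
    moreover have "(\<lambda>i. (if i = 0 then 1 else 0) *\<^sub>R e i) sums e 0"
      using sums_finite[of "{0}" "\<lambda>i. (if i = 0 then 1 else 0) *\<^sub>R e i"] by simp
    ultimately have "case_nat 0 c = (\<lambda>i. if i = 0 then 1 else (0::real))" by (rule uniq)
    then have "case_nat 0 c 0 = (if (0::nat) = 0 then 1 else (0::real))" by (rule fun_cong)
    then show False by simp
  qed
  moreover have "open (- closed_span e')" using closed_closed_span by auto
  ultimately obtain r where r: "r > 0" "ball (e 0) r \<subseteq> - closed_span e'"
    by (meson ComplI openE)
  have dist: "\<bar>t\<bar> * r \<le> norm (t *\<^sub>R e 0 + v)" if v: "v \<in> closed_span e'" for t v
  proof (cases "t = 0")
    case False
    have "- (1 / t) *\<^sub>R v \<in> closed_span e'"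
      using v subspace_closed_span by (intro subspace_scale)
    then have "r \<le> norm (e 0 - (- (1 / t) *\<^sub>R v))"
      using r(2) by (force simp: dist_norm not_less[symmetric])
    moreover have "t *\<^sub>R e 0 + v = t *\<^sub>R (e 0 - (- (1 / t) *\<^sub>R v))"
      using False by (simp add: scaleR_right_distrib)
    ultimately show ?thesis
      by (metis abs_ge_zero mult_left_mono norm_scaleR)
  qed simp
  \<comment> \<open>The first term of a sum s has norm at most \<open>norm (e 0) / r\<close> times
    that of s. The remaining terms lose \<open>K0\<close> against s minus its first term, that is,
    at most \<open>K0 * (1 + norm (e 0) / r)\<close> against s.\<close>
  define K where "K = (1 + K0) * norm (e 0) / r + K0"
  have K: "K \<ge> 0" using K0(1) r(1) by (simp add: K_def)
  have "basic K e"
    unfolding basic_def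
  proof (intro conjI allI impI)
    fix c n m assume nm: "n \<le> (m::nat)"
    let ?s = "\<Sum>i<m. c i *\<^sub>R e i"
    show "norm (\<Sum>i<n. c i *\<^sub>R e i) \<le> K * norm ?s"
    proof (cases "n = 0")
      case False
      have split: "(\<Sum>i<k. c i *\<^sub>R e i) = c 0 *\<^sub>R e 0 + (\<Sum>i<k - 1. c (Suc i) *\<^sub>R e' i)" if "k > 0" for k
        unfolding e'_def using sum.lessThan_Suc_shift[of "\<lambda>i. c i *\<^sub>R e i" "k - 1"] that by simp
      let ?v = "\<lambda>k. \<Sum>i<k - 1. c (Suc i) *\<^sub>R e' i"
      have "?v m \<in> closed_span e'"
        by (auto intro!: subsetD[OF span_subset_closed_span] span_sum span_scale intro: span_base)
      then have c0: "\<bar>c 0\<bar> * r \<le> norm ?s"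
        using dist split[of m] False nm by simp
      have b: "norm (c 0 *\<^sub>R e 0) \<le> norm (e 0) / r * norm ?s"
        using mult_left_mono[OF c0, of "norm (e 0) / r"] r(1) by (simp add: field_simps)
      have "norm (?v n) \<le> K0 * norm (?v m)"
        using nm by (intro basic_partial[OF e']) simp
      also have "norm (?v m) = norm (?s - c 0 *\<^sub>R e 0)"
        using split[of m] False nm by simp
      also have "K0 * \<dots> \<le> K0 * (norm ?s + norm (e 0) / r * norm ?s)"
        using K0 b norm_triangle_ineq4[of ?s "c 0 *\<^sub>R e 0"] by (intro mult_left_mono) linarith+
      finally have "norm (\<Sum>i<n. c i *\<^sub>R e i) \<le>
          norm (e 0) / r * norm ?s + K0 * (norm ?s + norm (e 0) / r * norm ?s)"
        using split[of n] False b norm_triangle_ineq[of "c 0 *\<^sub>R e 0" "?v n"] by simp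
      also have "\<dots> = K * norm ?s" using r(1) by (simp add: K_def field_simps)
      finally show ?thesis .
    qed (use K in simp)
  qed (rule ne)
  then show ?thesis ..
qed

section \<open>Lower estimates\<close>

text \<open>
  The supports of the \<open>u f\<close> need not start exactly at \<open>f\<close>; for regular families this does not
  matter, and it makes the estimate stable under block bases.
\<close>

definition lower_estimate ::
  "(nat \<Rightarrow> 'a::real_normed_vector) \<Rightarrow> ('a \<Rightarrow> real) \<Rightarrow> nat set set \<Rightarrow> real \<Rightarrow> bool" where
  "lower_estimate x p S d \<longleftrightarrow>
     (\<forall>F\<in>S. \<forall>r u. (\<forall>f\<in>F. \<forall>f'\<in>F. f < f' \<longrightarrow> r f \<le> f') \<and> (\<forall>f\<in>F. u f \<in> blk x f (r f)) \<longrightarrow>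
        d * (\<Sum>f\<in>F. p (u f)) \<le> p (\<Sum>f\<in>F. u f))"

lemma lower_estimateI:
  assumes "\<And>F r u. F \<in> S \<Longrightarrow> (\<And>f f'. f \<in> F \<Longrightarrow> f' \<in> F \<Longrightarrow> f < f' \<Longrightarrow> r f \<le> f') \<Longrightarrow>
    (\<And>f. f \<in> F \<Longrightarrow> u f \<in> blk x f (r f)) \<Longrightarrow> d * (\<Sum>f\<in>F. p (u f)) \<le> p (\<Sum>f\<in>F. u f)"
  shows "lower_estimate x p S d"
  using assms unfolding lower_estimate_def by blast

lemma lower_estimateD:
  assumes "lower_estimate x p S d" "F \<in> S" "\<And>f f'. f \<in> F \<Longrightarrow> f' \<in> F \<Longrightarrow> f < f' \<Longrightarrow> r f \<le> f'"
    "\<And>f. f \<in> F \<Longrightarrow> u f \<in> blk x f (r f)"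
  shows "d * (\<Sum>f\<in>F. p (u f)) \<le> p (\<Sum>f\<in>F. u f)"
  using assms unfolding lower_estimate_def by blast

text \<open>Only the image of each index set under \<sigma> has to belong to \<open>T\<close>. This
  covers both a change of block basis within one regular family, by spreading, and a subsequence
  along an embedding.\<close>

lemma lower_estimate_blocks:
  assumes z: "blocks_via \<sigma> x z" and ST: "\<And>F. F \<in> S \<Longrightarrow> \<sigma> ` F \<in> T" and T: "lower_estimate x p T d"
  shows "lower_estimate z p S d"
proof (rule lower_estimateI)
  fix F r u
  assume F: "F \<in> S" and r: "\<And>f f'. f \<in> F \<Longrightarrow> f' \<in> F \<Longrightarrow> f < f' \<Longrightarrow> r f \<le> (f'::nat)"
    and u: "\<And>f. f \<in> F \<Longrightarrow> u f \<in> blk z f (r f)"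
  have \<sigma>: "strict_mono \<sigma>" using z by (simp add: blocks_via_def)
  then have inj: "inj \<sigma>" by (rule strict_mono_imp_inj_on)
  define u' where "u' g = u (the_inv \<sigma> g)" for g
  define r' where "r' g = \<sigma> (r (the_inv \<sigma> g))" for g
  have inv: "the_inv \<sigma> (\<sigma> f) = f" for f using the_inv_f_f[OF inj] .
  have "d * (\<Sum>f\<in>\<sigma> ` F. p (u' f)) \<le> p (\<Sum>f\<in>\<sigma> ` F. u' f)"
  proof (rule lower_estimateD[OF T ST[OF F]])
    show "r' g \<le> g'" if "g \<in> \<sigma> ` F" "g' \<in> \<sigma> ` F" "g < g'" for g g'
      using that r \<sigma> by (auto simp: r'_def inv strict_mono_less strict_mono_less_eq)
    show "u' g \<in> blk x g (r' g)" if "g \<in> \<sigma> ` F" for g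
      using that blocks_via_blk[OF z u] by (auto simp: u'_def r'_def inv)
  qed
  then show "d * (\<Sum>f\<in>F. p (u f)) \<le> p (\<Sum>f\<in>F. u f)"
    by (simp add: sum.reindex[OF inj_on_subset[OF inj]] u'_def inv)
qed

text \<open>The estimate for \<open>S\<close> is applied inside each piece and the one for
  \<open>T\<close> to the sums over the pieces. The outer constant must be nonnegative, since it
  multiplies the inner inequalities.\<close>

lemma lower_estimate_fam_comp:
  assumes S: "lower_estimate x p S d" and T: "lower_estimate x p T d'" and d': "0 \<le> d'"
  shows "lower_estimate x p (fam_comp T S) (d' * d)"
proof (rule lower_estimateI)
  fix F r u
  assume F: "F \<in> fam_comp T S" and r: "\<And>f f'. f \<in> F \<Longrightarrow> f' \<in> F \<Longrightarrow> f < f' \<Longrightarrow> r f \<le> (f'::nat)"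
    and u: "\<And>f. f \<in> F \<Longrightarrow> u f \<in> blk x f (r f)"
  from F obtain H where H: "H \<in> T" "H \<subseteq> F" "\<And>f. f \<in> F \<Longrightarrow> \<exists>h\<in>H. h \<le> f"
    "\<And>h. h \<in> H \<Longrightarrow> piece H F h \<in> S" "finite F" "0 \<notin> F"
    by (rule fam_compE) blast
  have fH: "finite H" using H finite_subset by blast
  define v where "v h = (\<Sum>f\<in>piece H F h. u f)" for h
  define R where "R h = Max (r ` piece H F h)" for h
  have fp: "finite (piece H F h)" for h using H(5) by (auto simp: piece_def)
  have pF: "piece H F h \<subseteq> F" for h by (auto simp: piece_def)
  have hp: "h \<in> piece H F h" if "h \<in> H" for h using H(2) that by (auto simp: piece_def)
  have F_eq: "F = (\<Union>h\<in>H. piece H F h)"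
  proof
    show "F \<subseteq> (\<Union>h\<in>H. piece H F h)"
    proof
      fix f assume "f \<in> F"
      with ex_piece[OF fH this H(3)] show "f \<in> (\<Union>h\<in>H. piece H F h)" by blast
    qed
  qed (use pF in blast)
  have split: "(\<Sum>f\<in>F. g f) = (\<Sum>h\<in>H. \<Sum>f\<in>piece H F h. g f)" for g :: "nat \<Rightarrow> 'c::comm_monoid_add"
  proof -
    have "(\<Sum>f\<in>F. g f) = sum g (\<Union>h\<in>H. piece H F h)"
      by (rule arg_cong[OF F_eq])
    also have "\<dots> = (\<Sum>h\<in>H. \<Sum>f\<in>piece H F h. g f)"
    proof (rule sum.UNION_disjoint[OF fH])
      show "\<forall>i\<in>H. \<forall>j\<in>H. i \<noteq> j \<longrightarrow> piece H F i \<inter> piece H F j = {}"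
        using piece_unique by (meson disjoint_iff)
    qed (use fp in blast)
    finally show ?thesis .
  qed
  have "d' * (\<Sum>h\<in>H. p (v h)) \<le> p (\<Sum>h\<in>H. v h)"
  proof (rule lower_estimateD[OF T H(1)])
    show "R h \<le> h'" if "h \<in> H" "h' \<in> H" "h < h'" for h h'
      unfolding R_def using fp hp[OF that(1)] that H(2) r
      by (subst Max_le_iff) (auto simp: piece_def)
    show "v h \<in> blk x h (R h)" if "h \<in> H" for h
      unfolding v_def
    proof (rule subspace_sum[OF subspace_blk])
      fix f assume f: "f \<in> piece H F h"
      then have "h \<le> f" "r f \<le> R h" "u f \<in> blk x f (r f)"
        using fp u by (auto simp: R_def piece_def)
      then show "u f \<in> blk x h (R h)" using blk_mono by blast
    qed
  qed
  moreover have "d * (\<Sum>f\<in>piece H F h. p (u f)) \<le> p (v h)" if "h \<in> H" for h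
    unfolding v_def
    by (rule lower_estimateD[OF S H(4)[OF that], where r=r]) (use r u pF[of h] in blast)+
  then have "(\<Sum>h\<in>H. d * (\<Sum>f\<in>piece H F h. p (u f))) \<le> (\<Sum>h\<in>H. p (v h))"
    by (rule sum_mono)
  then have "d' * (\<Sum>h\<in>H. d * (\<Sum>f\<in>piece H F h. p (u f))) \<le> d' * (\<Sum>h\<in>H. p (v h))"
    using d' by (rule mult_left_mono)
  ultimately show "d' * d * (\<Sum>f\<in>F. p (u f)) \<le> p (\<Sum>f\<in>F. u f)"
    by (simp add: split v_def sum_distrib_left mult.assoc)
qed

section \<open>Equivalent norms, and admissible lists as indexed families\<close>

lemma equivalent_normD:
  assumes "equivalent_norm Y p"
  shows "u \<in> Y \<Longrightarrow> v \<in> Y \<Longrightarrow> p (u + v) \<le> p u + p v" "u \<in> Y \<Longrightarrow> p (t *\<^sub>R u) = \<bar>t\<bar> * p u"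
    "u \<in> Y \<Longrightarrow> 0 \<le> p u" "u \<in> Y \<Longrightarrow> u \<noteq> 0 \<Longrightarrow> 0 < p u"
    "u \<in> Y \<Longrightarrow> p 0 = 0"
proof -
  obtain c where c: "c > 0" "\<And>u. u \<in> Y \<Longrightarrow> c * norm u \<le> p u"
    using assms by (auto simp: equivalent_norm_def)
  have hom: "p (t *\<^sub>R u) = \<bar>t\<bar> * p u" if "u \<in> Y" for t u
    using assms that by (simp add: equivalent_norm_def)
  show "u \<in> Y \<Longrightarrow> v \<in> Y \<Longrightarrow> p (u + v) \<le> p u + p v" "u \<in> Y \<Longrightarrow> p (t *\<^sub>R u) = \<bar>t\<bar> * p u"
    using assms by (auto simp: equivalent_norm_def)
  show "0 \<le> p u" if "u \<in> Y"
    using c(2)[OF that] c(1) by (meson less_imp_le mult_nonneg_nonneg norm_ge_zero order_trans)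
  show "0 < p u" if "u \<in> Y" "u \<noteq> 0"
    using c(2)[OF that(1)] c(1) that(2) by (meson less_le_trans mult_pos_pos zero_less_norm_iff)
  show "p 0 = 0" if "u \<in> Y" using hom[OF that, of 0] by simp
qed

lemma equivalent_norm_mono: "equivalent_norm Y p \<Longrightarrow> Z \<subseteq> Y \<Longrightarrow> equivalent_norm Z p"
  unfolding equivalent_norm_def by (meson subsetD)

lemma equivalent_norm_norm: "equivalent_norm Y norm"
  unfolding equivalent_norm_def using norm_triangle_ineq by (auto intro!: exI[of _ 1])

lemma sum_list_sorted_list_of_set:
  fixes u :: "nat \<Rightarrow> 'a::comm_monoid_add"
  assumes "finite G"
  shows "sum_list (map u (sorted_list_of_set G)) = (\<Sum>f\<in>G. u f)"
  using assms by (simp add: sum_list_distinct_conv_sum_set)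

text \<open>Zero vectors are dropped, and the true minima of the remaining supports form a spread of
  a subset of \<open>F\<close>, so the list of vectors is admissible. Conversely, an admissible list
  is indexed by the minima of its supports, with windows ending just after the maxima.\<close>

lemma admissible_iff_lower_estimate:
  assumes a: "fundamental_sequences a" and x: "basic K x" and p: "p 0 = 0"
  shows "(\<forall>ys. admissible a \<alpha> x ys \<longrightarrow> p (\<Sum>y\<leftarrow>ys. y) \<ge> d * (\<Sum>y\<leftarrow>ys. p y)) \<longleftrightarrow>
    lower_estimate x p (schreier a \<alpha>) d"
proof (intro iffI allI impI)
  note reg = regular_schreier[OF a, of \<alpha>]
  assume adm: "\<forall>ys. admissible a \<alpha> x ys \<longrightarrow> p (\<Sum>y\<leftarrow>ys. y) \<ge> d * (\<Sum>y\<leftarrow>ys. p y)"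
  show "lower_estimate x p (schreier a \<alpha>) d"
  proof (rule lower_estimateI)
    fix F r u
    assume F: "F \<in> schreier a \<alpha>" and r: "\<And>f f'. f \<in> F \<Longrightarrow> f' \<in> F \<Longrightarrow> f < f' \<Longrightarrow> r f \<le> (f'::nat)"
      and u: "\<And>f. f \<in> F \<Longrightarrow> u f \<in> blk x f (r f)"
    have fF: "finite F" using regular_finite[OF reg F] .
    define G where "G = {f\<in>F. u f \<noteq> 0}"
    have G: "finite G" "G \<subseteq> F" using fF by (auto simp: G_def)
    define h where "h f = Min (supp x (u f))" for f
    have bv: "block_vector x (u f)" "f \<le> h f" "Max (supp x (u f)) < r f" if "f \<in> G" for f
      using block_vector_blk[OF x u[of f]] that by (auto simp: G_def h_def)
    have less: "Max (supp x (u f)) < h f'" if "f \<in> G" "f' \<in> G" "f < f'" for f f'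
      using bv(3)[OF that(1)] r[of f f'] bv(2)[OF that(2)] that G(2) by force
    have "h f \<le> Max (supp x (u f))" if "f \<in> G" for f
      using block_vectorD(3)[OF x bv(1)[OF that]] by (simp add: h_def)
    then have "strict_mono_on G h"
      using less by (force simp: strict_mono_on_def)
    then have hG: "h ` G \<in> schreier a \<alpha>"
      using regular_spread[OF reg regular_subset[OF reg F G(2)]] bv(2) by blast
    define ys where "ys = map u (sorted_list_of_set G)"
    have "sorted_wrt (block_less x) ys"
      unfolding ys_def sorted_wrt_map
      by (rule sorted_wrt_mono_rel[OF _ strict_sorted_list_of_set])
        (use G less in \<open>auto simp: block_less_def h_def\<close>)
    then have "admissible a \<alpha> x ys"
      using hG bv(1) G(1) by (auto simp: admissible_def finite_block_basis_def ys_def h_def image_image)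
    then have "d * (\<Sum>y\<leftarrow>ys. p y) \<le> p (\<Sum>y\<leftarrow>ys. y)" using adm by blast
    moreover have "(\<Sum>y\<leftarrow>ys. y) = (\<Sum>f\<in>G. u f)" "(\<Sum>y\<leftarrow>ys. p y) = (\<Sum>f\<in>G. p (u f))"
      using sum_list_sorted_list_of_set[OF G(1), of u]
        sum_list_sorted_list_of_set[OF G(1), of "\<lambda>f. p (u f)"]
      by (simp_all add: ys_def o_def)
    moreover have "(\<Sum>f\<in>G. u f) = (\<Sum>f\<in>F. u f)" "(\<Sum>f\<in>G. p (u f)) = (\<Sum>f\<in>F. p (u f))"
      using fF p by (auto intro!: sum.mono_neutral_left simp: G_def)
    ultimately show "d * (\<Sum>f\<in>F. p (u f)) \<le> p (\<Sum>f\<in>F. u f)" by simp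
  qed
next
  fix ys assume le: "lower_estimate x p (schreier a \<alpha>) d" and ys: "admissible a \<alpha> x ys"
  have bv: "block_vector x y" if "y \<in> set ys" for y
    using ys that by (auto simp: admissible_def finite_block_basis_def)
  have sorted: "sorted_wrt (block_less x) ys"
    using ys by (auto simp: admissible_def finite_block_basis_def)
  define m where "m y = Min (supp x y)" for y
  have mM: "m y \<le> Max (supp x y)" if "y \<in> set ys" for y
    using block_vectorD(3)[OF x bv[OF that]] by (simp add: m_def)
  have tri: "Max (supp x (ys ! i)) < m (ys ! j)" if "i < j" "j < length ys" for i j
    using sorted_wrt_nth_less[OF sorted that] by (simp add: block_less_def m_def)
  have mless: "m (ys ! i) < m (ys ! j)" if "i < j" "j < length ys" for i j
    using tri[OF that] mM[of "ys ! i"] that by simp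
  have dist: "distinct ys"
    unfolding distinct_conv_nth using mless by (metis less_irrefl linorder_neqE_nat)
  have inj: "inj_on m (set ys)"
  proof (rule inj_onI)
    fix y z assume "y \<in> set ys" "z \<in> set ys" "m y = m z"
    then show "y = z" using mless by (metis in_set_conv_nth less_irrefl linorder_neqE_nat)
  qed
  have cmp: "Max (supp x y) < m z" if yz: "y \<in> set ys" "z \<in> set ys" "m y < m z" for y z
  proof -
    obtain i j where ij: "i < length ys" "y = ys ! i" "j < length ys" "z = ys ! j"
      using yz by (metis in_set_conv_nth)
    then have "i < j" using yz(3) mless by (metis linorder_neqE_nat order.asym less_irrefl)
    then show ?thesis using tri ij by blast
  qed
  define u where "u = the_inv_into (set ys) m"
  have u: "u (m y) = y" if "y \<in> set ys" for y
    unfolding u_def using inj that by (rule the_inv_into_f_f)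
  have "d * (\<Sum>f\<in>m ` set ys. p (u f)) \<le> p (\<Sum>f\<in>m ` set ys. u f)"
  proof (rule lower_estimateD[OF le])
    show "m ` set ys \<in> schreier a \<alpha>" using ys by (simp add: admissible_def m_def)
    show "Suc (Max (supp x (u f))) \<le> f'" if "f \<in> m ` set ys" "f' \<in> m ` set ys" "f < f'" for f f'
      using that u cmp by (auto simp: Suc_le_eq)
    show "u f \<in> blk x f (Suc (Max (supp x (u f))))" if "f \<in> m ` set ys" for f
      using that u block_vectorD(1)[OF x bv] by (auto simp: m_def)
  qed
  then show "d * (\<Sum>y\<leftarrow>ys. p y) \<le> p (\<Sum>y\<leftarrow>ys. y)"
    using u sum_list_distinct_conv_sum_set[OF dist, of p] sum_list_distinct_conv_sum_set[OF dist, of "\<lambda>y. y"]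
    by (simp add: sum.reindex[OF inj])
qed

section \<open>The constants\<close>

lemma equivalent_norm_zero: "equivalent_norm (closed_span x) p \<Longrightarrow> p 0 = 0"
  using equivalent_normD(5)[of "closed_span x" p 0] subspace_0[OF subspace_closed_span] by blast

text \<open>The supremum defining the constant is attained, because the constraint is linear in the
  constant once the sum of norms is positive. Singletons in the Schreier class bound it by
  1.\<close>

lemma
  assumes a: "fundamental_sequences a" and x: "basic K x" and p: "equivalent_norm (closed_span x) p"
  shows delta_lower_estimate: "lower_estimate x p (schreier a \<alpha>) (delta a \<alpha> x p)"
    and delta_upper: "0 \<le> d \<Longrightarrow> lower_estimate x p (schreier a \<alpha>) d \<Longrightarrow> d \<le> delta a \<alpha> x p"
    and delta_nonneg: "0 \<le> delta a \<alpha> x p"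
    and delta_le_1: "delta a \<alpha> x p \<le> 1"
proof -
  let ?S = "schreier a \<alpha>"
  let ?A = "{d. d \<ge> 0 \<and> lower_estimate x p ?S d}"
  note reg = regular_schreier[OF a, of \<alpha>]
  have p0: "p 0 = 0" by (rule equivalent_norm_zero[OF p])
  have delta: "delta a \<alpha> x p = Sup ?A"
    unfolding delta_def admissible_iff_lower_estimate[where p=p, OF a x p0] ..
  have nonneg: "0 \<le> p v" if "v \<in> blk x f r" for v f r
    using equivalent_normD(3)[OF p] that blk_subset_closed_span by blast
  have sum_blk: "(\<Sum>f\<in>F. u f) \<in> closed_span x" if "\<And>f. f \<in> F \<Longrightarrow> u f \<in> blk x f (r f)" for F u r
    using that blk_subset_closed_span by (intro subspace_sum[OF subspace_closed_span]) blast
  have zero: "0 \<in> ?A"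
  proof (simp, rule lower_estimateI)
    fix F r u
    assume u: "\<And>f. f \<in> F \<Longrightarrow> u f \<in> blk x f (r f)"
    have "0 \<le> p (\<Sum>f\<in>F. u f)" by (rule equivalent_normD(3)[OF p sum_blk[OF u]])
    then show "0 * (\<Sum>f\<in>F. p (u f)) \<le> p (\<Sum>f\<in>F. u f)" by simp
  qed
  have le1: "d \<le> 1" if "lower_estimate x p ?S d" for d
  proof -
    have x0: "x 0 \<in> blk x 1 2" unfolding blk_def by (intro span_base imageI) simp
    have "d * (\<Sum>f\<in>{1::nat}. p (x 0)) \<le> p (\<Sum>f\<in>{1::nat}. x 0)"
      by (rule lower_estimateD[OF that regular_singleton[OF reg], where r="\<lambda>_. 2" and u="\<lambda>_. x 0"])
        (use x0 in auto)
    moreover have "0 < p (x 0)"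
      using equivalent_normD(4)[OF p] x0 blk_subset_closed_span basic_nonzero[OF x] by blast
    ultimately show ?thesis by simp
  qed
  then have bdd: "bdd_above ?A" by (intro bdd_aboveI[of _ 1]) simp
  show "0 \<le> delta a \<alpha> x p" unfolding delta using zero bdd by (rule cSup_upper)
  show "d \<le> delta a \<alpha> x p" if "0 \<le> d" "lower_estimate x p ?S d" for d
    unfolding delta using that by (intro cSup_upper bdd) simp
  show "delta a \<alpha> x p \<le> 1" unfolding delta using zero le1 by (intro cSup_least) auto
  show "lower_estimate x p ?S (delta a \<alpha> x p)"
  proof (rule lower_estimateI)
    fix F r u
    assume *: "F \<in> ?S" "\<And>f f'. f \<in> F \<Longrightarrow> f' \<in> F \<Longrightarrow> f < f' \<Longrightarrow> r f \<le> (f'::nat)"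
      "\<And>f. f \<in> F \<Longrightarrow> u f \<in> blk x f (r f)"
    let ?s = "\<Sum>f\<in>F. p (u f)"
    have s: "0 \<le> ?s" using nonneg *(3) by (meson sum_nonneg)
    have d: "d * ?s \<le> p (\<Sum>f\<in>F. u f)" if "d \<in> ?A" for d
      using that * by (intro lower_estimateD[where r=r]) auto
    show "delta a \<alpha> x p * ?s \<le> p (\<Sum>f\<in>F. u f)"
    proof (cases "?s = 0")
      case False
      then have s: "0 < ?s" using s by simp
      have "Sup ?A \<le> p (\<Sum>f\<in>F. u f) / ?s"
        using zero d s by (intro cSup_least) (auto simp: pos_le_divide_eq)
      then show ?thesis using s by (simp add: delta pos_le_divide_eq)
    qed (use d[OF zero] in simp)
  qed
qed

lemma schreier_image:
  assumes "fundamental_sequences a" "strict_mono \<sigma>" "F \<in> schreier a \<alpha>"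
  shows "\<sigma> ` F \<in> schreier a \<alpha>"
  by (rule regular_spread[OF regular_schreier[OF assms(1)] assms(3)])
    (use assms(2) in \<open>auto intro: strict_mono_on_strict_mono strict_mono_imp_increasing\<close>)

text \<open>Index sets over \<open>z\<close> become spread index sets over \<open>x\<close>, which
  remain in the class. Hence the constants can only grow along block bases.\<close>

lemma delta_blocks:
  assumes a: "fundamental_sequences a" and x: "basic K x" and p: "equivalent_norm (closed_span x) p"
    and z: "blocks_via \<sigma> x z"
  shows "delta a \<alpha> x p \<le> delta a \<alpha> z p"
proof -
  have "lower_estimate z p (schreier a \<alpha>) (delta a \<alpha> x p)"
    by (rule lower_estimate_blocks[OF z _ delta_lower_estimate[OF a x p]])
      (use z schreier_image[OF a] in \<open>auto simp: blocks_via_def\<close>)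
  then show ?thesis
    by (intro delta_upper[OF a basic_blocks[OF x z]] delta_nonneg[OF a x p]
        equivalent_norm_mono[OF p] closed_span_blocks[OF z])
qed

lemma embeds_lower_estimate:
  assumes x: "basic K x" and "S \<lesssim>\<^sub>F T" and "lower_estimate x p T d"
  shows "\<exists>\<sigma> z. blocks_via \<sigma> x z \<and> lower_estimate z p S d"
proof -
  obtain N where N: "strict_mono N" "\<And>F. F \<in> S \<Longrightarrow> N ` F \<in> T"
    using assms(2) by (auto simp: embeds_def)
  have "blocks_via N x (\<lambda>i. x (N (Suc i) - 1))"
    using N(1) basic_nonzero[OF x] by (rule blocks_via_subseq)
  then show ?thesis
    using lower_estimate_blocks[OF _ N(2) assms(3)] by blast
qed

lemma Delta_stabilizes_tail:
  assumes y: "basic K y" and st: "Delta_stabilizes a y \<gamma>" and w: "blocks_via \<sigma> y w" and "0 < e"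
  shows "\<exists>n. \<bar>delta a \<alpha> (tail n w) norm - \<gamma> \<alpha>\<bar> < e"
proof -
  obtain \<epsilon> m where \<epsilon>: "\<epsilon> \<longlonglongrightarrow> 0" "m \<ge> 1"
    and m: "\<And>n z. n \<ge> m \<Longrightarrow> block_basis z (tail n y) \<Longrightarrow> \<bar>delta a \<alpha> z norm - \<gamma> \<alpha>\<bar> < \<epsilon> n"
    using st unfolding Delta_stabilizes_def by metis
  obtain n0 where n0: "\<And>n. n \<ge> n0 \<Longrightarrow> norm (\<epsilon> n - 0) < e"
    using LIMSEQ_D[OF \<epsilon>(1) \<open>0 < e\<close>] by blast
  let ?n = "max m n0"
  have "basic K (tail ?n y)"
    using basic_blocks[OF y blocks_via_tail] basic_nonzero[OF y] by blast
  then have "block_basis (tail ?n w) (tail ?n y)"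
    using blocks_via_tail_tail[OF w] block_basis_iff_blocks_via by blast
  then have "\<bar>delta a \<alpha> (tail ?n w) norm - \<gamma> \<alpha>\<bar> < \<epsilon> ?n" by (intro m) auto
  also have "\<dots> < e" using n0[of ?n] by simp
  finally show ?thesis ..
qed

context
  fixes a :: "omega1 \<Rightarrow> nat \<Rightarrow> omega1" and y :: "nat \<Rightarrow> 'a::real_normed_vector" and K :: real
    and \<gamma> :: "omega1 \<Rightarrow> real"
  assumes a: "fundamental_sequences a" and y: "basic K y" and st: "Delta_stabilizes a y \<gamma>"
begin

text \<open>Passing to a tail does not lower the constant, and suitable tails have a constant
  arbitrarily near the stable value. Together with \<open>stable_less_delta\<close> this identifies
  the stable value as the supremum of the constants over the block bases of any given block basis of
  \<open>y\<close>.\<close>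

lemma delta_le_stable:
  assumes w: "blocks_via \<sigma> y w"
  shows "delta a \<alpha> w norm \<le> \<gamma> \<alpha>"
proof (rule field_le_epsilon)
  fix e :: real assume "0 < e"
  then obtain n where n: "\<bar>delta a \<alpha> (tail n w) norm - \<gamma> \<alpha>\<bar> < e"
    using Delta_stabilizes_tail[OF y st w] by blast
  have bw: "basic K w" using basic_blocks[OF y w] .
  have "delta a \<alpha> w norm \<le> delta a \<alpha> (tail n w) norm"
    using delta_blocks[OF a bw equivalent_norm_norm blocks_via_tail] basic_nonzero[OF bw] by blast
  then show "delta a \<alpha> w norm \<le> \<gamma> \<alpha> + e" using n by linarith
qed

lemma stable_less_delta:
  assumes w: "blocks_via \<sigma> y w" and "t < \<gamma> \<alpha>"
  shows "\<exists>\<tau> z. blocks_via \<tau> w z \<and> t < delta a \<alpha> z norm"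
proof -
  obtain n where n: "\<bar>delta a \<alpha> (tail n w) norm - \<gamma> \<alpha>\<bar> < \<gamma> \<alpha> - t"
    using Delta_stabilizes_tail[OF y st w, of "\<gamma> \<alpha> - t" \<alpha>] assms(2) by auto
  have "blocks_via (\<lambda>i. i + (n - 1)) w (tail n w)"
    using blocks_via_tail basic_nonzero[OF basic_blocks[OF y w]] by blast
  then show ?thesis using n by (intro exI conjI) (assumption, linarith)
qed

lemma lower_estimate_le_stable:
  assumes w: "blocks_via \<sigma> y w" and "lower_estimate w norm (schreier a \<alpha>) t" "0 \<le> t"
  shows "t \<le> \<gamma> \<alpha>"
  using delta_upper[OF a basic_blocks[OF y w] equivalent_norm_norm assms(3,2)] delta_le_stable[OF w]
  by (rule order_trans)


lemma stable_nonneg: "0 \<le> \<gamma> \<alpha>"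
  using delta_nonneg[OF a y equivalent_norm_norm]
    delta_le_stable[OF blocks_via_self[OF basic_nonzero[OF y]]]
  by (rule order_trans)

text \<open>Nearly optimal constants for \<alpha> and then for \<beta> are achieved on successive
  block bases. Since the class of \<alpha> + \<beta> corresponds to the class of \<alpha> inside
  that of \<beta>, the product is a lower estimate on a further subsequence.\<close>

lemma stable_mult: "\<gamma> \<alpha> * \<gamma> \<beta> \<le> \<gamma> (\<alpha> + \<beta>)"
proof -
  have *: "s * t \<le> \<gamma> (\<alpha> + \<beta>)" if st: "0 \<le> s" "s < \<gamma> \<alpha>" "0 \<le> t" "t < \<gamma> \<beta>" for s t
  proof -
    obtain \<sigma> z where z: "blocks_via \<sigma> y z" "s < delta a \<alpha> z norm"
      using stable_less_delta[OF blocks_via_self[OF basic_nonzero[OF y]] st(2)] by blast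
    obtain \<tau> w where w: "blocks_via \<tau> z w" "t < delta a \<beta> w norm"
      using stable_less_delta[OF z(1) st(4)] by blast
    note bz = basic_blocks[OF y z(1)]
    note bw = basic_blocks[OF bz w(1)]
    have yw: "blocks_via (\<lambda>i. \<sigma> (\<tau> i)) y w" by (rule blocks_via_trans[OF z(1) w(1)])
    \<comment> \<open>Monotonicity preserves the bound for \<alpha> while \<open>w\<close> is chosen
      for \<beta>.\<close>
    have s: "s < delta a \<alpha> w norm"
      using z(2) delta_blocks[OF a bz equivalent_norm_norm w(1)] by (rule less_le_trans)
    have "lower_estimate w norm (fam_comp (schreier a \<beta>) (schreier a \<alpha>))
        (delta a \<beta> w norm * delta a \<alpha> w norm)"
      by (intro lower_estimate_fam_comp delta_lower_estimate[OF a bw] delta_nonneg[OF a bw] equivalent_norm_norm)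
    from embeds_lower_estimate[OF bw embeds_schreier_plus[OF a] this]
    obtain \<rho> v where v: "blocks_via \<rho> w v"
      "lower_estimate v norm (schreier a (\<alpha> + \<beta>)) (delta a \<beta> w norm * delta a \<alpha> w norm)"
      by blast
    have "s * t \<le> delta a \<beta> w norm * delta a \<alpha> w norm"
      using mult_mono[of s "delta a \<alpha> w norm" t "delta a \<beta> w norm"] s w(2) st by (simp add: mult.commute)
    also have "\<dots> \<le> \<gamma> (\<alpha> + \<beta>)"
      using s w(2) st by (intro lower_estimate_le_stable[OF blocks_via_trans[OF yw v(1)] v(2)]) simp
    finally show ?thesis .
  qed
  show ?thesis
  proof (cases "\<gamma> \<alpha> = 0 \<or> \<gamma> \<beta> = 0")
    case False
    then have pos: "0 < \<gamma> \<alpha>" "0 < \<gamma> \<beta>" using stable_nonneg[of \<alpha>] stable_nonneg[of \<beta>] by auto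
    have 1: "\<gamma> \<alpha> * t \<le> \<gamma> (\<alpha> + \<beta>)" if t: "0 < t" "t < \<gamma> \<beta>" for t
    proof -
      have "\<gamma> \<alpha> \<le> \<gamma> (\<alpha> + \<beta>) / t"
        by (rule dense_le_bounded[OF pos(1)]) (use * t in \<open>auto simp: pos_le_divide_eq\<close>)
      then show ?thesis using t by (simp add: pos_le_divide_eq)
    qed
    have "\<gamma> \<beta> \<le> \<gamma> (\<alpha> + \<beta>) / \<gamma> \<alpha>"
      by (rule dense_le_bounded[OF pos(2)]) (use 1 pos in \<open>auto simp: pos_le_divide_eq mult.commute\<close>)
    then show ?thesis using pos by (simp add: pos_le_divide_eq mult.commute)
  qed (use stable_nonneg in auto)
qed

lemma stable_power:
  assumes "1 \<le> k"
  shows "\<gamma> (omul \<alpha> n) ^ k \<le> \<gamma> (omul \<alpha> (n * k))"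
  using assms
proof (induction k rule: nat_induct_at_least)
  case (Suc k)
  have "\<gamma> (omul \<alpha> n) ^ Suc k \<le> \<gamma> (omul \<alpha> (n * k)) * \<gamma> (omul \<alpha> n)"
    using mult_right_mono[OF Suc.IH stable_nonneg] by (simp add: mult.commute)
  also have "\<dots> \<le> \<gamma> (omul \<alpha> (n * k) + omul \<alpha> n)" by (rule stable_mult)
  also have "omul \<alpha> (n * k) + omul \<alpha> n = omul \<alpha> (n * Suc k)"
    using omul_add[of \<alpha> "n * k" n] by (simp add: add.commute)
  finally show ?case .
qed simp

end

section \<open>Bounded distortion\<close>

lemma coordinates_zero: "basic K z \<Longrightarrow> coordinates z 0 i = 0"
  using coordinates_finite_sum[of K z "{}"] by simp

lemma inf_dim_closed_span:
  assumes z: "basic K z"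
  shows "inf_dim_subspace (closed_span z)"
proof -
  have False if B: "finite B" "closed_span z \<subseteq> span B" for B
  proof -
    have coord: "coordinates z (z i) j = (if j = i then 1 else 0)" for i j
      using coordinates_finite_sum[OF z, of "{i}" "\<lambda>_. 1" j] by simp
    then have inj: "inj z" by (metis injI zero_neq_one)
    define A where "A = z ` {..<Suc (card B)}"
    have "independent A"
    proof (rule independent_if_scalars_zero)
      fix f v assume f: "(\<Sum>v\<in>A. f v *\<^sub>R v) = 0" and v: "v \<in> A"
      then obtain i where i: "v = z i" "i < Suc (card B)" by (auto simp: A_def)
      have "(\<Sum>v\<in>A. f v *\<^sub>R v) = (\<Sum>i<Suc (card B). f (z i) *\<^sub>R z i)"
        unfolding A_def by (simp add: sum.reindex[OF inj_on_subset[OF inj]])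
      then show "f v = 0"
        using coordinates_finite_sum[OF z finite_lessThan[of "Suc (card B)"], of "\<lambda>i. f (z i)" i]
          coordinates_zero[OF z, of i] f i by simp
    qed (simp add: A_def)
    moreover have "A \<subseteq> span (range z)"
      unfolding A_def by (auto intro: span_base)
    then have "A \<subseteq> span B"
      using B(2) span_subset_closed_span[of z] by blast
    ultimately have "card A \<le> card B"
      using independent_span_bound[OF B(1)] by blast
    then show False
      by (simp add: A_def card_image[OF inj_on_subset[OF inj]])
  qed
  then show ?thesis
    unfolding inf_dim_subspace_def using subspace_closed_span closed_closed_span by blast
qed

text \<open>Each further coordinate condition lowers the dimension by at most one: if the smaller
  subspace were spanned by a finite set, adding one vector \<open>u0\<close> with nonzero N-th
  coordinate would span the larger one.\<close>

lemma inf_dim_coordinates_zero: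
  assumes z: "basic K z" and W: "inf_dim_subspace W" "W \<subseteq> closed_span z"
  shows "\<exists>u\<in>W. u \<noteq> 0 \<and> (\<forall>i<N. coordinates z u i = 0)"
proof -
  have sub: "subspace W" using W(1) by (simp add: inf_dim_subspace_def)
  have "\<not> (\<exists>B. finite B \<and> {u\<in>W. \<forall>i<N. coordinates z u i = 0} \<subseteq> span B)"
  proof (induction N)
    case 0
    then show ?case using W(1) by (simp add: inf_dim_subspace_def)
  next
    case (Suc N)
    show ?case
    proof (cases "\<exists>u0\<in>W. (\<forall>i<N. coordinates z u0 i = 0) \<and> coordinates z u0 N \<noteq> 0")
      case True
      then obtain u0 where u0: "u0 \<in> W" "\<forall>i<N. coordinates z u0 i = 0" "coordinates z u0 N \<noteq> 0"
        by blast
      have "\<exists>B. finite B \<and> {u\<in>W. \<forall>i<N. coordinates z u i = 0} \<subseteq> span B"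
        if B: "finite B" "{u\<in>W. \<forall>i<Suc N. coordinates z u i = 0} \<subseteq> span B" for B
      proof (intro exI conjI subsetI)
        show "finite (insert u0 B)" using B by simp
        fix u assume "u \<in> {u\<in>W. \<forall>i<N. coordinates z u i = 0}"
        then have u: "u \<in> W" "\<forall>i<N. coordinates z u i = 0" by auto
        define t where "t = - (coordinates z u N / coordinates z u0 N)"
        have W': "u + t *\<^sub>R u0 \<in> W" using sub u(1) u0(1) by (intro subspace_add subspace_scale)
        have "coordinates z (u + t *\<^sub>R u0) i = coordinates z u i + t * coordinates z u0 i" for i
          using coordinates_add[OF z] coordinates_scale[OF z] u(1) u0(1) W(2) sub
            subspace_scale by (metis subsetD)
        then have "\<forall>i<Suc N. coordinates z (u + t *\<^sub>R u0) i = 0"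
          using u(2) u0(2,3) by (auto simp: less_Suc_eq t_def)
        then have "u + t *\<^sub>R u0 \<in> span B" using B(2) W' by blast
        then have "u + t *\<^sub>R u0 \<in> span (insert u0 B)" using span_mono by blast
        moreover have "t *\<^sub>R u0 \<in> span (insert u0 B)" by (intro span_scale span_base) simp
        ultimately show "u \<in> span (insert u0 B)" using span_diff by fastforce
      qed
      then show ?thesis using Suc.IH by blast
    next
      case False
      then have "{u\<in>W. \<forall>i<Suc N. coordinates z u i = 0} = {u\<in>W. \<forall>i<N. coordinates z u i = 0}"
        by (auto simp: less_Suc_eq)
      then show ?thesis using Suc.IH by simp
    qed
  qed
  then have "\<not> {u\<in>W. \<forall>i<N. coordinates z u i = 0} \<subseteq> span {}" by blast
  then show ?thesis by (auto simp: span_empty)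
qed

lemma block_near_subspace:
  assumes z: "basic K z" and W: "inf_dim_subspace W" "W \<subseteq> closed_span z" and e: "0 < e"
  shows "\<exists>M>N. \<exists>u\<in>W. \<exists>v\<in>blk z (Suc N) (Suc M). norm u = 1 \<and> norm (v - u) < e"
proof -
  obtain u0 where u0: "u0 \<in> W" "u0 \<noteq> 0" "\<forall>i<N. coordinates z u0 i = 0"
    using inf_dim_coordinates_zero[OF z W] by blast
  define u where "u = (1 / norm u0) *\<^sub>R u0"
  have u: "u \<in> W" "norm u = 1"
    using W(1) u0 by (auto simp: u_def inf_dim_subspace_def intro: subspace_scale)
  have c: "coordinates z u i = 0" if "i < N" for i
    using u0 that W(2) coordinates_scale[OF z, of u0] by (auto simp: u_def)
  have "(\<lambda>n. \<Sum>i<n. coordinates z u i *\<^sub>R z i) \<longlonglongrightarrow> u"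
    using coordinates_sums[OF z] u(1) W(2) by (auto simp: sums_def)
  from LIMSEQ_D[OF this e] obtain M0
    where M0: "\<And>n. n \<ge> M0 \<Longrightarrow> norm ((\<Sum>i<n. coordinates z u i *\<^sub>R z i) - u) < e"
    by blast
  define M where "M = max M0 (Suc N)"
  have "(\<Sum>i<M. coordinates z u i *\<^sub>R z i) = (\<Sum>i=N..<M. coordinates z u i *\<^sub>R z i)"
    using c by (intro sum.mono_neutral_right) auto
  then have "(\<Sum>i<M. coordinates z u i *\<^sub>R z i) \<in> blk z (Suc N) (Suc M)"
    by (auto simp: in_blk_iff)
  moreover have "norm ((\<Sum>i<M. coordinates z u i *\<^sub>R z i) - u) < e" by (rule M0) (simp add: M_def)
  ultimately show ?thesis using u by (intro exI[of _ M]) (auto simp: M_def)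
qed

text \<open>A gliding hump. Unit vectors of \<open>W\<close> with vanishing initial coordinates are
  nearly blocks of \<open>z\<close>, and these blocks can be chosen successively with summable
  errors. Finite combinations suffice, since lower estimates concern finite sums only.\<close>

lemma block_basis_near_subspace:
  assumes z: "basic K z" and W: "inf_dim_subspace W" "W \<subseteq> closed_span z" and d: "0 < d"
  shows "\<exists>\<sigma> w. blocks_via \<sigma> z w \<and> (\<forall>v\<in>span (range w). \<exists>u\<in>W. norm (v - u) \<le> d * norm v)"
proof -
  have K: "1 \<le> K" by (rule basic_ge_1[OF z])
  \<comment> \<open>Errors of at most 1/2 leave every block with norm at least 1/2, so the
    coefficients of v are at most \<open>4 * K * norm v\<close>. With errors
    \<open>d / (8 * K)\<close> times powers of 1/2, whose sum is below 2, the total error is at most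
    \<open>d * norm v\<close>.\<close>
  define e where "e k = min (1/2) (d / (8 * K)) * (1/2) ^ k" for k :: nat
  have e: "0 < e k" "e k \<le> 1/2" "e k \<le> d / (8 * K) * (1/2) ^ k" for k
  proof -
    have m: "0 < min (1/2) (d / (8 * K))" using d K by simp
    then show "0 < e k" by (simp add: e_def)
    have "e k \<le> min (1/2) (d / (8 * K)) * 1"
      unfolding e_def using m by (intro mult_left_mono power_le_one) auto
    then show "e k \<le> 1/2" by simp
    show "e k \<le> d / (8 * K) * (1/2) ^ k" unfolding e_def by (intro mult_right_mono) auto
  qed
  have "\<forall>k N. \<exists>M u v. M > N \<and> u \<in> W \<and> v \<in> blk z (Suc N) (Suc M) \<and> norm u = 1 \<and> norm (v - u) < e k"
    using block_near_subspace[OF z W e(1)] by blast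
  then obtain M U V where MUV: "\<And>k N. M k N > N" "\<And>k N. U k N \<in> W"
    "\<And>k N. V k N \<in> blk z (Suc N) (Suc (M k N))" "\<And>k N. norm (U k N) = (1::real)"
    "\<And>k N. norm (V k N - U k N) < e k"
    by metis
  define N where "N = rec_nat 0 M"
  have N: "N (Suc k) = M k (N k)" for k by (simp add: N_def)
  define \<sigma> where "\<sigma> = case_nat 0 (\<lambda>k. Suc (N k))"
  define w u where "w k = V k (N k)" and "u k = U k (N k)" for k
  have nw: "norm (w k) \<ge> 1/2" for k
  proof -
    have "norm (u k) \<le> norm (w k) + norm (w k - u k)"
      using norm_triangle_sub[of "u k" "w k"] by (simp add: norm_minus_commute)
    then show ?thesis using MUV(4,5)[of k "N k"] e(2)[of k] by (simp add: w_def u_def)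
  qed
  have w: "blocks_via \<sigma> z w"
    unfolding blocks_via_def
  proof (intro conjI allI)
    have "\<sigma> k < \<sigma> (Suc k)" for k
      using MUV(1) by (cases k) (simp_all add: \<sigma>_def N)
    then show "strict_mono \<sigma>" by (rule strict_monoI_Suc)
    show "w k \<noteq> 0" for k using nw[of k] by auto
    show "w k \<in> blk z (\<sigma> (Suc k)) (\<sigma> (Suc (Suc k)))" for k
      using MUV(3) by (simp add: \<sigma>_def N w_def)
  qed
  have "\<exists>u\<in>W. norm (v - u) \<le> d * norm v" if v: "v \<in> span (range w)" for v
  proof -
    obtain c n where c: "v = (\<Sum>i<n. c i *\<^sub>R w i)" using in_span_range[OF v] .
    have cb: "\<bar>c i\<bar> \<le> 4 * K * norm v" if "i < n" for i
    proof -
      have "\<bar>c i\<bar> * (1/2) \<le> \<bar>c i\<bar> * norm (w i)" using nw by (intro mult_left_mono) auto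
      also have "\<dots> \<le> 2 * K * norm v"
        unfolding c by (rule basic_coeff[OF basic_blocks[OF z w] that])
      finally show ?thesis by simp
    qed
    have "norm (v - (\<Sum>i<n. c i *\<^sub>R u i)) = norm (\<Sum>i<n. c i *\<^sub>R (w i - u i))"
      by (simp add: c scaleR_diff_right sum_subtractf)
    also have "\<dots> \<le> (\<Sum>i<n. 4 * K * norm v * (d / (8 * K) * (1/2) ^ i))"
    proof (rule order_trans[OF norm_sum sum_mono])
      fix i assume i: "i \<in> {..<n}"
      have "norm (w i - u i) \<le> d / (8 * K) * (1/2) ^ i"
        using less_imp_le[OF MUV(5)[of i "N i"]] e(3)[of i] by (simp add: w_def u_def)
      then show "norm (c i *\<^sub>R (w i - u i)) \<le> 4 * K * norm v * (d / (8 * K) * (1/2) ^ i)"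
        using cb[of i] i K by (simp only: norm_scaleR) (intro mult_mono, auto)
    qed
    also have "\<dots> = d / 2 * norm v * (\<Sum>i<n. (1/2) ^ i)"
      using K by (simp add: sum_distrib_left field_simps)
    also have "(\<Sum>i<n. (1/2) ^ i) = 2 - 2 * (1/2::real) ^ n"
      by (induction n) auto
    also have "d / 2 * norm v * (2 - 2 * (1/2) ^ n) \<le> d / 2 * norm v * 2"
      using d by (intro mult_left_mono) auto
    finally have "norm (v - (\<Sum>i<n. c i *\<^sub>R u i)) \<le> d * norm v" by simp
    moreover have "(\<Sum>i<n. c i *\<^sub>R u i) \<in> W"
      using W(1) MUV(2) by (intro subspace_sum subspace_scale) (auto simp: inf_dim_subspace_def u_def)
    ultimately show ?thesis by blast
  qed
  then show ?thesis using w by blast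
qed

lemma bounded_distortion_subspace:
  assumes D: "bounded_distortion D Y" and p: "equivalent_norm Y p" and z: "basic K z"
    and zY: "closed_span z \<subseteq> Y" and e: "0 < e"
  shows "\<exists>W. inf_dim_subspace W \<and> W \<subseteq> closed_span z \<and>
    (\<forall>u\<in>W. \<forall>v\<in>W. norm u = 1 \<longrightarrow> norm v = 1 \<longrightarrow> p u \<le> (D + e) * p v)"
proof -
  let ?S = "\<lambda>Z. {p u / p v | u v. u \<in> Z \<and> v \<in> Z \<and> norm u = 1 \<and> norm v = 1}"
  let ?A = "(\<lambda>Z. Sup (?S Z)) ` {Z. inf_dim_subspace Z \<and> Z \<subseteq> closed_span z}"
  have "Inf ?A \<le> D"
    using D p inf_dim_closed_span[OF z] zY unfolding bounded_distortion_def distortion_def by blast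
  then have "Inf ?A < D + e" using e by simp
  moreover have "?A \<noteq> {}" using inf_dim_closed_span[OF z] by blast
  ultimately obtain W where W: "inf_dim_subspace W" "W \<subseteq> closed_span z" "Sup (?S W) < D + e"
    using cInf_lessD by (smt (verit) imageE mem_Collect_eq)
  obtain c C where c: "c > 0" "C > 0" "\<And>u. u \<in> Y \<Longrightarrow> c * norm u \<le> p u" "\<And>u. u \<in> Y \<Longrightarrow> p u \<le> C * norm u"
    using p unfolding equivalent_norm_def by metis
  have WY: "W \<subseteq> Y" using W(2) zY by blast
  \<comment> \<open>The supremum dominates the individual ratios only for a bounded set; equivalence
    of the norms bounds them by \<open>C / c\<close>.\<close>
  have "bdd_above (?S W)"
  proof (rule bdd_aboveI)
    fix q assume "q \<in> ?S W"
    then obtain u v where *: "q = p u / p v" "u \<in> W" "v \<in> W" "norm u = 1" "norm v = 1" by blast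
    have "p u / p v \<le> C / c"
      using c(1,2) c(3)[of v] c(4)[of u] * WY by (intro frac_le) auto
    then show "q \<le> C / c" by (simp add: *)
  qed
  then have "p u \<le> (D + e) * p v" if "u \<in> W" "v \<in> W" "norm u = 1" "norm v = 1" for u v
  proof -
    have "p u / p v \<le> Sup (?S W)" using that by (intro cSup_upper \<open>bdd_above (?S W)\<close>) blast
    then have "p u / p v \<le> D + e" using W(3) by simp
    moreover have "p v > 0" using c(1) c(3)[of v] that WY by auto
    ultimately show ?thesis by (simp add: pos_divide_le_eq)
  qed
  then show ?thesis using W by blast
qed

text \<open>On a nearly optimal subspace, p lies between b and (D + e) b times the norm, where b is
  the infimum of p over the unit sphere. A block basis close to the subspace inherits both bounds up
  to small errors. Comparing a unit vector with itself gives \<open>1 \<le> D\<close>.\<close>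

lemma bounded_distortion_blocks:
  assumes D: "bounded_distortion D Y" and p: "equivalent_norm Y p" and z: "basic K z"
    and zY: "closed_span z \<subseteq> Y"
  shows "1 \<le> D" "\<exists>M\<ge>0. \<forall>e>0. \<exists>\<sigma> w b. blocks_via \<sigma> z w \<and> 0 < b \<and>
    (\<forall>v\<in>span (range w). b * (1 - e - M * e) * norm v \<le> p v \<and>
       p v \<le> b * ((D + e) * (1 + e) + M * e) * norm v)"
proof -
  obtain c C where c: "c > 0" "C > 0" "\<And>u. u \<in> Y \<Longrightarrow> c * norm u \<le> p u" "\<And>u. u \<in> Y \<Longrightarrow> p u \<le> C * norm u"
    using p unfolding equivalent_norm_def by metis
  have unit: "\<exists>u\<in>W. norm u = 1" if W: "inf_dim_subspace W" for W :: "'a set"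
  proof -
    have sub: "subspace W" "\<not> W \<subseteq> span {}"
      using W unfolding inf_dim_subspace_def by blast+
    then obtain u where u: "u \<in> W" "u \<noteq> 0" by (auto simp: span_empty)
    then show ?thesis
      using sub by (intro bexI[of _ "(1 / norm u) *\<^sub>R u"] subspace_scale) auto
  qed
  show D1: "1 \<le> D"
  proof (rule field_le_epsilon)
    fix e :: real assume "0 < e"
    then obtain W where W: "inf_dim_subspace W" "W \<subseteq> closed_span z"
      "\<And>u v. u \<in> W \<Longrightarrow> v \<in> W \<Longrightarrow> norm u = 1 \<Longrightarrow> norm v = 1 \<Longrightarrow> p u \<le> (D + e) * p v"
      using bounded_distortion_subspace[OF D p z zY] by metis
    obtain u where u: "u \<in> W" "norm u = 1" using unit[OF W(1)] by blast
    have "0 < p u" using c(1) c(3)[of u] u W(2) zY by auto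
    then show "1 \<le> D + e" using W(3)[OF u(1) u(1) u(2) u(2)] by simp
  qed
  show "\<exists>M\<ge>0. \<forall>e>0. \<exists>\<sigma> w b. blocks_via \<sigma> z w \<and> 0 < b \<and>
    (\<forall>v\<in>span (range w). b * (1 - e - M * e) * norm v \<le> p v \<and>
       p v \<le> b * ((D + e) * (1 + e) + M * e) * norm v)"
  \<comment> \<open>On an error vector, p is at most C times the norm, and C is at most
    \<open>C / c\<close> times b because b is at least c. This bound is independent of e, as letting
    e tend to 0 later requires.\<close>
  proof (intro exI[of _ "C / c"] conjI allI impI)
    show "0 \<le> C / c" using c by simp
    fix e :: real assume e: "0 < e"
    obtain W where W: "inf_dim_subspace W" "W \<subseteq> closed_span z"
      "\<And>u v. u \<in> W \<Longrightarrow> v \<in> W \<Longrightarrow> norm u = 1 \<Longrightarrow> norm v = 1 \<Longrightarrow> p u \<le> (D + e) * p v"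
      using bounded_distortion_subspace[OF D p z zY e] by metis
    have WY: "W \<subseteq> Y" using W(2) zY by blast
    have sub: "subspace W" using W(1) by (simp add: inf_dim_subspace_def)
    let ?B = "p ` {u\<in>W. norm u = 1}"
    define b where "b = Inf ?B"
    have ne: "?B \<noteq> {}" using unit[OF W(1)] by blast
    have bdd: "bdd_below ?B" using c(3) WY by (intro bdd_belowI[of _ c]) force
    have bc: "c \<le> b" unfolding b_def using ne c(3) WY by (intro cInf_greatest) force+
    have b1: "b \<le> p u" if "u \<in> W" "norm u = 1" for u
      unfolding b_def using that by (intro cInf_lower bdd) auto
    have b2: "p u \<le> (D + e) * b" if u: "u \<in> W" "norm u = 1" for u
    proof -
      have "p u / (D + e) \<le> b"
        unfolding b_def using W(3) u D1 e by (intro cInf_greatest ne) (auto simp: pos_divide_le_eq mult.commute)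
      then show ?thesis using D1 e by (simp add: pos_divide_le_eq mult.commute)
    qed
    have bW: "b * norm u \<le> p u \<and> p u \<le> (D + e) * b * norm u" if u: "u \<in> W" for u
    proof (cases "u = 0")
      case True
      then show ?thesis using equivalent_normD(5)[OF p] u WY by auto
    next
      case False
      have "(1 / norm u) *\<^sub>R u \<in> W" "norm ((1 / norm u) *\<^sub>R u) = 1"
        using False sub u by (auto intro: subspace_scale)
      from b1[OF this] b2[OF this]
      have "b \<le> p u / norm u" "p u / norm u \<le> (D + e) * b"
        using u WY equivalent_normD(2)[OF p, of u "1 / norm u"] by auto
      then show ?thesis
        using False by (simp add: pos_le_divide_eq pos_divide_le_eq)
    qed
    obtain \<sigma> w where w: "blocks_via \<sigma> z w" "\<And>v. v \<in> span (range w) \<Longrightarrow> \<exists>u\<in>W. norm (v - u) \<le> e * norm v"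
      using block_basis_near_subspace[OF z W(1,2) e] by blast
    have wY: "span (range w) \<subseteq> Y"
      using closed_span_blocks[OF w(1)] span_subset_closed_span[of w] zY by blast
    have sz: "closed_span z \<subseteq> Y" "subspace (closed_span z)" using zY subspace_closed_span by auto
    have "b * (1 - e - C / c * e) * norm v \<le> p v \<and>
        p v \<le> b * ((D + e) * (1 + e) + C / c * e) * norm v" if v: "v \<in> span (range w)" for v
    proof -
      obtain u where u: "u \<in> W" "norm (v - u) \<le> e * norm v" using w(2)[OF v] by blast
      have vz: "v \<in> closed_span z" "u \<in> closed_span z" "v - u \<in> closed_span z" "u - v \<in> closed_span z"
      proof -
        show "v \<in> closed_span z" "u \<in> closed_span z"
          using closed_span_blocks[OF w(1)] span_subset_closed_span[of w] v u(1) W(2) by auto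
        then show "v - u \<in> closed_span z" "u - v \<in> closed_span z"
          using subspace_diff[OF sz(2)] by auto
      qed
      have "C * norm (v - u) \<le> C * (e * norm v)" using c(2) u(2) by simp
      also have "\<dots> = C / c * e * norm v * c" using c(1) by simp
      also have "\<dots> \<le> C / c * e * norm v * b" using bc c e by (intro mult_left_mono) auto
      finally have pert: "C * norm (v - u) \<le> b * (C / c * e) * norm v" by (simp add: mult_ac)
      have pvu: "p (v - u) \<le> C * norm (v - u)" "p (u - v) \<le> C * norm (v - u)"
        using c(4)[of "v - u"] c(4)[of "u - v"] vz sz by (auto simp: norm_minus_commute)
      have t1: "p v \<le> p u + p (v - u)"
        using equivalent_normD(1)[OF p, of u "v - u"] vz sz by auto
      have t2: "p u \<le> p v + p (u - v)"
        using equivalent_normD(1)[OF p, of v "u - v"] vz sz by auto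
      have n1: "norm u \<le> (1 + e) * norm v" "(1 - e) * norm v \<le> norm u"
        using norm_triangle_ineq2[of u v] norm_triangle_ineq2[of v u] u(2)
        by (auto simp: norm_minus_commute algebra_simps)
      have bpos: "0 < b" using bc c(1) by simp
      have "p u \<le> (D + e) * b * ((1 + e) * norm v)"
        using bW[OF u(1)] n1(1) D1 e bpos
        by (meson add_pos_pos less_imp_le less_le_trans mult_left_mono mult_nonneg_nonneg order_trans zero_less_one)
      then have up: "p v \<le> (D + e) * b * ((1 + e) * norm v) + b * (C / c * e) * norm v"
        using t1 pvu(1) pert by linarith
      have "b * ((1 - e) * norm v) \<le> p u"
        using bW[OF u(1)] n1(2) bpos by (meson less_imp_le mult_left_mono order_trans)
      then have lo: "b * ((1 - e) * norm v) - b * (C / c * e) * norm v \<le> p v"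
        using t2 pvu(2) pert by linarith
      show ?thesis using up lo by (simp add: algebra_simps)
    qed
    then show "\<exists>\<sigma> w b. blocks_via \<sigma> z w \<and> 0 < b \<and>
      (\<forall>v\<in>span (range w). b * (1 - e - C / c * e) * norm v \<le> p v \<and>
         p v \<le> b * ((D + e) * (1 + e) + C / c * e) * norm v)"
      using w(1) bc c(1) by (intro exI[of _ \<sigma>] exI[of _ w] exI[of _ b]) auto
  qed
qed

text \<open>The last summand \<alpha> of the multiple acts as the outer family, and each induction
  step passes to one more subsequence.\<close>

lemma lower_estimate_omul:
  assumes a: "fundamental_sequences a" and x: "basic K x"
    and le: "lower_estimate x p (schreier a \<alpha>) d" "0 \<le> d" and "1 \<le> n"
  shows "\<exists>\<sigma> z. blocks_via \<sigma> x z \<and> lower_estimate z p (schreier a (omul \<alpha> n)) (d ^ n)"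
  using \<open>1 \<le> n\<close>
proof (induction n rule: nat_induct_at_least)
  case base
  have "blocks_via (\<lambda>i. i) x x"
    by (rule blocks_via_self[OF basic_nonzero[OF x]])
  then show ?case using le by auto
next
  case (Suc n)
  then obtain \<sigma> z where z: "blocks_via \<sigma> x z" "lower_estimate z p (schreier a (omul \<alpha> n)) (d ^ n)"
    by blast
  have "lower_estimate z p (schreier a \<alpha>) d"
    by (rule lower_estimate_blocks[OF z(1) _ le(1)])
      (use z(1) schreier_image[OF a] in \<open>auto simp: blocks_via_def\<close>)
  from lower_estimate_fam_comp[OF z(2) this le(2)]
  have "lower_estimate z p (fam_comp (schreier a \<alpha>) (schreier a (omul \<alpha> n))) (d ^ Suc n)" by simp
  from embeds_lower_estimate[OF basic_blocks[OF x z(1)] embeds_schreier_plus[OF a] this]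
  show ?case using blocks_via_trans[OF z(1)] by auto
qed

lemma delta_power_le:
  assumes a: "fundamental_sequences a" and y: "basic K y" and st: "Delta_stabilizes a y \<gamma>"
    and D: "bounded_distortion D (closed_span y)" and p: "equivalent_norm (closed_span y) p"
    and x: "blocks_via \<sigma> y x" and n: "1 \<le> n"
  shows "delta a \<alpha> x p ^ n \<le> D * \<gamma> (omul \<alpha> n)"
proof -
  note bx = basic_blocks[OF y x]
  note px = equivalent_norm_mono[OF p closed_span_blocks[OF x]]
  define d where "d = delta a \<alpha> x p"
  have d: "0 \<le> d" unfolding d_def by (rule delta_nonneg[OF a bx px])
  obtain \<tau> z where z: "blocks_via \<tau> x z" "lower_estimate z p (schreier a (omul \<alpha> n)) (d ^ n)"
    using lower_estimate_omul[OF a bx delta_lower_estimate[OF a bx px] _ n] d d_def by blast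
  note bz = basic_blocks[OF bx z(1)]
  have yz: "blocks_via (\<lambda>i. \<sigma> (\<tau> i)) y z" by (rule blocks_via_trans[OF x z(1)])
  note zY = closed_span_blocks[OF yz]
  have D1: "1 \<le> D" by (rule bounded_distortion_blocks(1)[OF D p bz zY])
  obtain M where M: "M \<ge> 0" "\<And>e. 0 < e \<Longrightarrow> \<exists>\<rho> w b. blocks_via \<rho> z w \<and> 0 < b \<and>
    (\<forall>v\<in>span (range w). b * (1 - e - M * e) * norm v \<le> p v \<and>
       p v \<le> b * ((D + e) * (1 + e) + M * e) * norm v)"
    using bounded_distortion_blocks(2)[OF D p bz zY] by blast
  have main: "d ^ n * (1 - e - M * e) \<le> ((D + e) * (1 + e) + M * e) * \<gamma> (omul \<alpha> n)" if e: "0 < e" for e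
  proof -
    obtain \<rho> w b where w: "blocks_via \<rho> z w" "0 < b"
      "\<And>v. v \<in> span (range w) \<Longrightarrow> b * (1 - e - M * e) * norm v \<le> p v"
      "\<And>v. v \<in> span (range w) \<Longrightarrow> p v \<le> b * ((D + e) * (1 + e) + M * e) * norm v"
      using M(2)[OF e] by metis
    define U L where "U = (D + e) * (1 + e) + M * e" and "L = 1 - e - M * e"
    have U: "0 < U" unfolding U_def using D1 e M(1) by (intro add_pos_nonneg mult_pos_pos) auto
    have g: "0 \<le> \<gamma> (omul \<alpha> n)" by (rule stable_nonneg[OF a y st])
    show ?thesis
    proof (cases "L \<le> 0")
      case True
      then have "d ^ n * L \<le> 0" using d by (simp add: mult_nonneg_nonpos)
      also have "0 \<le> U * \<gamma> (omul \<alpha> n)" using U g by simp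
      finally show ?thesis by (simp add: U_def L_def)
    next
      case False
      have lw: "lower_estimate w p (schreier a (omul \<alpha> n)) (d ^ n)"
        by (rule lower_estimate_blocks[OF w(1) _ z(2)])
          (use w(1) schreier_image[OF a] in \<open>auto simp: blocks_via_def\<close>)
      \<comment> \<open>On the span of \<open>w\<close>, p lies between \<open>b * L\<close> and
        \<open>b * U\<close> times the norm. The unknown scale b occurs on both sides and
        cancels.\<close>
      have "lower_estimate w norm (schreier a (omul \<alpha> n)) (d ^ n * L / U)"
      proof (rule lower_estimateI)
        fix F r u
        assume *: "F \<in> schreier a (omul \<alpha> n)" "\<And>f f'. f \<in> F \<Longrightarrow> f' \<in> F \<Longrightarrow> f < f' \<Longrightarrow> r f \<le> (f'::nat)"
          "\<And>f. f \<in> F \<Longrightarrow> u f \<in> blk w f (r f)"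
        have us: "u f \<in> span (range w)" if "f \<in> F" for f using *(3)[OF that] blk_subset_span by blast
        have "b * L * (\<Sum>f\<in>F. norm (u f)) \<le> (\<Sum>f\<in>F. p (u f))"
          unfolding sum_distrib_left using w(3)[OF us] by (intro sum_mono) (simp add: L_def)
        then have "d ^ n * (b * L * (\<Sum>f\<in>F. norm (u f))) \<le> d ^ n * (\<Sum>f\<in>F. p (u f))"
          using d by (intro mult_left_mono) auto
        also have "\<dots> \<le> p (\<Sum>f\<in>F. u f)" using * by (rule lower_estimateD[OF lw])
        also have "\<dots> \<le> b * U * norm (\<Sum>f\<in>F. u f)"
          unfolding U_def using us by (intro w(4) span_sum)
        finally have "b * (d ^ n * L * (\<Sum>f\<in>F. norm (u f))) \<le> b * (U * norm (\<Sum>f\<in>F. u f))"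
          by (simp add: mult_ac)
        then have "d ^ n * L * (\<Sum>f\<in>F. norm (u f)) \<le> U * norm (\<Sum>f\<in>F. u f)"
          using w(2) by simp
        then show "d ^ n * L / U * (\<Sum>f\<in>F. norm (u f)) \<le> norm (\<Sum>f\<in>F. u f)"
          using U by (simp add: field_simps)
      qed
      moreover have "0 \<le> d ^ n * L / U" using d False U by simp
      ultimately have "d ^ n * L / U \<le> \<gamma> (omul \<alpha> n)"
        by (rule lower_estimate_le_stable[OF a y st blocks_via_trans[OF yz w(1)]])
      then show ?thesis using U by (simp add: U_def[symmetric] L_def[symmetric] pos_divide_le_eq mult.commute)
    qed
  qed
  \<comment> \<open>The e-dependent block basis and scale no longer occur in \<open>main\<close>, so
    e can tend to 0.\<close>
  have "d ^ n * (1 - 0 - M * 0) \<le> ((D + 0) * (1 + 0) + M * 0) * \<gamma> (omul \<alpha> n)"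
  proof (rule tendsto_le[OF trivial_limit_at_right_real])
    show "((\<lambda>e. ((D + e) * (1 + e) + M * e) * \<gamma> (omul \<alpha> n)) \<longlongrightarrow>
        ((D + 0) * (1 + 0) + M * 0) * \<gamma> (omul \<alpha> n)) (at_right 0)"
      by (intro tendsto_intros)
    show "((\<lambda>e. d ^ n * (1 - e - M * e)) \<longlongrightarrow> d ^ n * (1 - 0 - M * 0)) (at_right 0)"
      by (intro tendsto_intros)
    show "\<forall>\<^sub>F e in at_right 0. d ^ n * (1 - e - M * e) \<le> ((D + e) * (1 + e) + M * e) * \<gamma> (omul \<alpha> n)"
      using main by (auto simp: eventually_at_right_field intro: exI[of _ 1])
  qed
  then show ?thesis by (simp add: d_def)
qed

section \<open>The supremum over equivalent norms\<close>

text \<open>Both suprema are over nonempty sets, witnessed by the given norm and by \<open>y\<close>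
  itself, and all constants are bounded by 1. This justifies the laws for conditional
  suprema.\<close>

lemma
  assumes a: "fundamental_sequences a" and y: "basic K y"
  shows delta_le_ddot: "equivalent_norm (closed_span y) p \<Longrightarrow> blocks_via \<sigma> y x \<Longrightarrow>
      delta a \<alpha> x p \<le> delta_ddot a \<alpha> y"
    and delta_ddot_least: "(\<And>p \<sigma> x. equivalent_norm (closed_span y) p \<Longrightarrow> blocks_via \<sigma> y x \<Longrightarrow>
      delta a \<alpha> x p \<le> t) \<Longrightarrow> delta_ddot a \<alpha> y \<le> t"
    and delta_ddot_nonneg: "0 \<le> delta_ddot a \<alpha> y"
proof -
  let ?P = "{p. equivalent_norm (closed_span y) p}"
  have X: "{x. block_basis x y} = {x. \<exists>\<sigma>. blocks_via \<sigma> y x}"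
    using block_basis_iff_blocks_via[OF y] by simp
  have yy: "blocks_via (\<lambda>i. i) y y"
    by (rule blocks_via_self[OF basic_nonzero[OF y]])
  have le1: "delta a \<alpha> x p \<le> 1" if "equivalent_norm (closed_span y) p" "blocks_via \<sigma> y x" for p \<sigma> x
    using delta_le_1[OF a basic_blocks[OF y that(2)] equivalent_norm_mono[OF that(1) closed_span_blocks[OF that(2)]]] .
  have dot_upper: "delta a \<alpha> x p \<le> delta_dot a \<alpha> y p"
    if "equivalent_norm (closed_span y) p" "blocks_via \<sigma> y x" for p \<sigma> x
    unfolding delta_dot_def X using that le1 by (intro cSUP_upper bdd_aboveI[of _ 1]) auto
  have dot_least: "delta_dot a \<alpha> y p \<le> t"
    if "\<And>\<sigma> x. blocks_via \<sigma> y x \<Longrightarrow> delta a \<alpha> x p \<le> t" for p t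
    unfolding delta_dot_def X using that yy by (intro cSUP_least) auto
  have ddot_upper: "delta_dot a \<alpha> y p \<le> delta_ddot a \<alpha> y" if "equivalent_norm (closed_span y) p" for p
    unfolding delta_ddot_def using that dot_least le1 by (intro cSUP_upper bdd_aboveI[of _ 1]) auto
  show upper: "delta a \<alpha> x p \<le> delta_ddot a \<alpha> y"
    if "equivalent_norm (closed_span y) p" "blocks_via \<sigma> y x" for p \<sigma> x
    using dot_upper[OF that] ddot_upper[OF that(1)] by (rule order_trans)
  show "delta_ddot a \<alpha> y \<le> t"
    if "\<And>p \<sigma> x. equivalent_norm (closed_span y) p \<Longrightarrow> blocks_via \<sigma> y x \<Longrightarrow> delta a \<alpha> x p \<le> t"
    unfolding delta_ddot_def
    by (rule cSUP_least) (use that dot_least equivalent_norm_norm[of "closed_span y"] in blast)+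
  show "0 \<le> delta_ddot a \<alpha> y"
    using delta_nonneg[OF a y equivalent_norm_norm] upper[OF equivalent_norm_norm yy] by (rule order_trans)
qed

text \<open>The estimate for the n-th powers becomes a bound on the constants by taking n-th roots;
  in this form it passes to the supremum.\<close>

lemma delta_ddot_power_le:
  assumes a: "fundamental_sequences a" and y: "basic K y" and st: "Delta_stabilizes a y \<gamma>"
    and D: "bounded_distortion D (closed_span y)" and n: "1 \<le> n"
  shows "delta_ddot a \<alpha> y ^ n \<le> D * \<gamma> (omul \<alpha> n)" "1 \<le> D"
proof -
  show D1: "1 \<le> D"
    by (rule bounded_distortion_blocks(1)[OF D equivalent_norm_norm y order_refl])
  let ?t = "D * \<gamma> (omul \<alpha> n)"
  have t: "0 \<le> ?t" using D1 stable_nonneg[OF a y st] by simp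
  have "delta_ddot a \<alpha> y \<le> root n ?t"
  proof (rule delta_ddot_least[OF a y])
    fix p \<sigma> x assume px: "equivalent_norm (closed_span y) p" "blocks_via \<sigma> y x"
    have "delta a \<alpha> x p = root n (delta a \<alpha> x p ^ n)"
      using n delta_nonneg[OF a basic_blocks[OF y px(2)] equivalent_norm_mono[OF px(1) closed_span_blocks[OF px(2)]]]
      by (simp add: real_root_power_cancel)
    also have "\<dots> \<le> root n ?t"
      using n delta_power_le[OF a y st D px n] by simp
    finally show "delta a \<alpha> x p \<le> root n ?t" .
  qed
  then have "delta_ddot a \<alpha> y ^ n \<le> root n ?t ^ n"
    using delta_ddot_nonneg[OF a y] by (intro power_mono)
  also have "\<dots> = ?t" using n t by simp
  finally show "delta_ddot a \<alpha> y ^ n \<le> ?t" .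
qed

section \<open>Norms from iterated admissible sums\<close>

definition interval_proj :: "(nat \<Rightarrow> 'a::real_normed_vector) \<Rightarrow> nat \<Rightarrow> nat \<Rightarrow> 'a \<Rightarrow> 'a" where
  "interval_proj x f r u = (\<Sum>i=f - 1..<r - 1. coordinates x u i *\<^sub>R x i)"

definition successive :: "nat set \<Rightarrow> (nat \<Rightarrow> nat) \<Rightarrow> bool" where
  "successive F r \<longleftrightarrow> (\<forall>f\<in>F. \<forall>f'\<in>F. f < f' \<longrightarrow> r f \<le> f')"

definition interval_sum :: "(nat \<Rightarrow> 'a::real_normed_vector) \<Rightarrow> nat set \<Rightarrow> (nat \<Rightarrow> nat) \<Rightarrow> 'a \<Rightarrow> real" where
  "interval_sum x F r u = (\<Sum>f\<in>F. norm (interval_proj x f (r f) u))"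

text \<open>For \<open>A\<close> the k-fold power of a Schreier class this is the
  \<open>h\<^sub>k\<close> of the overview. Right ends are free, so intervals may be shortened or
  leave gaps without leaving the supremum.\<close>

definition interval_norm :: "(nat \<Rightarrow> 'a::real_normed_vector) \<Rightarrow> nat set set \<Rightarrow> 'a \<Rightarrow> real" where
  "interval_norm x A u = Sup {interval_sum x F r u | F r. F \<in> A \<and> successive F r}"

lemma interval_proj_in_blk: "interval_proj x f r u \<in> blk x f r"
  by (auto simp: interval_proj_def in_blk_iff)

lemma interval_proj_add: "basic K x \<Longrightarrow> u \<in> closed_span x \<Longrightarrow> v \<in> closed_span x \<Longrightarrow>
    interval_proj x f r (u + v) = interval_proj x f r u + interval_proj x f r v"
  by (simp add: interval_proj_def coordinates_add scaleR_left_distrib sum.distrib)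

lemma interval_proj_scale: "basic K x \<Longrightarrow> u \<in> closed_span x \<Longrightarrow> interval_proj x f r (t *\<^sub>R u) = t *\<^sub>R interval_proj x f r u"
  by (simp add: interval_proj_def coordinates_scale scaleR_sum_right)

lemma interval_proj_cong: "(\<And>i. f - 1 \<le> i \<Longrightarrow> i < r - 1 \<Longrightarrow> coordinates x u i = coordinates x v i) \<Longrightarrow>
    interval_proj x f r u = interval_proj x f r v"
  unfolding interval_proj_def by (intro sum.cong) auto

lemma interval_sum_add: "basic K x \<Longrightarrow> u \<in> closed_span x \<Longrightarrow> v \<in> closed_span x \<Longrightarrow>
    interval_sum x F r (u + v) \<le> interval_sum x F r u + interval_sum x F r v"
  unfolding interval_sum_def sum.distrib[symmetric]
  by (intro sum_mono) (simp add: interval_proj_add norm_triangle_ineq)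

lemma interval_sum_scale: "basic K x \<Longrightarrow> u \<in> closed_span x \<Longrightarrow> interval_sum x F r (t *\<^sub>R u) = \<bar>t\<bar> * interval_sum x F r u"
  by (simp add: interval_sum_def interval_proj_scale sum_distrib_left)

lemma norm_partial_sum_le:
  assumes x: "basic K x" and u: "u \<in> closed_span x"
  shows "norm (\<Sum>i<n. coordinates x u i *\<^sub>R x i) \<le> K * norm u"
proof (rule LIMSEQ_le_const)
  show "(\<lambda>m. K * norm (\<Sum>i<m. coordinates x u i *\<^sub>R x i)) \<longlonglongrightarrow> K * norm u"
    using coordinates_sums[OF x u] unfolding sums_def by (intro tendsto_intros)
  show "\<exists>N. \<forall>m\<ge>N. norm (\<Sum>i<n. coordinates x u i *\<^sub>R x i) \<le> K * norm (\<Sum>i<m. coordinates x u i *\<^sub>R x i)"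
    using basic_partial[OF x] by blast
qed

lemma norm_interval_proj_le:
  assumes x: "basic K x" and u: "u \<in> closed_span x"
  shows "norm (interval_proj x f r u) \<le> 2 * K * norm u"
proof (cases "f - 1 \<le> r - 1")
  case True
  have "interval_proj x f r u = (\<Sum>i<r - 1. coordinates x u i *\<^sub>R x i) - (\<Sum>i<f - 1. coordinates x u i *\<^sub>R x i)"
    using sum_diff_nat_ivl[of 0 "f - 1" "r - 1" "\<lambda>i. coordinates x u i *\<^sub>R x i"] True
    by (simp add: atLeast0LessThan interval_proj_def)
  also have "norm \<dots> \<le> K * norm u + K * norm u"
    by (rule order_trans[OF norm_triangle_ineq4 add_mono[OF norm_partial_sum_le[OF x u] norm_partial_sum_le[OF x u]]])
  finally show ?thesis by simp
qed (use basic_ge_1[OF x] in \<open>simp add: interval_proj_def\<close>)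

lemma norm_interval_proj_mono:
  assumes x: "basic K x" and "r \<le> r'"
  shows "norm (interval_proj x f r u) \<le> K * norm (interval_proj x f r' u)"
proof -
  define c where "c i = (if f - 1 \<le> i then coordinates x u i else 0)" for i
  have "interval_proj x f s u = (\<Sum>i<s - 1. c i *\<^sub>R x i)" for s
    unfolding interval_proj_def c_def by (intro sum.mono_neutral_cong_left) auto
  then show ?thesis using basic_partial[OF x, of "r - 1" "r' - 1" c] assms(2) by simp
qed

text \<open>
  The gaps between the intervals \<open>{f..<r f}\<close> have to be closed, since the projection to a union of
  intervals need not be bounded; in the proof, \<open>s f\<close> is the successor of \<open>f\<close> in \<open>F\<close>, or \<open>m\<close>.
\<close>

lemma interval_sum_le:
  assumes x: "basic K x" and F: "F \<in> A" "finite F" "0 \<notin> F" and r: "successive F r"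
    and le: "lower_estimate x norm A \<theta>" "0 < \<theta>" and u: "u \<in> closed_span x"
  shows "interval_sum x F r u \<le> 2 * K\<^sup>2 / \<theta> * norm u"
proof (cases "F = {}")
  case True
  then show ?thesis using le by (simp add: interval_sum_def)
next
  case False
  have K: "1 \<le> K" by (rule basic_ge_1[OF x])
  define m where "m = Suc (Max (F \<union> r ` F))"
  have m: "f < m" "r f \<le> m" if "f \<in> F" for f
  proof -
    have "f \<le> Max (F \<union> r ` F)" "r f \<le> Max (F \<union> r ` F)"
      using that F(2) by (auto intro!: Max_ge simp del: Max_Un)
    then show "f < m" "r f \<le> m" unfolding m_def by linarith+
  qed
  define s where "s f = Min (insert m {f'\<in>F. f < f'})" for f
  have fin: "finite (insert m {f'\<in>F. f < f'})" for f using F(2) by simp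
  have s_le: "s f \<le> m" "f' \<in> F \<Longrightarrow> f < f' \<Longrightarrow> s f \<le> f'" for f f'
    unfolding s_def using fin by (auto intro: Min_le)
  have s_ge: "r f \<le> s f" if "f \<in> F" for f
    unfolding s_def using fin m(2) that r by (subst Min_ge_iff) (auto simp: successive_def)
  \<comment> \<open>Read as pieces, the enlarged intervals are known to be disjoint and to cover the
    whole range.\<close>
  have s_piece: "{f..<s f} = piece F {Min F..<m} f" if "f \<in> F" for f
    unfolding s_def piece_def using fin[of f] that F(2) by (auto simp: Min_gr_iff intro: order_trans[OF Min_le])
  have "(\<Union>f\<in>F. {f..<s f}) = {Min F..<m}"
  proof
    show "(\<Union>f\<in>F. {f..<s f}) \<subseteq> {Min F..<m}"
      using s_piece by (auto simp: piece_def)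
    show "{Min F..<m} \<subseteq> (\<Union>f\<in>F. {f..<s f})"
    proof
      fix j assume j: "j \<in> {Min F..<m}"
      then have "\<exists>h\<in>F. h \<le> j" using Min_in[OF F(2) False] by auto
      with ex_piece[OF F(2) j] show "j \<in> (\<Union>f\<in>F. {f..<s f})" using s_piece by blast
    qed
  qed
  note cover = this
  have split: "(\<Sum>f\<in>F. \<Sum>j=f..<s f. g j) = (\<Sum>j=Min F..<m. g j)" for g :: "nat \<Rightarrow> 'a"
  proof (subst cover[symmetric], rule sum.UNION_disjoint[OF F(2), symmetric])
    show "\<forall>f\<in>F. \<forall>f'\<in>F. f \<noteq> f' \<longrightarrow> {f..<s f} \<inter> {f'..<s f'} = {}"
      using s_piece piece_unique by blast
  qed simp
  have interval_proj_eq: "interval_proj x f k u = (\<Sum>j=f..<k. coordinates x u (j - 1) *\<^sub>R x (j - 1))" if "1 \<le> f" for f k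
    unfolding interval_proj_def
    by (rule sum.reindex_bij_witness[of _ "\<lambda>j. j - 1" Suc]) (use that in auto)
  have F1: "1 \<le> f" if "f \<in> F" for f using that F(3) by (cases f) auto
  have "Min F \<in> F" using F(2) False by simp
  have "(\<Sum>f\<in>F. interval_proj x f (s f) u) = (\<Sum>f\<in>F. \<Sum>j=f..<s f. coordinates x u (j - 1) *\<^sub>R x (j - 1))"
    by (intro sum.cong refl interval_proj_eq F1)
  also have "\<dots> = interval_proj x (Min F) m u"
    unfolding split interval_proj_eq[OF F1[OF \<open>Min F \<in> F\<close>]] ..
  finally have sum_eq: "(\<Sum>f\<in>F. interval_proj x f (s f) u) = interval_proj x (Min F) m u" .
  \<comment> \<open>One factor \<open>K\<close> is paid here for enlarging the intervals; a factor
    \<open>2 * K\<close> follows from projecting u to the single interval they form.\<close>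
  have "interval_sum x F r u \<le> (\<Sum>f\<in>F. K * norm (interval_proj x f (s f) u))"
    unfolding interval_sum_def using s_ge by (intro sum_mono norm_interval_proj_mono[OF x])
  also have "\<dots> = K * (\<Sum>f\<in>F. norm (interval_proj x f (s f) u))"
    by (simp only: sum_distrib_left)
  finally have "\<theta> * interval_sum x F r u \<le> \<theta> * (K * (\<Sum>f\<in>F. norm (interval_proj x f (s f) u)))"
    using le(2) by simp
  also have "\<dots> = K * (\<theta> * (\<Sum>f\<in>F. norm (interval_proj x f (s f) u)))" by simp
  also have "\<dots> \<le> K * norm (\<Sum>f\<in>F. interval_proj x f (s f) u)"
    using K s_le(2) interval_proj_in_blk
    by (intro mult_left_mono lower_estimateD[OF le(1) F(1), where r=s]) auto
  also have "\<dots> \<le> K * (2 * K * norm u)"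
    unfolding sum_eq using K by (intro mult_left_mono norm_interval_proj_le[OF x u]) auto
  finally show ?thesis using le(2) by (simp add: field_simps power2_eq_square)
qed

section \<open>Restricting admissible intervals to blocks and joining them\<close>

lemma coordinates_blk:
  assumes x: "basic K x" and v: "v \<in> blk x g R" and "\<not> (g \<le> Suc i \<and> Suc i < R)"
  shows "coordinates x v i = 0"
  using supp_blk[OF x v] assms(3) by (force simp: supp_def)

text \<open>Each interval is intersected with the window of v, and those with empty intersection
  contribute nothing. An interval starting before g now starts at g; this is a move to the right, so
  spreading keeps the index set in \<open>A\<close>. The new left ends stay distinct because a
  remaining interval ends after its new start and before the next old start.\<close>

lemma interval_sum_trim:
  assumes x: "basic K x" and A: "regular_family A" and F: "F \<in> A" "successive F r" and g: "1 \<le> g"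
    and v: "v \<in> blk x g R"
  shows "\<exists>F'\<in>A. \<exists>r'. successive F' r' \<and> F' \<subseteq> {g..<R} \<and> (\<forall>f\<in>F'. r' f \<le> R) \<and> interval_sum x F' r' v = interval_sum x F r v"
proof -
  have fF: "finite F" "0 \<notin> F" using F A regular_finite regular_zero by auto
  define B where "B = {f\<in>F. max f g < min (r f) R}"
  define \<phi> where "\<phi> f = max f g" for f
  have less: "r f \<le> f'" "\<phi> f < \<phi> f'" if "f \<in> B" "f' \<in> B" "f < f'" for f f'
  proof -
    show "r f \<le> f'" using that F(2) by (auto simp: B_def successive_def)
    then show "\<phi> f < \<phi> f'" using that by (auto simp: B_def \<phi>_def)
  qed
  then have mono: "strict_mono_on B \<phi>" by (auto simp: strict_mono_on_def)
  then have inj: "inj_on \<phi> B" by (rule strict_mono_on_imp_inj_on)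
  define r' where "r' k = min (r (the_inv_into B \<phi> k)) R" for k
  have r': "r' (\<phi> f) = min (r f) R" if "f \<in> B" for f
    using that by (simp add: r'_def the_inv_into_f_f[OF inj])
  have "\<phi> ` B \<in> A"
    by (rule regular_spread[OF A regular_subset[OF A F(1)] mono]) (auto simp: B_def \<phi>_def)
  moreover have "successive (\<phi> ` B) r'"
    unfolding successive_def
  proof (intro ballI impI)
    fix k k' assume k: "k \<in> \<phi> ` B" "k' \<in> \<phi> ` B" "k < k'"
    then obtain f f' where f: "f \<in> B" "f' \<in> B" "k = \<phi> f" "k' = \<phi> f'" by blast
    have "f < f'"
      using k(3) less(2)[OF f(2,1)] f by (cases f f' rule: linorder_cases) auto
    then show "r' k \<le> k'" using less(1)[OF f(1,2)] f r' by (auto simp: \<phi>_def)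
  qed
  moreover have "\<phi> ` B \<subseteq> {g..<R}" by (auto simp: B_def \<phi>_def)
  moreover have "\<forall>k\<in>\<phi> ` B. r' k \<le> R" using r' by auto
  moreover have "interval_sum x (\<phi> ` B) r' v = interval_sum x F r v"
  proof -
    have zero: "coordinates x v i = 0" if "\<not> (g \<le> Suc i \<and> Suc i < R)" for i
      using coordinates_blk[OF x v that] .
    have "interval_proj x (\<phi> f) (r' (\<phi> f)) v = interval_proj x f (r f) v" if "f \<in> B" for f
    proof -
      have f: "f - 1 \<le> max f g - 1" "min (r f) R - 1 \<le> r f - 1"
        by auto
      have "coordinates x v i = 0" if "i \<notin> {max f g - 1..<min (r f) R - 1}" "i \<in> {f - 1..<r f - 1}" for i
        using that by (intro zero) auto
      then show ?thesis
        unfolding interval_proj_def r'[OF that] unfolding \<phi>_def using f by (intro sum.mono_neutral_left) auto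
    qed
    then have "interval_sum x (\<phi> ` B) r' v = (\<Sum>f\<in>B. norm (interval_proj x f (r f) v))"
      by (simp add: interval_sum_def sum.reindex[OF inj])
    also have "\<dots> = interval_sum x F r v"
      unfolding interval_sum_def
    proof (rule sum.mono_neutral_left)
      show "\<forall>f\<in>F - B. norm (interval_proj x f (r f) v) = 0"
      proof
        fix f assume f: "f \<in> F - B"
        have "1 \<le> f" using f fF(2) by (cases f) auto
        have "coordinates x v i = 0" if "i \<in> {f - 1..<r f - 1}" for i
          using f that \<open>1 \<le> f\<close> by (intro zero) (auto simp: B_def)
        then show "norm (interval_proj x f (r f) v) = 0" by (simp add: interval_proj_def)
      qed
    qed (use fF in \<open>auto simp: B_def\<close>)
    finally show ?thesis .
  qed
  ultimately show ?thesis by blast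
qed

lemma coordinates_sum:
  assumes x: "basic K x" and "\<And>g. g \<in> G \<Longrightarrow> y g \<in> closed_span x"
  shows "coordinates x (\<Sum>g\<in>G. y g) i = (\<Sum>g\<in>G. coordinates x (y g) i)"
  using assms(2)
proof (induction G rule: infinite_finite_induct)
  case (insert h G)
  then have "(\<Sum>g\<in>G. y g) \<in> closed_span x" by (intro subspace_sum[OF subspace_closed_span]) auto
  then show ?case using insert by (simp add: coordinates_add[OF x])
qed (simp_all add: coordinates_zero[OF x])

text \<open>After trimming, the intervals for different g lie in disjoint windows, so their union is
  successive. It belongs to the composition with \<open>G\<close> as set of lower bounds, which need
  not be elements of the union.\<close>

lemma interval_sum_superadditive:
  assumes x: "basic K x" and S: "regular_family S" and A: "regular_family A" and G: "G \<in> S" "successive G R"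
    and y: "\<And>g. g \<in> G \<Longrightarrow> y g \<in> blk x g (R g)"
    and F: "\<And>g. g \<in> G \<Longrightarrow> F g \<in> A" "\<And>g. g \<in> G \<Longrightarrow> successive (F g) (r g)"
  shows "\<exists>F'\<in>fam_comp S A. \<exists>r'. successive F' r' \<and>
    interval_sum x F' r' (\<Sum>g\<in>G. y g) = (\<Sum>g\<in>G. interval_sum x (F g) (r g) (y g))"
proof -
  have fG: "finite G" "0 \<notin> G" using G S regular_finite regular_zero by auto
  have G1: "1 \<le> g" if "g \<in> G" for g using that fG(2) by (cases g) auto
  have "\<forall>g\<in>G. \<exists>F' r'. F' \<in> A \<and> successive F' r' \<and> F' \<subseteq> {g..<R g} \<and> (\<forall>f\<in>F'. r' f \<le> R g) \<and>
      interval_sum x F' r' (y g) = interval_sum x (F g) (r g) (y g)"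
    using interval_sum_trim[OF x A F G1 y] by blast
  then obtain F' r' where F': "\<And>g. g \<in> G \<Longrightarrow> F' g \<in> A" "\<And>g. g \<in> G \<Longrightarrow> successive (F' g) (r' g)"
    "\<And>g. g \<in> G \<Longrightarrow> F' g \<subseteq> {g..<R g}" "\<And>g f. g \<in> G \<Longrightarrow> f \<in> F' g \<Longrightarrow> r' g f \<le> R g"
    "\<And>g. g \<in> G \<Longrightarrow> interval_sum x (F' g) (r' g) (y g) = interval_sum x (F g) (r g) (y g)"
    by metis
  have sep: "h = g" if "g \<in> G" "h \<in> G" "g \<le> j" "j < R g" "h \<le> j" "j < R h" for g h j
    using that G(2) unfolding successive_def by (meson leD le_less_trans less_le_trans linorder_neqE_nat)
  have F'_range: "g \<le> f" "f < R g" if "g \<in> G" "f \<in> F' g" for g f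
    using F'(3)[OF that(1)] that(2) by auto
  have sepF: "h = g" if "g \<in> G" "h \<in> G" "f \<in> F' g" "f \<in> F' h" for g h f
    using sep[OF that(1,2)] F'_range that by blast
  define U where "U = (\<Union>g\<in>G. F' g)"
  define \<rho> where "\<rho> f = r' (SOME g. g \<in> G \<and> f \<in> F' g) f" for f
  have \<rho>: "\<rho> f = r' g f" if "g \<in> G" "f \<in> F' g" for g f
  proof -
    have "(SOME g. g \<in> G \<and> f \<in> F' g) = g"
      using that sepF by (intro some_equality) auto
    then show ?thesis by (simp add: \<rho>_def)
  qed
  have fin: "finite (F' g)" "0 \<notin> F' g" if "g \<in> G" for g
    using F'(1)[OF that] A regular_finite regular_zero by auto
  have "U \<in> fam_comp S A"
  proof (rule fam_comp_weakI[OF S A _ _ G(1)])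
    show "finite U" "0 \<notin> U" using fG fin by (auto simp: U_def)
    show "\<exists>g\<in>G. g \<le> f" if "f \<in> U" for f using that F'(3) by (force simp: U_def)
    fix g assume g: "g \<in> G"
    have "piece G U g \<subseteq> F' g"
    proof
      fix f assume f: "f \<in> piece G U g"
      then obtain h where h: "h \<in> G" "f \<in> F' h" by (auto simp: U_def piece_def)
      note hf = F'_range[OF this]
      have "\<not> g < h" using f hf(1) h(1) by (auto simp: piece_def)
      moreover have "\<not> h < g"
      proof
        assume "h < g"
        then have "R h \<le> g" using G(2) g h(1) by (auto simp: successive_def)
        then show False using f hf(2) by (auto simp: piece_def)
      qed
      ultimately have "h = g" by simp
      then show "f \<in> F' g" using h by simp
    qed
    then show "piece G U g \<in> A" using regular_subset[OF A F'(1)[OF g]] by blast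
  qed
  moreover have "successive U \<rho>"
    unfolding successive_def
  proof (intro ballI impI)
    fix f f' assume f: "f \<in> U" "f' \<in> U" "f < f'"
    then obtain g g' where g: "g \<in> G" "f \<in> F' g" "g' \<in> G" "f' \<in> F' g'" by (auto simp: U_def)
    consider "g = g'" | "g < g'" | "g' < g" by (rule linorder_cases)
    then show "\<rho> f \<le> f'"
    proof cases
      case 1
      then have "r' g f \<le> f'" using F'(2)[OF g(1)] g f(3) unfolding successive_def by blast
      then show ?thesis using \<rho>[OF g(1,2)] by simp
    next
      case 2
      have "\<rho> f \<le> R g" using \<rho>[OF g(1,2)] F'(4)[OF g(1,2)] by simp
      also have "R g \<le> g'" using G(2) g 2 by (auto simp: successive_def)
      also have "g' \<le> f'" by (rule F'_range(1)[OF g(3,4)])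
      finally show ?thesis .
    next
      case 3
      have "f' < R g'" by (rule F'_range(2)[OF g(3,4)])
      also have "R g' \<le> g" using G(2) g 3 by (auto simp: successive_def)
      also have "g \<le> f" by (rule F'_range(1)[OF g(1,2)])
      finally show ?thesis using f(3) by simp
    qed
  qed
  moreover have "interval_sum x U \<rho> (\<Sum>g\<in>G. y g) = (\<Sum>g\<in>G. interval_sum x (F g) (r g) (y g))"
  proof -
    have ysp: "y h \<in> closed_span x" if "h \<in> G" for h using y[OF that] blk_subset_closed_span by blast
    \<comment> \<open>Inside the window of g all other blocks have zero coordinates.\<close>
    have coord: "coordinates x (\<Sum>h\<in>G. y h) i = coordinates x (y g) i"
      if "g \<in> G" "g \<le> Suc i" "Suc i < R g" for g i
    proof -
      have "coordinates x (y h) i = 0" if "h \<in> G - {g}" for h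
        using that sep[of g h "Suc i"] \<open>g \<in> G\<close> \<open>g \<le> Suc i\<close> \<open>Suc i < R g\<close>
        by (intro coordinates_blk[OF x y]) auto
      then have "(\<Sum>h\<in>G. coordinates x (y h) i) = (\<Sum>h\<in>{g}. coordinates x (y h) i)"
        using fG(1) that(1) by (intro sum.mono_neutral_right) auto
      then show ?thesis by (simp add: coordinates_sum[OF x ysp])
    qed
    have projs: "interval_proj x f (\<rho> f) (\<Sum>g\<in>G. y g) = interval_proj x f (r' g f) (y g)" if g: "g \<in> G" "f \<in> F' g" for g f
    proof -
      have "g \<le> f" "r' g f \<le> R g" using F'_range(1) F'(4) g by auto
      moreover have "1 \<le> f" using F'_range(1)[OF g] G1[OF g(1)] by simp
      ultimately show ?thesis unfolding \<rho>[OF g] by (intro interval_proj_cong coord g) auto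
    qed
    have "interval_sum x U \<rho> (\<Sum>g\<in>G. y g) = (\<Sum>g\<in>G. interval_sum x (F' g) (r' g) (y g))"
    proof -
      have "\<forall>g\<in>G. \<forall>h\<in>G. g \<noteq> h \<longrightarrow> F' g \<inter> F' h = {}" using sepF by blast
      then have "interval_sum x U \<rho> (\<Sum>g\<in>G. y g) = (\<Sum>g\<in>G. \<Sum>f\<in>F' g. norm (interval_proj x f (\<rho> f) (\<Sum>g\<in>G. y g)))"
        unfolding interval_sum_def U_def using fin(1) by (intro sum.UNION_disjoint[OF fG(1)]) blast+
      also have "\<dots> = (\<Sum>g\<in>G. interval_sum x (F' g) (r' g) (y g))"
        unfolding interval_sum_def using projs by (intro sum.cong) auto
      finally show ?thesis .
    qed
    also have "\<dots> = (\<Sum>g\<in>G. interval_sum x (F g) (r g) (y g))" using F'(5) by (intro sum.cong) auto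
    finally show ?thesis .
  qed
  ultimately show ?thesis by blast
qed

lemma sum_Sup_le:
  fixes B :: "'b \<Rightarrow> real set"
  assumes "finite G" and ne: "\<And>g. g \<in> G \<Longrightarrow> B g \<noteq> {}"
    and le: "\<And>s. (\<And>g. g \<in> G \<Longrightarrow> s g \<in> B g) \<Longrightarrow> (\<Sum>g\<in>G. s g) \<le> t"
  shows "(\<Sum>g\<in>G. Sup (B g)) \<le> t"
proof (rule field_le_epsilon)
  fix e :: real assume e: "0 < e"
  \<comment> \<open>Each supremum is approximated up to an equal share of e; the summand 1 keeps the
    denominator positive for empty \<open>G\<close>.\<close>
  define e' where "e' = e / (1 + card G)"
  have e': "0 < e'" using e by (simp add: e'_def)
  have "\<forall>g\<in>G. \<exists>s. s \<in> B g \<and> Sup (B g) - e' < s"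
    using less_cSupD[OF ne, of _ "Sup (B _) - e'"] e' by (metis diff_less_eq less_add_same_cancel1)
  then obtain s where s: "\<And>g. g \<in> G \<Longrightarrow> s g \<in> B g" "\<And>g. g \<in> G \<Longrightarrow> Sup (B g) - e' < s g" by metis
  have "(\<Sum>g\<in>G. Sup (B g)) \<le> (\<Sum>g\<in>G. s g + e')"
    using s(2) by (intro sum_mono) (force simp: diff_less_eq intro: less_imp_le)
  also have "\<dots> = (\<Sum>g\<in>G. s g) + card G * e'" by (simp add: sum.distrib)
  also have "(\<Sum>g\<in>G. s g) \<le> t" by (rule le[OF s(1)])
  also have "card G * e' \<le> e" using e by (simp add: e'_def field_simps)
  finally show "(\<Sum>g\<in>G. Sup (B g)) \<le> t + e" by simp
qed

section \<open>Supremum over admissible intervals as an equivalent norm\<close>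

context
  fixes x :: "nat \<Rightarrow> 'a::real_normed_vector" and K C :: real and A :: "nat set set"
  assumes x: "basic K x" and A: "regular_family A"
    and bound: "\<And>F r u. F \<in> A \<Longrightarrow> successive F r \<Longrightarrow> u \<in> closed_span x \<Longrightarrow> interval_sum x F r u \<le> C * norm u"
begin

lemma interval_sum_le_interval_norm:
  assumes "F \<in> A" "successive F r" "u \<in> closed_span x"
  shows "interval_sum x F r u \<le> interval_norm x A u"
  unfolding interval_norm_def
  using assms bound by (intro cSup_upper bdd_aboveI[of _ "C * norm u"]) auto

lemma interval_norm_set_nonempty: "{interval_sum x F r u | F r. F \<in> A \<and> successive F r} \<noteq> {}"
  using regular_empty[OF A] by (auto simp: successive_def)

lemma interval_norm_least:
  assumes "\<And>F r. F \<in> A \<Longrightarrow> successive F r \<Longrightarrow> interval_sum x F r u \<le> t"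
  shows "interval_norm x A u \<le> t"
  unfolding interval_norm_def using assms interval_norm_set_nonempty by (intro cSup_least) auto

lemma interval_norm_bound: "u \<in> closed_span x \<Longrightarrow> interval_norm x A u \<le> C * norm u"
  using bound by (intro interval_norm_least)

lemma interval_norm_nonneg:
  assumes "u \<in> closed_span x"
  shows "0 \<le> interval_norm x A u"
  using interval_sum_le_interval_norm[OF regular_empty[OF A] _ assms, of id] by (simp add: interval_sum_def successive_def)

lemma interval_norm_add:
  assumes "u \<in> closed_span x" "v \<in> closed_span x"
  shows "interval_norm x A (u + v) \<le> interval_norm x A u + interval_norm x A v"
proof (rule interval_norm_least)
  fix F r assume "F \<in> A" "successive F r"
  then show "interval_sum x F r (u + v) \<le> interval_norm x A u + interval_norm x A v"
    using interval_sum_add[OF x assms, of F r] interval_sum_le_interval_norm[of F r] assms by (meson add_mono order_trans)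
qed

lemma interval_norm_scale:
  assumes u: "u \<in> closed_span x"
  shows "interval_norm x A (t *\<^sub>R u) = \<bar>t\<bar> * interval_norm x A u"
proof -
  have le: "interval_norm x A (t *\<^sub>R u) \<le> \<bar>t\<bar> * interval_norm x A u" if "u \<in> closed_span x" for t u
    using interval_sum_le_interval_norm that by (intro interval_norm_least) (simp add: interval_sum_scale[OF x that] mult_left_mono)
  show ?thesis
  proof (cases "t = 0")
    case True
    have "0 \<in> closed_span x" using u by (metis subspace_0 subspace_closed_span)
    then show ?thesis using True interval_norm_nonneg[of 0] le[OF u, of 0] by simp
  next
    case False
    have "t *\<^sub>R u \<in> closed_span x" using u subspace_closed_span subspace_scale by blast
    from le[OF this, of "1 / t"] have "\<bar>t\<bar> * interval_norm x A u \<le> interval_norm x A (t *\<^sub>R u)"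
      using False by (simp add: field_simps)
    then show ?thesis using le[OF u, of t] by simp
  qed
qed

text \<open>The single interval starting at 1 and ending at n is admissible and yields the n-th
  partial sum, which converges to u. No constant is lost.\<close>

lemma norm_le_interval_norm:
  assumes u: "u \<in> closed_span x"
  shows "norm u \<le> interval_norm x A u"
proof (rule LIMSEQ_le_const2)
  show "(\<lambda>n. norm (\<Sum>i<n. coordinates x u i *\<^sub>R x i)) \<longlonglongrightarrow> norm u"
    using coordinates_sums[OF x u] unfolding sums_def by (intro tendsto_intros)
  have "norm (\<Sum>i<n. coordinates x u i *\<^sub>R x i) \<le> interval_norm x A u" for n
    using interval_sum_le_interval_norm[OF regular_singleton[OF A, of 1] _ u, of "\<lambda>_. Suc n"]
    by (simp add: interval_sum_def successive_def interval_proj_def atLeast0LessThan)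
  then show "\<exists>N. \<forall>n\<ge>N. norm (\<Sum>i<n. coordinates x u i *\<^sub>R x i) \<le> interval_norm x A u" by blast
qed

end

text \<open>This is the link from one level to the next: near-optimal intervals for the blocks,
  chosen independently, are joined into one competitor for their sum.\<close>

lemma interval_norm_superadditive:
  assumes x: "basic K x" and S: "regular_family S" and A: "regular_family A"
    and bound: "\<And>F r u. F \<in> fam_comp S A \<Longrightarrow> successive F r \<Longrightarrow> u \<in> closed_span x \<Longrightarrow> interval_sum x F r u \<le> C * norm u"
    and G: "G \<in> S" "successive G R" and y: "\<And>g. g \<in> G \<Longrightarrow> y g \<in> blk x g (R g)"
  shows "(\<Sum>g\<in>G. interval_norm x A (y g)) \<le> interval_norm x (fam_comp S A) (\<Sum>g\<in>G. y g)"
  unfolding interval_norm_def[of x A]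
proof (rule sum_Sup_le)
  show "finite G" using regular_finite[OF S G(1)] .
  show "{interval_sum x F r (y g) | F r. F \<in> A \<and> successive F r} \<noteq> {}" for g
    using regular_empty[OF A] by (auto simp: successive_def)
  fix s assume "\<And>g. g \<in> G \<Longrightarrow> s g \<in> {interval_sum x F r (y g) | F r. F \<in> A \<and> successive F r}"
  then have "\<forall>g\<in>G. \<exists>F r. F \<in> A \<and> successive F r \<and> s g = interval_sum x F r (y g)" by blast
  then obtain F r where *: "\<And>g. g \<in> G \<Longrightarrow> F g \<in> A" "\<And>g. g \<in> G \<Longrightarrow> successive (F g) (r g)"
    "\<And>g. g \<in> G \<Longrightarrow> s g = interval_sum x (F g) (r g) (y g)" by metis
  obtain F' r' where F': "F' \<in> fam_comp S A" "successive F' r'"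
    "interval_sum x F' r' (\<Sum>g\<in>G. y g) = (\<Sum>g\<in>G. interval_sum x (F g) (r g) (y g))"
    using interval_sum_superadditive[OF x S A G, of y F r, OF y *(1,2)] by blast
  have "(\<Sum>g\<in>G. y g) \<in> closed_span x"
    using y blk_subset_closed_span by (intro subspace_sum[OF subspace_closed_span]) blast
  then have "interval_sum x F' r' (\<Sum>g\<in>G. y g) \<le> interval_norm x (fam_comp S A) (\<Sum>g\<in>G. y g)"
    using F' bound by (intro interval_sum_le_interval_norm[OF x regular_fam_comp[OF S A], where C=C])
  then show "(\<Sum>g\<in>G. s g) \<le> interval_norm x (fam_comp S A) (\<Sum>g\<in>G. y g)"
    using F'(3) *(3) by simp
qed

text \<open>Exact powers make the step from k to k+1 hold on the same sequence. The recursion puts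
  the new factor outside, as in the comparison of Schreier classes with ordinal sums.\<close>

primrec fam_power :: "nat set set \<Rightarrow> nat \<Rightarrow> nat set set" where
  "fam_power S 0 = schreier0"
| "fam_power S (Suc k) = fam_comp S (fam_power S k)"

lemma regular_fam_power: "regular_family S \<Longrightarrow> regular_family (fam_power S k)"
  by (induction k) (auto intro: regular_schreier0 regular_fam_comp)

lemma fam_power_mono:
  assumes "regular_family S" "k \<le> n"
  shows "fam_power S k \<subseteq> fam_power S n"
  using assms(2)
proof (induction n rule: dec_induct)
  case (step n)
  then show ?case using subset_fam_comp[OF assms(1) regular_fam_power[OF assms(1), of n]] by auto
qed simp

lemma fam_power_embeds:
  assumes a: "fundamental_sequences a"
  shows "fam_power (schreier a \<alpha>) n \<lesssim>\<^sub>F schreier a (omul \<alpha> n)"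
proof (induction n)
  case 0
  then show ?case by (simp add: schreier_zero embeds_subset)
next
  case (Suc n)
  from embeds_fam_comp[OF regular_schreier[OF a] this] fam_comp_schreier_embeds[OF a]
  show ?case by (auto intro: embeds_trans)
qed

text \<open>
  The weights are chosen such that the last summand, which has no successor to dominate it, is
  absorbed by the norm itself.
\<close>

lemma ex_norm_lower_estimate:
  assumes x: "basic K x" and S: "regular_family S" and n: "1 \<le> n"
    and le: "lower_estimate x norm (fam_power S n) \<theta>" "0 < \<theta>"
  shows "\<exists>p. equivalent_norm (closed_span x) p \<and> lower_estimate x p S (root n (\<theta> / (2 * K\<^sup>2)))"
proof -
  have K: "1 \<le> K" by (rule basic_ge_1[OF x])
  define C where "C = 2 * K\<^sup>2 / \<theta>"
  have C: "0 < C" using K le(2) by (simp add: C_def)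
  define \<eta> where "\<eta> = root n (\<theta> / (2 * K\<^sup>2))"
  \<comment> \<open>C bounds every level up to n relative to the norm; hence the weighted n-th level
    is at most the norm, and so at most \<open>h 0\<close>.\<close>
  have \<eta>: "0 < \<eta>" "\<eta> ^ n * C = 1"
    using n K le(2) by (auto simp: \<eta>_def C_def)
  define h where "h k = interval_norm x (fam_power S k)" for k
  note reg = regular_fam_power[OF S]
  have bound: "interval_sum x F r u \<le> C * norm u"
    if "k \<le> n" "F \<in> fam_power S k" "successive F r" "u \<in> closed_span x" for k F r u
  proof -
    have "F \<in> fam_power S n" using fam_power_mono[OF S that(1)] that(2) by blast
    then show ?thesis
      unfolding C_def using that(3,4) regular_finite[OF reg] regular_zero[OF reg] le
      by (intro interval_sum_le[OF x])
  qed
  note fam = interval_norm_bound interval_norm_nonneg interval_norm_add interval_norm_scale norm_le_interval_norm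
  have h: "h k u \<le> C * norm u" "0 \<le> h k u" "norm u \<le> h k u"
    "h k (t *\<^sub>R u) = \<bar>t\<bar> * h k u" "v \<in> closed_span x \<Longrightarrow> h k (u + v) \<le> h k u + h k v"
    if "k \<le> n" "u \<in> closed_span x" for k u v t
    unfolding h_def using fam[OF x reg bound[OF that(1)]] that(2) by auto
  define p where "p u = (\<Sum>k<n. \<eta> ^ k * h k u)" for u
  have p_ge: "h 0 u \<le> p u" if "u \<in> closed_span x" for u
  proof -
    have "(\<Sum>k\<in>{0}. \<eta> ^ k * h k u) \<le> p u"
      unfolding p_def using n \<eta>(1) h(2) that by (intro sum_mono2) auto
    then show ?thesis by simp
  qed
  have "equivalent_norm (closed_span x) p"
    unfolding equivalent_norm_def
  proof (intro conjI ballI allI)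
    fix u assume u: "u \<in> closed_span x"
    show "p (u + v) \<le> p u + p v" if v: "v \<in> closed_span x" for v
    proof -
      have "p (u + v) \<le> (\<Sum>k<n. \<eta> ^ k * (h k u + h k v))"
        unfolding p_def using \<eta>(1) h(5) u v by (intro sum_mono mult_left_mono) auto
      then show ?thesis by (simp add: p_def distrib_left sum.distrib)
    qed
    show "p (t *\<^sub>R u) = \<bar>t\<bar> * p u" for t
      unfolding p_def sum_distrib_left using h(4) u by (intro sum.cong) auto
  next
    show "\<exists>c>0. \<exists>C>0. \<forall>u\<in>closed_span x. c * norm u \<le> p u \<and> p u \<le> C * norm u"
    proof (intro exI conjI ballI)
      show "0 < (1::real)" by simp
      show "0 < (\<Sum>k<n. \<eta> ^ k * C)"
        using n \<eta>(1) C by (intro sum_pos) (auto simp: lessThan_empty_iff)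
      fix u assume u: "u \<in> closed_span x"
      show "1 * norm u \<le> p u" using h(3)[OF _ u, of 0] p_ge[OF u] by simp
      show "p u \<le> (\<Sum>k<n. \<eta> ^ k * C) * norm u"
        unfolding p_def sum_distrib_right mult.assoc
        using \<eta>(1) h(1) u by (intro sum_mono mult_left_mono) auto
    qed
  qed
  moreover have "lower_estimate x p S \<eta>"
  proof (rule lower_estimateI)
    fix G R y
    assume G: "G \<in> S" and R: "\<And>f f'. f \<in> G \<Longrightarrow> f' \<in> G \<Longrightarrow> f < f' \<Longrightarrow> R f \<le> (f'::nat)"
      and y: "\<And>f. f \<in> G \<Longrightarrow> y f \<in> blk x f (R f)"
    define Y where "Y = (\<Sum>g\<in>G. y g)"
    have Y: "Y \<in> closed_span x"
      unfolding Y_def using y blk_subset_closed_span by (intro subspace_sum[OF subspace_closed_span]) blast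
    have step: "(\<Sum>g\<in>G. h k (y g)) \<le> h (Suc k) Y" if "k < n" for k
      unfolding h_def Y_def fam_power.simps
      using bound[of "Suc k"] that R y
      by (intro interval_norm_superadditive[OF x S reg _ G, where C=C and R=R]) (auto simp: successive_def)
    have "\<eta> * (\<Sum>g\<in>G. p (y g)) = (\<Sum>k<n. \<eta> ^ Suc k * (\<Sum>g\<in>G. h k (y g)))"
    proof -
      have "(\<Sum>g\<in>G. p (y g)) = (\<Sum>k<n. \<Sum>g\<in>G. \<eta> ^ k * h k (y g))"
        unfolding p_def by (rule sum.swap)
      then show ?thesis by (simp add: sum_distrib_left mult.assoc)
    qed
    also have "\<dots> \<le> (\<Sum>k<n. \<eta> ^ Suc k * h (Suc k) Y)"
      using step \<eta>(1) by (intro sum_mono mult_left_mono) auto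
    also have "\<dots> = (\<Sum>k<Suc n. \<eta> ^ k * h k Y) - h 0 Y"
      by (subst sum.lessThan_Suc_shift) simp
    also have "\<dots> = p Y + (\<eta> ^ n * h n Y - h 0 Y)"
      by (simp add: p_def)
    also have "\<eta> ^ n * h n Y \<le> \<eta> ^ n * (C * norm Y)"
      using \<eta>(1) h(1)[OF _ Y, of n] by (intro mult_left_mono) auto
    also have "\<eta> ^ n * (C * norm Y) = norm Y"
      using \<eta>(2) by (simp add: mult.assoc[symmetric])
    also have "norm Y \<le> h 0 Y" using h(3)[OF _ Y] by simp
    finally show "\<eta> * (\<Sum>g\<in>G. p (y g)) \<le> p (\<Sum>g\<in>G. y g)" by (simp add: Y_def)
  qed
  ultimately show ?thesis by (auto simp: \<eta>_def)
qed

text \<open>The extension is the infimal convolution of \<open>p\<close> with a multiple of the norm.\<close>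

lemma equivalent_norm_extend:
  fixes X Y :: "'a::real_normed_vector set"
  assumes p: "equivalent_norm X p" and X: "subspace X" and Y: "subspace Y" "X \<subseteq> Y"
  shows "\<exists>q. equivalent_norm Y q \<and> (\<forall>v\<in>X. q v = p v)"
proof -
  obtain c C where c: "c > 0" "C > 0" "\<And>u. u \<in> X \<Longrightarrow> c * norm u \<le> p u" "\<And>u. u \<in> X \<Longrightarrow> p u \<le> C * norm u"
    using p unfolding equivalent_norm_def by metis
  note pn = equivalent_normD[OF p]
  have X0: "0 \<in> X" using X by (rule subspace_0)
  define B where "B u = (\<lambda>v. p v + C * norm (u - v)) ` X" for u
  define q where "q u = Inf (B u)" for u
  have nonneg: "0 \<le> p v + C * norm (u - v)" if "v \<in> X" for u v
    using pn(3)[OF that] c(2) by simp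
  have q_le: "q u \<le> p v + C * norm (u - v)" if "v \<in> X" for u v
    unfolding q_def B_def using that nonneg
    by (intro cInf_lower bdd_belowI[of _ 0]) auto
  have q_ge: "t \<le> q u" if "\<And>v. v \<in> X \<Longrightarrow> t \<le> p v + C * norm (u - v)" for t u
    unfolding q_def B_def using that X0 by (intro cInf_greatest) auto
  have hom_le: "q (t *\<^sub>R u) \<le> \<bar>t\<bar> * q u" if t: "t \<noteq> 0" for t u
  proof -
    have "q (t *\<^sub>R u) / \<bar>t\<bar> \<le> q u"
    proof (rule q_ge)
      fix v assume v: "v \<in> X"
      have "q (t *\<^sub>R u) \<le> p (t *\<^sub>R v) + C * norm (t *\<^sub>R u - t *\<^sub>R v)"
        using v X by (intro q_le subspace_scale)
      also have "\<dots> = \<bar>t\<bar> * (p v + C * norm (u - v))"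
        using pn(2)[OF v, of t] norm_scaleR[of t "u - v"]
        by (simp add: scaleR_diff_right distrib_left)
      finally show "q (t *\<^sub>R u) / \<bar>t\<bar> \<le> p v + C * norm (u - v)"
        using t by (simp add: pos_divide_le_eq mult.commute)
    qed
    then show ?thesis using t by (simp add: pos_divide_le_eq mult.commute)
  qed
  \<comment> \<open>The factor C is chosen for this: as p is at most C times the norm on
    \<open>X\<close>, replacing v by another w in \<open>X\<close> cannot lower the value.\<close>
  have ext: "q v = p v" if v: "v \<in> X" for v
  proof (rule antisym)
    show "q v \<le> p v" using q_le[OF v, of v] by simp
    show "p v \<le> q v"
    proof (rule q_ge)
      fix w assume w: "w \<in> X"
      have vw: "v - w \<in> X" using v w X by (rule subspace_diff[rotated])
      have "p v \<le> p w + p (v - w)" using pn(1)[OF w vw] by simp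
      also have "p (v - w) \<le> C * norm (v - w)" by (rule c(4)[OF vw])
      finally show "p v \<le> p w + C * norm (v - w)" by simp
    qed
  qed
  have "equivalent_norm Y q"
    unfolding equivalent_norm_def
  proof (intro conjI ballI allI)
    fix u v
    have "q (u + v) - q v \<le> q u"
    proof (rule q_ge)
      fix v1 assume v1: "v1 \<in> X"
      have "q (u + v) - (p v1 + C * norm (u - v1)) \<le> q v"
      proof (rule q_ge)
        fix v2 assume v2: "v2 \<in> X"
        have "q (u + v) \<le> p (v1 + v2) + C * norm (u + v - (v1 + v2))"
          using v1 v2 X by (intro q_le subspace_add)
        also have "norm (u + v - (v1 + v2)) \<le> norm (u - v1) + norm (v - v2)"
          using norm_triangle_ineq[of "u - v1" "v - v2"] by (simp add: algebra_simps)
        also have "p (v1 + v2) \<le> p v1 + p v2" by (rule pn(1)[OF v1 v2])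
        finally show "q (u + v) - (p v1 + C * norm (u - v1)) \<le> p v2 + C * norm (v - v2)"
          using c(2) by (simp add: algebra_simps)
      qed
      then show "q (u + v) - q v \<le> p v1 + C * norm (u - v1)" by simp
    qed
    then show "q (u + v) \<le> q u + q v" by simp
  next
    fix u t
    show "q (t *\<^sub>R u) = \<bar>t\<bar> * q u"
    proof (cases "t = 0")
      case True
      then show ?thesis using ext[OF X0] pn(5)[OF X0] by simp
    next
      case False
      then have "\<bar>t\<bar> * q u \<le> q (t *\<^sub>R u)"
        using hom_le[of "1 / t" "t *\<^sub>R u"] by (simp add: field_simps)
      then show ?thesis using hom_le[OF False, of u] by simp
    qed
  next
    show "\<exists>c>0. \<exists>C>0. \<forall>u\<in>Y. c * norm u \<le> q u \<and> q u \<le> C * norm u"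
    proof (intro exI conjI ballI)
      show "0 < min c C" "0 < C" using c by auto
      fix u
      show "q u \<le> C * norm u" using q_le[OF X0, of u] pn(5)[OF X0] by simp
      show "min c C * norm u \<le> q u"
      proof (rule q_ge)
        fix v assume v: "v \<in> X"
        have "min c C * norm u \<le> min c C * (norm v + norm (u - v))"
          using c norm_triangle_sub[of u v] by (intro mult_left_mono) auto
        also have "\<dots> \<le> c * norm v + C * norm (u - v)"
          unfolding distrib_left by (intro add_mono mult_right_mono) auto
        finally show "min c C * norm u \<le> p v + C * norm (u - v)" using c(3)[OF v] by simp
      qed
    qed
  qed
  then show ?thesis using ext by blast
qed

lemma lower_estimate_cong:
  assumes "lower_estimate x p S d" "\<And>v. v \<in> closed_span x \<Longrightarrow> q v = p v"
  shows "lower_estimate x q S d"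
proof (rule lower_estimateI)
  fix F r u
  assume *: "F \<in> S" "\<And>f f'. f \<in> F \<Longrightarrow> f' \<in> F \<Longrightarrow> f < f' \<Longrightarrow> r f \<le> (f'::nat)"
    "\<And>f. f \<in> F \<Longrightarrow> u f \<in> blk x f (r f)"
  have u: "u f \<in> closed_span x" if "f \<in> F" for f using *(3)[OF that] blk_subset_closed_span by blast
  then have "(\<Sum>f\<in>F. u f) \<in> closed_span x" by (intro subspace_sum[OF subspace_closed_span])
  then show "d * (\<Sum>f\<in>F. q (u f)) \<le> q (\<Sum>f\<in>F. u f)"
    using lower_estimateD[OF assms(1) *] u assms(2) by simp
qed

section \<open>The upper bound in (a)\<close>

context
  fixes a :: "omega1 \<Rightarrow> nat \<Rightarrow> omega1" and y :: "nat \<Rightarrow> 'a::real_normed_vector" and K :: real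
    and \<gamma> :: "omega1 \<Rightarrow> real"
  assumes a: "fundamental_sequences a" and y: "basic K y" and st: "Delta_stabilizes a y \<gamma>"
begin

lemma stable_le_const_ddot_power:
  assumes n: "1 \<le> n"
  shows "\<gamma> (omul \<alpha> n) \<le> 2 * K\<^sup>2 * delta_ddot a \<alpha> y ^ n"
proof -
  have K: "1 \<le> K" by (rule basic_ge_1[OF y])
  note reg = regular_schreier[OF a]
  have main: "\<theta> \<le> 2 * K\<^sup>2 * delta_ddot a \<alpha> y ^ n" if \<theta>: "0 < \<theta>" "\<theta> < \<gamma> (omul \<alpha> n)" for \<theta>
  proof -
    obtain \<sigma> x where x: "blocks_via \<sigma> y x" "\<theta> < delta a (omul \<alpha> n) x norm"
      using stable_less_delta[OF a y st blocks_via_self[OF basic_nonzero[OF y]] \<theta>(2)] by blast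
    note bx = basic_blocks[OF y x(1)]
    define d where "d = delta a (omul \<alpha> n) x norm"
    have d: "0 < d" using x(2) \<theta>(1) by (simp add: d_def)
    have "lower_estimate x norm (schreier a (omul \<alpha> n)) d"
      unfolding d_def by (rule delta_lower_estimate[OF a bx equivalent_norm_norm])
    from embeds_lower_estimate[OF bx fam_power_embeds[OF a] this]
    obtain \<tau> z where z: "blocks_via \<tau> x z" "lower_estimate z norm (fam_power (schreier a \<alpha>) n) d"
      by blast
    note bz = basic_blocks[OF bx z(1)]
    have yz: "blocks_via (\<lambda>i. \<sigma> (\<tau> i)) y z" by (rule blocks_via_trans[OF x(1) z(1)])
    define \<eta> where "\<eta> = root n (d / (2 * K\<^sup>2))"
    have \<eta>: "0 \<le> \<eta>" "\<eta> ^ n = d / (2 * K\<^sup>2)" using n d K by (auto simp: \<eta>_def)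
    obtain p where p: "equivalent_norm (closed_span z) p" "lower_estimate z p (schreier a \<alpha>) \<eta>"
      using ex_norm_lower_estimate[OF bz reg n z(2) d] by (auto simp: \<eta>_def)
    \<comment> \<open>p is defined only as a norm on the block subspace, while the supremum ranges
      over equivalent norms on the closed span of \<open>y\<close>.\<close>
    obtain q where q: "equivalent_norm (closed_span y) q" "\<And>v. v \<in> closed_span z \<Longrightarrow> q v = p v"
      using equivalent_norm_extend[OF p(1) subspace_closed_span subspace_closed_span closed_span_blocks[OF yz]]
      by blast
    have "\<eta> \<le> delta a \<alpha> z q"
      using q by (intro delta_upper[OF a bz] \<eta>(1) lower_estimate_cong[OF p(2)]
          equivalent_norm_mono[OF q(1) closed_span_blocks[OF yz]])
    also have "\<dots> \<le> delta_ddot a \<alpha> y" by (rule delta_le_ddot[OF a y q(1) yz])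
    finally have "\<eta> ^ n \<le> delta_ddot a \<alpha> y ^ n" using \<eta>(1) by (intro power_mono)
    then have "d \<le> 2 * K\<^sup>2 * delta_ddot a \<alpha> y ^ n"
      unfolding \<eta>(2) using K by (simp add: field_simps)
    then show ?thesis using x(2) by (simp add: d_def)
  qed
  show ?thesis
  proof (cases "\<gamma> (omul \<alpha> n) \<le> 0")
    case True
    have "0 \<le> 2 * K\<^sup>2 * delta_ddot a \<alpha> y ^ n" using delta_ddot_nonneg[OF a y] by simp
    then show ?thesis using True by linarith
  next
    case False
    then have "0 < \<gamma> (omul \<alpha> n)" by simp
    then show ?thesis by (rule dense_le_bounded) (rule main)
  qed
qed

text \<open>Were the stable value g larger than b, the powers of g / b would be unbounded. Applied
  at exponent n k, the previous bound keeps them below \<open>2 * K\<^sup>2\<close>, with the same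
  \<open>K\<close> for all k.\<close>

lemma stable_le_ddot_power:
  assumes n: "1 \<le> n"
  shows "\<gamma> (omul \<alpha> n) \<le> delta_ddot a \<alpha> y ^ n"
proof (rule ccontr)
  define b where "b = delta_ddot a \<alpha> y ^ n"
  define g where "g = \<gamma> (omul \<alpha> n)"
  assume "\<not> \<gamma> (omul \<alpha> n) \<le> delta_ddot a \<alpha> y ^ n"
  then have bg: "b < g" by (simp add: b_def g_def)
  have b0: "0 \<le> b" using delta_ddot_nonneg[OF a y] by (simp add: b_def)
  have le: "g ^ k \<le> 2 * K\<^sup>2 * b ^ k" if "1 \<le> k" for k
  proof -
    have "g ^ k \<le> \<gamma> (omul \<alpha> (n * k))" unfolding g_def by (rule stable_power[OF a y st that])
    also have "\<dots> \<le> 2 * K\<^sup>2 * delta_ddot a \<alpha> y ^ (n * k)"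
      using n that by (intro stable_le_const_ddot_power) simp
    finally show ?thesis by (simp add: b_def power_mult)
  qed
  \<comment> \<open>For b = 0 the case k = 1 would force g to be at most 0, against b < g.\<close>
  have "b \<noteq> 0" using le[of 1] bg by auto
  then have b: "0 < b" using b0 by simp
  then have "1 < g / b" using bg by simp
  then obtain k where k: "2 * K\<^sup>2 < (g / b) ^ k" using real_arch_pow by blast
  have "(g / b) ^ k \<le> 2 * K\<^sup>2" if "1 \<le> k" for k
    using le[OF that] b by (simp add: power_divide pos_divide_le_eq)
  moreover have "1 \<le> K\<^sup>2" using basic_ge_1[OF y] by (rule one_le_power)
  then have "1 < 2 * K\<^sup>2" by linarith
  then have "1 \<le> k" using k by (cases k) auto
  ultimately show False using k by (meson leD)
qed

end

theorem theorem6p8: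
  fixes a :: "omega1 \<Rightarrow> nat \<Rightarrow> omega1"
    and e y :: "nat \<Rightarrow> 'a::banach"
    and \<gamma> :: "omega1 \<Rightarrow> real"
    and D :: real
    and \<alpha> :: omega1
    and n m :: nat
  assumes "fundamental_sequences a"
    and "schauder_basis e"
    and "asymptotic_l1 e"
    and "\<gamma> \<in> Delta_set a e"
    and "block_basis y e"
    and "Delta_stabilizes a y \<gamma>"
    and "bounded_distortion D (closed_span y)"
    and "1 \<le> n" and "1 \<le> m"
  shows "(inverse D * delta_ddot a \<alpha> y ^ n \<le> \<gamma> (omul \<alpha> n) \<and>
          \<gamma> (omul \<alpha> n) \<le> delta_ddot a \<alpha> y ^ n) \<and>
         (\<gamma> (omul \<alpha> n) * \<gamma> (omul \<alpha> m) \<le> \<gamma> (omul \<alpha> (n + m)) \<and>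
          \<gamma> (omul \<alpha> (n + m)) \<le> D ^ 2 * \<gamma> (omul \<alpha> n) * \<gamma> (omul \<alpha> m))"
proof -
  obtain K where "basic K e"
    using asymptotic_l1_basic assms(2,3) by blast
  then obtain \<sigma> where "blocks_via \<sigma> e y"
    using assms(5) block_basis_iff_blocks_via by blast
  then have y: "basic K y"
    using basic_blocks \<open>basic K e\<close> by blast
  note a = assms(1) and st = assms(6) and D = assms(7)
  have D1: "1 \<le> D"
    by (rule delta_ddot_power_le(2)[OF a y st D assms(8)])
  define d where "d = delta_ddot a \<alpha> y"
  have d: "0 \<le> d" unfolding d_def by (rule delta_ddot_nonneg[OF a y])
  have lower: "d ^ k \<le> D * \<gamma> (omul \<alpha> k)" if "1 \<le> k" for k
    unfolding d_def by (rule delta_ddot_power_le(1)[OF a y st D that])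
  have upper: "\<gamma> (omul \<alpha> k) \<le> d ^ k" if "1 \<le> k" for k
    unfolding d_def by (rule stable_le_ddot_power[OF a y st that])
  have "inverse D * d ^ n \<le> \<gamma> (omul \<alpha> n)"
    using lower[OF assms(8)] D1 by (simp add: field_simps)
  moreover have "\<gamma> (omul \<alpha> n) * \<gamma> (omul \<alpha> m) \<le> \<gamma> (omul \<alpha> (n + m))"
    unfolding omul_add by (rule stable_mult[OF a y st])
  moreover have "\<gamma> (omul \<alpha> (n + m)) \<le> D ^ 2 * \<gamma> (omul \<alpha> n) * \<gamma> (omul \<alpha> m)"
  proof -
    have "\<gamma> (omul \<alpha> (n + m)) \<le> d ^ n * d ^ m"
      using upper[of "n + m"] assms(8) by (simp add: power_add)
    also have "\<dots> \<le> (D * \<gamma> (omul \<alpha> n)) * (D * \<gamma> (omul \<alpha> m))"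
      using d D1 lower[OF assms(8)] lower[OF assms(9)] stable_nonneg[OF a y st]
      by (intro mult_mono) auto
    finally show ?thesis by (simp add: power2_eq_square mult_ac)
  qed
  ultimately show ?thesis
    using upper[OF assms(8)] by (simp add: d_def)
qed

end
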